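(* Let $U\ni 0$ and $W$ be domains in $\mathbb{C}$, let $f:W\times U\to\mathbb{C}$, $(\lambda,z)\mapsto f_\lambda(z)$, be a family of functions and let $\alpha_0$ be an irrational real number such that: (1) $f_\lambda(z)$ depends analytically on both the variable $z\in U$ and the parameter $\lambda\in W$; (2) $f_\lambda(0)=0$ and $f_\lambda'(0)=\lambda$ for all $\lambda\in W$; (3) $\lambda_0:=\exp(2\pi i\alpha_0)\in W$ and the function $f_{\lambda_0}$ has a Siegel point at $0$, with $S:=\mathcal{A}^*(0,f_{\lambda_0},U)$ lying in $U$ along with its boundary $\partial S$. Let $\psi:\mathbb{D}\to S$ be the inverse of the conformal mapping $\varphi$ of $S$ onto the unit disk $\mathbb{D}$ with $\varphi(0)=0$, $\varphi'(0)>0$, and let $S_r:=\psi(r\mathbb{D})$. Let $\gamma>\gamma_0:=1+\max\{\beta_\psi(1),\beta_\psi(-1)\}$. Then for any Stolz angle $\Delta$ at the point $\lambda_0$ there exist a constant $C>0$ and a function $\varepsilon:(0,1)\to(0,+\infty)$ such that for any $r\in(0,1)$ the following statements are true: (i) $S_r\subset\mathcal{A}^*(0,f_\lambda,U)$ for all $\lambda\in W\cap\Delta$ satisfying $|\lambda-\lambda_0|<\varepsilon(r)$; (ii) $\varepsilon(r)\ge C(1-r)^3/\ell\big((1-r)^{-\gamma}\big)$.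
   Context: Here $\mathbb{N}=\{1,2,\dots\}$, $\mathbb{D}$ is the open unit disk, and $f_\lambda'$ is the derivative with respect to $z$. The boundary $\partial S$ is taken in the Riemann sphere, so $\overline S$ is a compact subset of $U$ and in particular $S$ is bounded. Iterates and Fatou set. For a domain $U\subset\mathbb{C}$ and an analytic function $f:U\to\mathbb{C}$, the iterates are $f^0=\mathrm{id}_U$, $f^1=f$, $f^{n+1}:(f^n)^{-1}(U)\to\mathbb{C}$, $f^{n+1}:=f\circ f^n$. Put $E(f,U):=\bigcap_{n\in\mathbb{N}}(f^n)^{-1}(U)$. The Fatou set $\mathcal{F}(f,U)$ is the set of all interior points $z$ of $E(f,U)$ such that $\{f^n\}_{n\in\mathbb{N}}$ is a normal family (as maps into the Riemann sphere) in some neighbourhood of $z$. The Julia set is $\mathcal{J}(f,U)=U\setminus\mathcal{F}(f,U)$. Siegel points and immediate basins. A fixed point $z_0$ of $f$ is a Siegel point if $f'(z_0)=e^{2\pi i\alpha}$ with $\alpha\in\mathbb{R}\setminus\mathbb{Q}$ and $z_0\in\mathcal{F}(f,U)$. For a fixed point $z_0\in\mathcal{F}(f,U)$, the immediate basin $\mathcal{A}^*(z_0,f,U)$ is the connected component of $\mathcal{F}(f,U)$ containing $z_0$; for a fixed point $z_0\in\mathcal{J}(f,U)$ one puts $\mathcal{A}^*(z_0,f,U):=\{z_0\}$. It is known that the Siegel disk $S$ is mapped conformally onto $\mathbb{D}$ by a map $\varphi$ as in the statement, and $\varphi\circ f_{\lambda_0}=\lambda_0\varphi$ on $S$. Stolz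 angle. A Stolz angle at $\lambda_0$ (with respect to the unit disk) is a set $\{\lambda:|\arg(1-\lambda/\lambda_0)|<\Theta,\ 0<|\lambda-\lambda_0|<\rho\}$ contained in $\mathbb{D}$, with $0<\Theta<\pi/2$ and $\rho>0$. Continued fractions. Let $p_n/q_n$ be the $n$-th convergent of the continued fraction expansion of $\alpha_0$ (with $p_0/q_0=\lfloor\alpha_0\rfloor/1$). For $x>0$ put $$n_0(x):=\min\Big\{n\in\mathbb{N}:\frac{2q_nq_{n+1}}{q_n+q_{n+1}}\ge x\Big\},\qquad \ell(x):=q_{n_0(x)}.$$ Integral means spectrum. For real $t$, $$\beta_\psi(t):=\limsup_{r\to1-}\frac{\log\int_0^{2\pi}|\psi'(re^{i\theta})|^t\,d\theta}{-\log(1-r)}.$$ *)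

theory Defs
  imports "HOL-Analysis.Analysis" "HOL-Complex_Analysis.Complex_Analysis"
begin

text \<open>Complex differentiability of a function of two complex variables: the total derivative
  exists at every point of \<open>W \<times> U\<close> and is complex linear.\<close>

definition analytic_family :: "(complex \<Rightarrow> complex \<Rightarrow> complex) \<Rightarrow> complex set \<Rightarrow> complex set \<Rightarrow> bool"
  where "analytic_family f W U \<longleftrightarrow>
    (\<forall>l\<in>W. \<forall>z\<in>U. \<exists>a b.
      ((\<lambda>(l, z). f l z) has_derivative (\<lambda>(h, k). a * h + b * k)) (at (l, z)))"

text \<open>The Riemann sphere is the unit sphere of \<open>\<complex> \<times> \<real>\<close>, with \<open>\<infinity>\<close> the north pole \<open>(0, 1)\<close>; the
  plane is embedded by inverse stereographic projection, so that the Euclidean distance of images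
  is the chordal distance.\<close>

definition riemann_sphere :: "(complex \<times> real) topology"
  where "riemann_sphere = top_of_set (sphere 0 1)"

definition to_sphere :: "complex \<Rightarrow> complex \<times> real"
  where "to_sphere z =
    ((2 / (1 + (cmod z)\<^sup>2)) *\<^sub>R z, ((cmod z)\<^sup>2 - 1) / (1 + (cmod z)\<^sup>2))"

text \<open>Normality as maps into the sphere; the limit \<open>g\<close> may take the value \<open>\<infinity>\<close>.\<close>

definition normal_family :: "complex set \<Rightarrow> (complex \<Rightarrow> complex) set \<Rightarrow> bool"
  where "normal_family V F \<longleftrightarrow>
    (\<forall>s :: nat \<Rightarrow> complex \<Rightarrow> complex. range s \<subseteq> F \<longrightarrow>
      (\<exists>r g. strict_mono r \<and>
        (\<forall>K. compact K \<and> K \<subseteq> V \<longrightarrow>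
          uniform_limit K (\<lambda>n z. to_sphere (s (r n) z)) g sequentially)))"

text \<open>The domain of the \<open>n\<close>-th iterate of the partial map \<open>f : U \<rightarrow> \<complex>\<close>. A HOL function is total, so
  \<open>(f ^^ n) z\<close> is meaningful only for \<open>z \<in> iter_dom f U n\<close>, where it does not depend on the
  values of \<open>f\<close> outside \<open>U\<close>. The set \<open>(f\<^sup>n)\<^sup>-\<^sup>1(U)\<close> is \<open>iter_dom f U (Suc n)\<close>.\<close>

fun iter_dom :: "(complex \<Rightarrow> complex) \<Rightarrow> complex set \<Rightarrow> nat \<Rightarrow> complex set"
  where
    "iter_dom f U 0 = U"
  | "iter_dom f U (Suc n) = {z \<in> iter_dom f U n. (f ^^ n) z \<in> U}"

definition iter_set :: "(complex \<Rightarrow> complex) \<Rightarrow> complex set \<Rightarrow> complex set"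
  where "iter_set f U = (\<Inter>n\<in>{1..}. iter_dom f U (Suc n))"

definition fatou :: "(complex \<Rightarrow> complex) \<Rightarrow> complex set \<Rightarrow> complex set"
  where "fatou f U =
    {z \<in> interior (iter_set f U).
      \<exists>V. open V \<and> z \<in> V \<and> V \<subseteq> iter_set f U \<and> normal_family V {f ^^ n |n. n \<ge> 1}}"

definition siegel_point :: "(complex \<Rightarrow> complex) \<Rightarrow> complex set \<Rightarrow> complex \<Rightarrow> bool"
  where "siegel_point f U z0 \<longleftrightarrow>
    f z0 = z0 \<and> (\<exists>\<alpha>::real. \<alpha> \<notin> \<rat> \<and> deriv f z0 = exp (2 * pi * \<i> * \<alpha>)) \<and> z0 \<in> fatou f U"

text \<open>Only used for fixed points \<open>z0 \<in> U\<close>; the second case is then \<open>z0\<close> in the Julia set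
  \<open>U - fatou f U\<close>.\<close>

definition immediate_basin :: "complex \<Rightarrow> (complex \<Rightarrow> complex) \<Rightarrow> complex set \<Rightarrow> complex set"
  where "immediate_basin z0 f U =
    (if z0 \<in> fatou f U then connected_component_set (fatou f U) z0 else {z0})"

definition stolz_angle :: "complex \<Rightarrow> complex set \<Rightarrow> bool"
  where "stolz_angle l0 D \<longleftrightarrow>
    (\<exists>\<Theta> \<rho>. 0 < \<Theta> \<and> \<Theta> < pi / 2 \<and> 0 < \<rho> \<and>
      D = {l. \<bar>Arg (1 - l / l0)\<bar> < \<Theta> \<and> 0 < cmod (l - l0) \<and> cmod (l - l0) < \<rho>} \<and>
      D \<subseteq> ball 0 1)"

text \<open>Complete quotients, partial quotients and convergent denominators of the (infinite) continued
  fraction of an irrational number.\<close>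

fun cf_rem :: "real \<Rightarrow> nat \<Rightarrow> real"
  where
    "cf_rem \<alpha> 0 = \<alpha>"
  | "cf_rem \<alpha> (Suc n) = 1 / frac (cf_rem \<alpha> n)"

definition cf_coeff :: "real \<Rightarrow> nat \<Rightarrow> int"
  where "cf_coeff \<alpha> n = \<lfloor>cf_rem \<alpha> n\<rfloor>"

fun cf_denom :: "real \<Rightarrow> nat \<Rightarrow> int"
  where
    "cf_denom \<alpha> 0 = 1"
  | "cf_denom \<alpha> (Suc 0) = cf_coeff \<alpha> 1"
  | "cf_denom \<alpha> (Suc (Suc n)) =
      cf_coeff \<alpha> (Suc (Suc n)) * cf_denom \<alpha> (Suc n) + cf_denom \<alpha> n"

definition cf_index :: "real \<Rightarrow> real \<Rightarrow> nat"
  where "cf_index \<alpha> x =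
    (LEAST n. n \<ge> 1 \<and>
      2 * real_of_int (cf_denom \<alpha> n) * real_of_int (cf_denom \<alpha> (n + 1)) /
        (real_of_int (cf_denom \<alpha> n) + real_of_int (cf_denom \<alpha> (n + 1))) \<ge> x)"

definition cf_ell :: "real \<Rightarrow> real \<Rightarrow> real"
  where "cf_ell \<alpha> x = real_of_int (cf_denom \<alpha> (cf_index \<alpha> x))"

definition integral_means_spectrum :: "(complex \<Rightarrow> complex) \<Rightarrow> real \<Rightarrow> ereal"
  where "integral_means_spectrum \<psi> t =
    Limsup (at_left 1) (\<lambda>r::real.
      ereal (ln (integral {0..2 * pi} (\<lambda>\<theta>. cmod (deriv \<psi> (of_real r * cis \<theta>)) powr t))
        / (- ln (1 - r))))"

end

theory Submission
  imports Defs
begin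

text \<open>
  Conjugated by \<open>\<phi>\<close> to the unit disk, \<open>f l0\<close> is the rotation by \<open>l0\<close>, and \<open>f l\<close> is a map
  \<open>g w = l0 * w * (1 + (l - l0) * H (l0 * w))\<close> with \<open>H\<close> holomorphic and \<open>H 0 = 1 / l0\<close>, since the
  multiplier of the fixed point is \<open>l\<close> (\<open>conjugated_perturbation\<close>). Hence \<open>ln \<bar>g ^^ q (w) / w\<bar>\<close> is
  close to the real part of \<open>(l - l0)\<close> times the sum of \<open>H\<close> along \<open>q\<close> points of the orbit. If these
  points are well distributed, the sum is close to \<open>q * H 0 = q / l0\<close> by the mean value property, and
  in a Stolz angle \<open>Re ((l - l0) / l0) \<le> - \<kappa> * cmod (l - l0)\<close>. So \<open>g ^^ q\<close> does not increase the
  modulus, orbits that start in the disk of radius \<open>r\<close> never leave a slightly larger disk, the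
  iterates of \<open>f l\<close> are bounded on \<open>\<psi> ` ball 0 r\<close>, and Montel's theorem puts this connected set
  into the Fatou set.

  The work lies in the errors. Put \<open>\<delta> = 1 - r\<close> and let \<open>q\<close> be the value of \<open>cf_ell\<close>; it is the
  denominator of a convergent \<open>p / q\<close>, and \<open>2 * q \<ge> \<delta> powr (- \<gamma>)\<close>. During \<open>q\<close> steps the orbit
  stays within \<open>q * cmod (l - l0) * sup \<bar>H\<bar> + 2 * pi / q\<close> of the orbit of the rotation by \<open>p / q\<close>.
  Over an orbit of a rational rotation the Cauchy and the Poisson kernels sum in closed form. The
  former shows that the average of \<open>H\<close> differs from \<open>H 0\<close> by a term of order \<open>(r / \<rho>) ^ q\<close>, the latter
  that moving the points by \<open>\<eta>\<close> changes the average by at most a constant times \<open>\<eta> / \<delta>\<close>; both are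
  multiplied by the mean of \<open>\<bar>H\<bar>\<close> on the circle of radius \<open>\<rho> = 1 - \<delta> / 2\<close>
  (\<open>sum_along_perturbed_rotation\<close>). Up to a bounded term \<open>\<bar>H\<bar>\<close> is at most a constant times
  \<open>1 / \<bar>deriv \<psi>\<bar>\<close>, so this mean is governed by the integral means spectrum at \<open>- 1\<close>: it is
  \<open>O(\<delta> powr (- b))\<close> with \<open>b < \<gamma> - 1\<close> and is beaten by \<open>1 / (q * \<delta>)\<close>, which is
  \<open>O(\<delta> powr (\<gamma> - 1))\<close>. The deviation caused by \<open>l - l0\<close> is absorbed with the pointwise
  bound \<open>\<bar>H\<bar> \<le> K / \<delta>\<close>, used twice; together with the factor \<open>1 / \<delta>\<close> of the kernel this costs \<open>\<delta> ^ 3\<close>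
  (\<open>siegel_disk_orbits_stay\<close>).

  The pointwise bound is Koebe's distortion estimate \<open>\<bar>deriv \<psi> u\<bar> \<ge> c * (1 - \<bar>u\<bar>)\<close> with the sharp
  exponent. It follows from \<open>\<bar>deriv F 0\<bar> \<le> 4 * \<bar>F 0\<bar>\<close> for univalent \<open>F\<close> without zeros, moved to all
  points of the disk and integrated along a radius. With \<open>h = sqrt F\<close> and \<open>T = (h - h 0) / (h + h 0)\<close>
  this says that \<open>\<bar>deriv T 0\<bar> \<le> 1\<close> if \<open>T\<close> is univalent and \<open>T z * T w \<noteq> 1\<close>
  (\<open>univalent_bieberbach_eilenberg\<close>). Here \<open>T\<close> and \<open>1 / T\<close> map the annulus \<open>s < \<bar>z\<bar> < t\<close> to
  disjoint sets, each of area at least \<open>2 * pi * ln (t / s)\<close> for the area element \<open>1 / \<bar>w\<bar>\<^sup>2\<close>; both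
  sets lie in an annulus \<open>\<rho> \<le> \<bar>w\<bar> \<le> 1 / \<rho>\<close> of area \<open>4 * pi * ln (1 / \<rho>)\<close>, where \<open>\<rho> / s\<close> can be
  chosen arbitrarily close to \<open>\<bar>deriv T 0\<bar>\<close>.
\<close>

section \<open>Convergents of the continued fraction\<close>

fun cf_numer :: "real \<Rightarrow> nat \<Rightarrow> int"
  where
    "cf_numer \<alpha> 0 = cf_coeff \<alpha> 0"
  | "cf_numer \<alpha> (Suc 0) = cf_coeff \<alpha> 1 * cf_coeff \<alpha> 0 + 1"
  | "cf_numer \<alpha> (Suc (Suc n)) =
      cf_coeff \<alpha> (Suc (Suc n)) * cf_numer \<alpha> (Suc n) + cf_numer \<alpha> n"

lemma cf_rem_irrational:
  assumes "\<alpha> \<notin> \<rat>"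
  shows "cf_rem \<alpha> n \<notin> \<rat>"
proof (induction n)
  case 0
  then show ?case using assms by simp
next
  case (Suc n)
  show ?case
  proof
    assume "cf_rem \<alpha> (Suc n) \<in> \<rat>"
    hence "inverse (cf_rem \<alpha> (Suc n)) \<in> \<rat>" by (rule Rats_inverse)
    hence "frac (cf_rem \<alpha> n) \<in> \<rat>" by (simp add: field_simps)
    hence "frac (cf_rem \<alpha> n) + of_int \<lfloor>cf_rem \<alpha> n\<rfloor> \<in> \<rat>" by (intro Rats_add) auto
    thus False using Suc by (simp add: frac_def)
  qed
qed

lemma cf_rem_step:
  assumes "\<alpha> \<notin> \<rat>"
  shows "cf_rem \<alpha> (Suc n) > 1" "cf_rem \<alpha> n = cf_coeff \<alpha> n + 1 / cf_rem \<alpha> (Suc n)"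
proof -
  have "cf_rem \<alpha> n \<notin> \<int>" using cf_rem_irrational[OF assms] Ints_subset_Rats by blast
  hence f: "frac (cf_rem \<alpha> n) > 0" "frac (cf_rem \<alpha> n) < 1"
    by (auto simp: frac_gt_0_iff frac_lt_1)
  then show "cf_rem \<alpha> (Suc n) > 1" by simp
  show "cf_rem \<alpha> n = cf_coeff \<alpha> n + 1 / cf_rem \<alpha> (Suc n)"
    by (simp add: cf_coeff_def frac_def)
qed

lemma cf_coeff_ge_1:
  assumes "\<alpha> \<notin> \<rat>"
  shows "cf_coeff \<alpha> (Suc n) \<ge> 1"
  using cf_rem_step(1)[OF assms, of n] by (simp add: cf_coeff_def le_floor_iff)

lemma cf_denom_ge:
  assumes "\<alpha> \<notin> \<rat>"
  shows "cf_denom \<alpha> n \<ge> 1 \<and> cf_denom \<alpha> (Suc n) \<ge> int (Suc n)"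
proof (induction n)
  case 0
  then show ?case using cf_coeff_ge_1[OF assms, of 0] by simp
next
  case (Suc n)
  have "cf_coeff \<alpha> (Suc (Suc n)) * cf_denom \<alpha> (Suc n) \<ge> 1 * cf_denom \<alpha> (Suc n)"
    using cf_coeff_ge_1[OF assms, of "Suc n"] Suc by (intro mult_right_mono) auto
  then have "cf_denom \<alpha> (Suc (Suc n)) \<ge> cf_denom \<alpha> (Suc n) + cf_denom \<alpha> n" by simp
  then show ?case using Suc by linarith
qed

lemma cf_determinant:
  "cf_numer \<alpha> (Suc n) * cf_denom \<alpha> n - cf_numer \<alpha> n * cf_denom \<alpha> (Suc n) = (- 1) ^ n"
  by (induction n) (simp_all add: algebra_simps)

text \<open>This is \<open>\<alpha> = (p * x + p') / (q * x + q')\<close> for the complete quotient \<open>x\<close>, cleared of denominators.\<close>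

lemma cf_complete_quotient:
  assumes "\<alpha> \<notin> \<rat>"
  shows "\<alpha> * (cf_denom \<alpha> (Suc n) * cf_rem \<alpha> (Suc (Suc n)) + cf_denom \<alpha> n)
       = cf_numer \<alpha> (Suc n) * cf_rem \<alpha> (Suc (Suc n)) + cf_numer \<alpha> n"
proof (induction n)
  case 0
  define x1 where "x1 = cf_rem \<alpha> (Suc 0)"
  define x2 where "x2 = cf_rem \<alpha> (Suc (Suc 0))"
  have x: "x1 > 1" "x2 > 1" "x1 = cf_coeff \<alpha> 1 + 1 / x2" "\<alpha> = cf_coeff \<alpha> 0 + 1 / x1"
    using cf_rem_step[OF assms, of 0] cf_rem_step[OF assms, of 1] by (simp_all add: x1_def x2_def)
  have e1: "x1 * x2 = cf_coeff \<alpha> 1 * x2 + 1" using x by (simp add: field_simps)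
  have "\<alpha> * x1 = cf_coeff \<alpha> 0 * x1 + 1" using x(1,4) by (simp add: field_simps)
  hence "\<alpha> * x1 * x2 = (cf_coeff \<alpha> 0 * x1 + 1) * x2" by (simp only:)
  hence "\<alpha> * (x1 * x2) = cf_coeff \<alpha> 0 * (x1 * x2) + x2" by (simp add: algebra_simps)
  then show ?case unfolding e1 x2_def[symmetric]
    by (simp add: algebra_simps del: cf_rem.simps)
next
  case (Suc n)
  define x2 where "x2 = cf_rem \<alpha> (Suc (Suc n))"
  define x3 where "x3 = cf_rem \<alpha> (Suc (Suc (Suc n)))"
  have x: "x2 > 1" "x3 > 1" "x2 = cf_coeff \<alpha> (Suc (Suc n)) + 1 / x3"
    using cf_rem_step[OF assms, of "Suc n"] cf_rem_step[OF assms, of "Suc (Suc n)"]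
    by (simp_all add: x2_def x3_def del: cf_rem.simps)
  have e: "x2 * x3 = cf_coeff \<alpha> (Suc (Suc n)) * x3 + 1" using x by (simp add: field_simps)
  have "\<alpha> * (cf_denom \<alpha> (Suc n) * x2 + cf_denom \<alpha> n) * x3
      = (cf_numer \<alpha> (Suc n) * x2 + cf_numer \<alpha> n) * x3"
    using Suc by (simp add: x2_def)
  hence "\<alpha> * (cf_denom \<alpha> (Suc n) * (x2 * x3) + cf_denom \<alpha> n * x3)
      = cf_numer \<alpha> (Suc n) * (x2 * x3) + cf_numer \<alpha> n * x3"
    by (simp add: algebra_simps)
  then show ?case unfolding e by (simp add: x3_def[symmetric] algebra_simps del: cf_rem.simps)
qed

lemma cf_convergent_approx:
  assumes "\<alpha> \<notin> \<rat>"
  shows "\<bar>\<alpha> - cf_numer \<alpha> (Suc n) / cf_denom \<alpha> (Suc n)\<bar> \<le> 1 / (cf_denom \<alpha> (Suc n))\<^sup>2"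
proof -
  define q where "q = real_of_int (cf_denom \<alpha> (Suc n))"
  define q' where "q' = real_of_int (cf_denom \<alpha> n)"
  define p where "p = real_of_int (cf_numer \<alpha> (Suc n))"
  define p' where "p' = real_of_int (cf_numer \<alpha> n)"
  define x where "x = cf_rem \<alpha> (Suc (Suc n))"
  have x: "x > 1" using cf_rem_step(1)[OF assms] unfolding x_def .
  have q: "q \<ge> 1" "q' \<ge> 1" using cf_denom_ge[OF assms, of n] by (auto simp: q_def q'_def)
  have eq: "\<alpha> * (q * x + q') = p * x + p'"
    using cf_complete_quotient[OF assms, of n] by (simp add: q_def q'_def p_def p'_def x_def)
  have "real_of_int (cf_numer \<alpha> (Suc n) * cf_denom \<alpha> n - cf_numer \<alpha> n * cf_denom \<alpha> (Suc n))
      = real_of_int ((- 1) ^ n)"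
    by (simp only: cf_determinant)
  hence det: "p * q' - p' * q = (-1) ^ n" by (simp add: q_def q'_def p_def p'_def)
  have qx: "q \<le> q * x" using q x by simp
  have pos: "q \<le> q * x + q'" using q qx by linarith
  have "(\<alpha> - p / q) * (q * (q * x + q')) = q * (\<alpha> * (q * x + q')) - p * (q * x + q')"
    using q by (simp add: field_simps)
  also have "\<dots> = - (p * q' - p' * q)" unfolding eq by (simp add: algebra_simps)
  finally have "(\<alpha> - p / q) * (q * (q * x + q')) = - ((-1) ^ n)" using det by simp
  hence "\<bar>(\<alpha> - p / q) * (q * (q * x + q'))\<bar> = 1" by (simp add: power_abs)
  hence "\<bar>\<alpha> - p / q\<bar> * (q * (q * x + q')) = 1"
    using q pos by (simp add: abs_mult)
  moreover have "\<bar>\<alpha> - p / q\<bar> * (q * q) \<le> \<bar>\<alpha> - p / q\<bar> * (q * (q * x + q'))"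
    using q pos by (intro mult_left_mono) auto
  ultimately have "\<bar>\<alpha> - p / q\<bar> * (q * q) \<le> 1" by simp
  hence "\<bar>\<alpha> - p / q\<bar> \<le> 1 / q\<^sup>2" using q by (simp add: field_simps power2_eq_square)
  thus ?thesis by (simp add: p_def q_def)
qed

text \<open>The harmonic mean of two consecutive denominators lies between the smaller one and twice the first
one: the lower bound makes it unbounded, so that the minimum in \<open>cf_index\<close> is attained; the upper
bound then gives \<open>x \<le> 2 * q\<close>.\<close>

lemma cf_ell_convergent:
  assumes "\<alpha> \<notin> \<rat>"
  obtains p :: int and q :: nat
  where "cf_ell \<alpha> x = real q" "q \<ge> 1" "coprime p (int q)"
    "\<bar>\<alpha> - p / q\<bar> \<le> 1 / (real q)\<^sup>2" "x \<le> 2 * real q"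
proof -
  define hm where "hm n = 2 * real_of_int (cf_denom \<alpha> n) * real_of_int (cf_denom \<alpha> (n + 1)) /
        (real_of_int (cf_denom \<alpha> n) + real_of_int (cf_denom \<alpha> (n + 1)))" for n
  have le: "hm n \<le> 2 * real_of_int (cf_denom \<alpha> n)" for n
    using cf_denom_ge[OF assms, of n] unfolding hm_def by (auto simp: field_simps)
  have ge: "hm n \<ge> real n" if n1: "n \<ge> 1" for n
  proof -
    obtain m where n: "n = Suc m" using n1 by (cases n) auto
    define a where "a = real_of_int (cf_denom \<alpha> n)"
    define b where "b = real_of_int (cf_denom \<alpha> (n + 1))"
    have "cf_denom \<alpha> n \<ge> int n" "cf_denom \<alpha> (n + 1) \<ge> int n"
      using cf_denom_ge[OF assms, of m] cf_denom_ge[OF assms, of n] by (auto simp: n)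
    hence ab: "a \<ge> real n" "b \<ge> real n"
      by (simp_all add: a_def b_def)
    have n0: "real n > 0" using n1 by simp
    have "real n * a \<le> b * a" "real n * b \<le> a * b" using ab n0 by (auto intro: mult_right_mono)
    hence "real n * (a + b) \<le> 2 * a * b" by (simp add: algebra_simps)
    thus ?thesis using ab n0 unfolding hm_def a_def[symmetric] b_def[symmetric]
      by (simp add: pos_le_divide_eq)
  qed
  obtain m :: nat where m: "real m \<ge> max x 1" using real_arch_simple by blast
  have ex: "\<exists>n\<ge>1. hm n \<ge> x" using m ge[of m] by (intro exI[of _ m]) auto
  define n where "n = cf_index \<alpha> x"
  have "n \<ge> 1 \<and> hm n \<ge> x"
    unfolding n_def cf_index_def using ex LeastI_ex[of "\<lambda>n. n \<ge> 1 \<and> hm n \<ge> x"]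
    by (simp add: hm_def)
  hence n1: "n \<ge> 1" "hm n \<ge> x" by auto
  then obtain k where k: "n = Suc k" "hm n \<ge> x" by (cases n) auto
  define q where "q = nat (cf_denom \<alpha> n)"
  have q1: "cf_denom \<alpha> n \<ge> 1" using cf_denom_ge[OF assms, of n] by auto
  have iq: "cf_denom \<alpha> n = int q" using q1 by (simp add: q_def)
  have cop: "coprime (cf_numer \<alpha> n) (int q)"
  proof (rule coprimeI)
    fix d assume d: "d dvd cf_numer \<alpha> n" "d dvd int q"
    have "d dvd cf_numer \<alpha> (Suc k) * cf_denom \<alpha> k - cf_numer \<alpha> k * cf_denom \<alpha> (Suc k)"
      using d unfolding iq[symmetric] k(1) by (intro dvd_diff) auto
    hence "d dvd (-1) ^ k" by (simp only: cf_determinant)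
    thus "is_unit d" by (metis dvd_trans is_unit_power_iff dvd_minus_iff dvd_refl)
  qed
  show thesis
  proof (rule that[of q "cf_numer \<alpha> n"])
    show "cf_ell \<alpha> x = real q" unfolding cf_ell_def n_def[symmetric] iq by simp
    show "q \<ge> 1" using q1 iq by simp
    show "coprime (cf_numer \<alpha> n) (int q)" by (rule cop)
    show "\<bar>\<alpha> - cf_numer \<alpha> n / q\<bar> \<le> 1 / (real q)\<^sup>2"
      using cf_convergent_approx[OF assms, of k] iq unfolding k(1) by simp
    show "x \<le> 2 * real q" using le[of n] k(2) iq by simp
  qed
qed

section \<open>Averages of a holomorphic function along a rotation\<close>

lemma Re_of_nat_mult: "Re (of_nat q * z) = q * Re z"
  by simp

lemma cis_rational_rotation_sum:
  assumes "coprime p (int q)" "q > 0" "\<not> q dvd m"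
  shows "(\<Sum>k<q. cis (2 * pi * p / q) ^ (k * m)) = 0"
proof -
  define y where "y = cis (2 * pi * p / q) ^ m"
  have yq: "y ^ q = 1"
  proof -
    have "y ^ q = cis (real q * (real m * (2 * pi * p / q)))"
      by (simp only: y_def Complex.DeMoivre)
    also have "real q * (real m * (2 * pi * p / q)) = 2 * pi * of_int (int m * p)"
      using assms(2) by simp
    finally show ?thesis by (simp only: cis_multiple_2pi Ints_of_int)
  qed
  have y1: "y \<noteq> 1"
  proof
    assume "y = 1"
    hence "cis (real m * (2 * pi * p / q)) = 1" by (simp only: y_def Complex.DeMoivre)
    hence "exp (\<i> * of_real (real m * (2 * pi * p / q))) = 1" by (simp add: cis_conv_exp)
    then obtain n :: int where "real m * (2 * pi * p / q) = of_int (2 * n) * pi"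
      by (auto simp: exp_eq_1)
    hence "real m * p = of_int n * real q" using assms(2) by (simp add: field_simps)
    hence "real_of_int (int m * p) = real_of_int (n * int q)" by simp
    hence "int m * p = n * int q" by linarith
    hence "int q dvd p * int m" by (simp add: mult.commute)
    hence "int q dvd int m"
      using assms(1) by (simp add: coprime_dvd_mult_right_iff coprime_commute)
    thus False using assms(3) by simp
  qed
  have "(\<Sum>k<q. y ^ k) = (y ^ q - 1) / (y - 1)" by (rule geometric_sum[OF y1])
  hence "(\<Sum>k<q. y ^ k) = 0" by (simp add: yq)
  moreover have "y ^ k = cis (2 * pi * p / q) ^ (k * m)" for k
    unfolding y_def by (simp only: power_mult[symmetric] mult.commute)
  ultimately show ?thesis by (simp only:)
qed

text \<open>With \<open>y = \<omega> ^ k * x\<close> one has \<open>y ^ q = x ^ q\<close>, so \<open>1 / (1 - y)\<close> is a polynomial of degree less than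
\<open>q\<close> in \<open>y\<close> divided by \<open>1 - x ^ q\<close>, independent of \<open>k\<close>; summed over the roots of unity only its
constant term survives.\<close>

lemma cauchy_kernel_rational_rotation:
  fixes x :: complex
  assumes "coprime p (int q)" "q > 0" "cmod x < 1"
  defines "\<omega> \<equiv> cis (2 * pi * p / q)"
  shows "(\<Sum>k<q. 1 / (1 - \<omega> ^ k * x)) = of_nat q / (1 - x ^ q)"
proof -
  have wq: "\<omega> ^ q = 1"
  proof -
    have "\<omega> ^ q = cis (real q * (2 * pi * p / q))" unfolding \<omega>_def Complex.DeMoivre ..
    also have "real q * (2 * pi * p / q) = 2 * pi * of_int p" using assms(2) by simp
    finally have "\<omega> ^ q = cis (2 * pi * of_int p)" .
    thus ?thesis by (simp only: cis_multiple_2pi Ints_of_int)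
  qed
  have "1 / (1 - \<omega> ^ k * x) = (\<Sum>m<q. \<omega> ^ (k * m) * x ^ m) / (1 - x ^ q)" for k
  proof -
    define y where "y = \<omega> ^ k * x"
    have ny: "cmod y < 1" using assms(3) by (simp add: y_def norm_mult norm_power \<omega>_def)
    hence y1: "y \<noteq> 1" by auto
    have "y ^ q = (\<omega> ^ q) ^ k * x ^ q" unfolding y_def power_mult_distrib
      by (simp add: mult.commute flip: power_mult)
    hence yq: "y ^ q = x ^ q" using wq by simp
    have xq: "x ^ q \<noteq> 1"
      by (metis assms(2,3) norm_one norm_power power_less_one_iff norm_ge_zero less_irrefl)
    have "(\<Sum>m<q. y ^ m) = (y ^ q - 1) / (y - 1)" by (rule geometric_sum[OF y1])
    hence "1 / (1 - y) = (\<Sum>m<q. y ^ m) / (1 - x ^ q)"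
      using y1 xq by (simp add: yq divide_simps) (auto simp: algebra_simps)
    thus ?thesis by (simp add: y_def power_mult_distrib power_mult)
  qed
  hence "(\<Sum>k<q. 1 / (1 - \<omega> ^ k * x)) = (\<Sum>k<q. \<Sum>m<q. \<omega> ^ (k * m) * x ^ m) / (1 - x ^ q)"
    by (simp add: sum_divide_distrib)
  also have "(\<Sum>k<q. \<Sum>m<q. \<omega> ^ (k * m) * x ^ m) = (\<Sum>m<q. (\<Sum>k<q. \<omega> ^ (k * m)) * x ^ m)"
    by (subst sum.swap) (simp add: sum_distrib_right)
  also have "\<dots> = (\<Sum>m<q. if m = 0 then of_nat q else 0)"
    using assms(1,2) cis_rational_rotation_sum[of p q]
    by (intro sum.cong) (auto simp: \<omega>_def dest: nat_dvd_not_less)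
  also have "\<dots> = of_nat q" using assms(2) by simp
  finally show ?thesis .
qed

text \<open>With \<open>y = \<omega> ^ k * x\<close> the Poisson kernel \<open>(1 - \<bar>x\<bar>\<^sup>2) / \<bar>1 - y\<bar>\<^sup>2\<close> is the real part of
\<open>2 / (1 - y) - 1\<close>, which the previous lemma sums.\<close>

lemma poisson_kernel_rational_rotation:
  fixes x :: complex
  assumes "coprime p (int q)" "q > 0" "cmod x \<le> s" "s < 1" "s ^ q \<le> 1 / 2"
  shows "(\<Sum>k<q. 1 / (cmod (1 - cis (2 * pi * p / q) ^ k * x))\<^sup>2) \<le> 3 * q / (1 - s)"
proof -
  define \<omega> where "\<omega> = cis (2 * pi * p / q)"
  have x1: "cmod x < 1" and s0: "s \<ge> 0" using assms(3,4) norm_ge_zero[of x] by linarith+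
  have poisson: "(1 - (cmod x)\<^sup>2) / (cmod (1 - \<omega> ^ k * x))\<^sup>2 = 2 * Re (1 / (1 - \<omega> ^ k * x)) - 1" for k
  proof -
    define y where "y = \<omega> ^ k * x"
    have ny: "cmod y = cmod x" by (simp add: y_def norm_mult norm_power \<omega>_def)
    hence y1: "1 - y \<noteq> 0" using x1 by auto
    hence c0: "(cmod (1 - y))\<^sup>2 \<noteq> 0" by simp
    have "Re (1 / (1 - y)) = (1 - Re y) / (cmod (1 - y))\<^sup>2"
      by (simp add: Re_divide cmod_power2)
    moreover have "(cmod (1 - y))\<^sup>2 = 1 - 2 * Re y + (cmod y)\<^sup>2"
      unfolding cmod_power2 by (simp add: power2_eq_square algebra_simps)
    moreover from calculation(1) have "Re (1 / (1 - y)) * (cmod (1 - y))\<^sup>2 = 1 - Re y"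
      using c0 by simp
    ultimately have "1 - (cmod y)\<^sup>2 = (2 * Re (1 / (1 - y)) - 1) * (cmod (1 - y))\<^sup>2"
      unfolding left_diff_distrib mult.assoc by linarith
    thus ?thesis using c0 unfolding y_def[symmetric] ny[symmetric] by (metis nonzero_mult_div_cancel_right)
  qed
  define z where "z = x ^ q"
  have nz: "cmod z \<le> 1 / 2"
  proof -
    have "cmod z \<le> s ^ q" unfolding z_def norm_power using assms(3) by (intro power_mono) auto
    thus ?thesis using assms(5) by linarith
  qed
  have re: "Re (1 / (1 - z)) \<le> 2"
  proof -
    have "1 / 2 \<le> cmod (1 - z)" using nz norm_triangle_ineq2[of 1 z] by simp
    hence "1 / cmod (1 - z) \<le> 1 / (1 / 2)" by (intro frac_le) auto
    hence "cmod (1 / (1 - z)) \<le> 2" by (simp add: norm_divide)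
    thus ?thesis using complex_Re_le_cmod order_trans by blast
  qed
  have "(1 - (cmod x)\<^sup>2) * (\<Sum>k<q. 1 / (cmod (1 - \<omega> ^ k * x))\<^sup>2)
      = (\<Sum>k<q. 2 * Re (1 / (1 - \<omega> ^ k * x)) - 1)"
    unfolding sum_distrib_left by (intro sum.cong) (simp_all add: poisson[symmetric])
  also have "\<dots> = 2 * Re (\<Sum>k<q. 1 / (1 - \<omega> ^ k * x)) - q"
    by (simp add: sum_subtractf sum_distrib_left)
  also have "(\<Sum>k<q. 1 / (1 - \<omega> ^ k * x)) = of_nat q * (1 / (1 - z))"
    using cauchy_kernel_rational_rotation[OF assms(1,2) x1] by (simp add: \<omega>_def z_def)
  also have "2 * Re (of_nat q * (1 / (1 - z))) - q = q * (2 * Re (1 / (1 - z)) - 1)"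
    by (simp only: Re_of_nat_mult right_diff_distrib)
  also have "\<dots> \<le> real q * 3" using re by (intro mult_left_mono) auto
  finally have *: "(1 - (cmod x)\<^sup>2) * (\<Sum>k<q. 1 / (cmod (1 - \<omega> ^ k * x))\<^sup>2) \<le> 3 * q" by simp
  have "(cmod x)\<^sup>2 \<le> s * 1"
    unfolding power2_eq_square using assms(3) x1 s0 by (intro mult_mono) auto
  hence "(1 - s) * (\<Sum>k<q. 1 / (cmod (1 - \<omega> ^ k * x))\<^sup>2)
      \<le> (1 - (cmod x)\<^sup>2) * (\<Sum>k<q. 1 / (cmod (1 - \<omega> ^ k * x))\<^sup>2)"
    by (intro mult_right_mono sum_nonneg) auto
  with * have "(1 - s) * (\<Sum>k<q. 1 / (cmod (1 - \<omega> ^ k * x))\<^sup>2) \<le> 3 * q" by linarith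
  thus ?thesis unfolding \<omega>_def[symmetric] using assms(4) by (simp add: pos_le_divide_eq mult.commute)
qed

lemma cauchy_formula_circle_mean:
  fixes H :: "complex \<Rightarrow> complex"
  assumes "H holomorphic_on ball 0 R" "0 < \<rho>" "\<rho> < R" "cmod x < \<rho>"
  shows "((\<lambda>t. H (\<rho> * cis t) * (1 / (1 - x / (\<rho> * cis t)))) has_integral 2 * pi * H x) {0..2 * pi}"
proof -
  have "((\<lambda>u. H u / (u - x)) has_contour_integral (2 * of_real pi * \<i> * H x)) (circlepath 0 \<rho>)"
    using assms by (intro Cauchy_integral_circlepath_simple holomorphic_on_subset[OF assms(1)]) auto
  hence "((\<lambda>u. H u / (u - x)) has_contour_integral (2 * of_real pi * \<i> * H x))
      (part_circlepath 0 \<rho> 0 (2 * pi))"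
    by (simp add: circlepath_def)
  hence "((\<lambda>t. H (0 + \<rho> * cis t) / (0 + \<rho> * cis t - x) * \<rho> * \<i> * exp (\<i> * t))
      has_integral (2 * of_real pi * \<i> * H x)) {0..2 * pi}"
    by (subst (asm) has_contour_integral_part_circlepath_iff) (auto simp: cis_conv_exp)
  hence "((\<lambda>t. (H (0 + \<rho> * cis t) / (0 + \<rho> * cis t - x) * \<rho> * \<i> * exp (\<i> * t)) * (1 / \<i>))
      has_integral (2 * of_real pi * \<i> * H x) * (1 / \<i>)) {0..2 * pi}"
    by (rule has_integral_mult_left)
  moreover have "(2 * of_real pi * \<i> * H x) * (1 / \<i>) = 2 * pi * H x" by simp
  moreover have "(H (0 + \<rho> * cis t) / (0 + \<rho> * cis t - x) * \<rho> * \<i> * exp (\<i> * t)) * (1 / \<i>)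
      = H (\<rho> * cis t) * (1 / (1 - x / (\<rho> * cis t)))" for t
  proof -
    have n0: "\<rho> * cis t \<noteq> 0" using assms(2) by simp
    have n1: "\<rho> * cis t - x \<noteq> 0"
    proof
      assume "\<rho> * cis t - x = 0"
      hence "cmod x = cmod (\<rho> * cis t)" by simp
      thus False using assms(2,4) by (simp add: norm_mult)
    qed
    have "1 / (1 - x / (\<rho> * cis t)) = \<rho> * cis t / (\<rho> * cis t - x)"
      using n0 n1 by (simp add: divide_simps)
    moreover have "(a / b * \<rho> * \<i> * c) * (1 / \<i>) = a * (\<rho> * c / b)" for a b c :: complex
      by (simp add: field_simps)
    ultimately show ?thesis by (simp only: cis_conv_exp add_0_left)
  qed
  ultimately show ?thesis by (simp only:)
qed

text \<open>By Cauchy's formula \<open>H (u k)\<close> is the mean of \<open>H v / (1 - u k / v)\<close> over the circle of radius \<open>\<rho>\<close>.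
Everything therefore reduces to the sum of the Cauchy kernels, uniformly in \<open>v\<close>: at the unperturbed
points it is \<open>q / (1 - (x / v) ^ q)\<close>, and the perturbation costs at most \<open>2 * \<eta> / \<rho>\<close> times the
sum bounded in \<open>poisson_kernel_rational_rotation\<close>.\<close>

lemma sum_along_perturbed_rotation:
  fixes H :: "complex \<Rightarrow> complex"
  assumes H: "H holomorphic_on ball 0 R" and \<rho>: "\<rho> < R" and r: "0 \<le> r" "r < \<rho>"
    and pq: "coprime p (int q)" "q > 0" and s: "(r / \<rho>) ^ q \<le> 1 / 2"
    and x: "cmod x \<le> r" and \<eta>: "2 * \<eta> \<le> \<rho> - r"
    and u: "\<And>k. k < q \<Longrightarrow> cmod (u k - cis (2 * pi * p / q) ^ k * x) \<le> \<eta>"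
  shows "cmod ((\<Sum>k<q. H (u k)) - q * H 0)
      \<le> q * (2 * (r / \<rho>) ^ q + 6 * \<eta> / (\<rho> - r))
          * (integral {0..2 * pi} (\<lambda>t. cmod (H (\<rho> * cis t))) / (2 * pi))"
proof -
  define \<omega> where "\<omega> = cis (2 * pi * p / q)"
  define s where "s = r / \<rho>"
  have \<rho>0: "\<rho> > 0" using r by simp
  have s1: "0 \<le> s" "s < 1" using r by (auto simp: s_def)
  have \<rho>s: "\<rho> * (1 - s) = \<rho> - r" using \<rho>0 by (simp add: s_def field_simps)
  have \<eta>0: "\<eta> \<ge> 0" using u[of 0] pq(2) norm_ge_zero order_trans by blast
  define v where "v t = \<rho> * cis t" for t
  have nv: "cmod (v t) = \<rho>" for t using \<rho>0 by (simp add: v_def norm_mult)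
  have v0: "v t \<noteq> 0" for t using nv[of t] \<rho>0 by auto
  have xk: "cmod (\<omega> ^ k * x) \<le> r" for k using x by (simp add: norm_mult norm_power \<omega>_def)
  have uk: "cmod (u k) < \<rho>" if "k < q" for k
  proof -
    have "cmod (u k) \<le> cmod (\<omega> ^ k * x) + cmod (u k - \<omega> ^ k * x)"
      by (metis add.commute norm_triangle_sub)
    also have "\<dots> \<le> r + \<eta>" using xk[of k] u[OF that] by (simp add: \<omega>_def)
    finally show ?thesis using \<eta> \<eta>0 r by linarith
  qed
  \<comment> \<open>the kernel that represents the sum minus \<open>q * H 0\<close>\<close>
  define K where "K t = (\<Sum>k<q. 1 / (1 - u k / v t)) - of_nat q" for t
  have I: "((\<lambda>t. H (v t) * K t) has_integral 2 * pi * ((\<Sum>k<q. H (u k)) - q * H 0)) {0..2 * pi}"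
  proof -
    have a: "((\<lambda>t. H (v t) * (1 / (1 - u k / v t))) has_integral 2 * pi * H (u k)) {0..2 * pi}" if "k < q" for k
      using cauchy_formula_circle_mean[OF H \<rho>0 \<rho> uk[OF that]] by (simp add: v_def)
    have b: "((\<lambda>t. H (v t) * of_nat q) has_integral 2 * pi * H 0 * of_nat q) {0..2 * pi}"
      using has_integral_mult_left[OF cauchy_formula_circle_mean[OF H \<rho>0 \<rho>, of 0], of "of_nat q"] \<rho>0
      by (simp add: v_def)
    have "((\<lambda>t. (\<Sum>k<q. H (v t) * (1 / (1 - u k / v t))) - H (v t) * of_nat q)
        has_integral (\<Sum>k<q. 2 * pi * H (u k)) - 2 * pi * H 0 * of_nat q) {0..2 * pi}"
      by (intro has_integral_diff has_integral_sum a b) auto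
    thus ?thesis by (simp add: K_def sum_distrib_left algebra_simps)
  qed
  have Kle: "cmod (K t) \<le> q * (2 * s ^ q + 6 * \<eta> / (\<rho> - r))" for t
  proof -
    define y where "y = x / v t"
    have ny: "cmod y \<le> s" using x nv[of t] \<rho>0 by (simp add: y_def norm_divide s_def divide_right_mono)
    have yk: "cmod (\<omega> ^ k * y) \<le> s" for k using ny by (simp add: norm_mult norm_power \<omega>_def)
    have main: "cmod (of_nat q / (1 - y ^ q) - of_nat q) \<le> q * (2 * s ^ q)"
    proof -
      have yq: "cmod (y ^ q) \<le> s ^ q" unfolding norm_power using ny by (intro power_mono) auto
      have "1 / 2 \<le> cmod (1 - y ^ q)" using yq s norm_triangle_ineq2[of 1 "y ^ q"] by (simp add: s_def)
      moreover from this have "1 - y ^ q \<noteq> 0" by auto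
      ultimately have "of_nat q / (1 - y ^ q) - of_nat q = of_nat q * (y ^ q / (1 - y ^ q))"
        by (simp add: field_simps)
      moreover have "cmod (y ^ q / (1 - y ^ q)) \<le> s ^ q / (1 / 2)"
        unfolding norm_divide using yq \<open>1 / 2 \<le> _\<close> by (intro frac_le) (auto simp: s1)
      ultimately show ?thesis
        by (simp only: norm_mult norm_of_nat) (intro mult_left_mono, auto)
    qed
    have diff: "cmod (1 / (1 - u k / v t) - 1 / (1 - \<omega> ^ k * y)) \<le> 2 * \<eta> / \<rho> * (1 / (cmod (1 - \<omega> ^ k * y))\<^sup>2)"
      if k: "k < q" for k
    proof -
      define a where "a = 1 - u k / v t"
      define b where "b = 1 - \<omega> ^ k * y"
      have "b - a = (u k - \<omega> ^ k * x) / v t" by (simp add: a_def b_def y_def diff_divide_distrib)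
      hence ba: "cmod (b - a) \<le> \<eta> / \<rho>"
        using u[OF k] \<rho>0 by (simp add: norm_divide nv \<omega>_def divide_right_mono)
      have "1 - s \<le> cmod b" unfolding b_def using yk[of k] norm_triangle_ineq2[of 1 "\<omega> ^ k * y"] by simp
      moreover have "\<eta> / \<rho> \<le> (1 - s) / 2"
      proof -
        have "\<eta> \<le> (1 - s) / 2 * \<rho>" using \<eta> \<rho>s by (simp add: field_simps)
        thus ?thesis using \<rho>0 by (simp only: pos_divide_le_eq)
      qed
      moreover have "cmod b \<le> cmod a + cmod (b - a)" by (metis norm_triangle_sub)
      ultimately have ab: "cmod b / 2 \<le> cmod a" using ba by argo
      have b0: "cmod b > 0" using \<open>1 - s \<le> cmod b\<close> s1 by linarith
      have n0: "a \<noteq> 0" "b \<noteq> 0" using ab b0 by auto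
      hence "1 / a - 1 / b = (b - a) / (a * b)" by (simp add: field_simps)
      hence "cmod (1 / a - 1 / b) = cmod (b - a) / (cmod a * cmod b)" by (simp add: norm_divide norm_mult)
      also have "\<dots> \<le> (\<eta> / \<rho>) / (cmod b / 2 * cmod b)"
        using ab b0 ba \<eta>0 \<rho>0 by (intro frac_le mult_right_mono mult_pos_pos) auto
      also have "\<dots> = 2 * \<eta> / \<rho> * (1 / (cmod b)\<^sup>2)" by (simp add: power2_eq_square)
      finally show ?thesis by (simp add: a_def b_def)
    qed
    have "K t = (\<Sum>k<q. 1 / (1 - u k / v t) - 1 / (1 - \<omega> ^ k * y)) + (of_nat q / (1 - y ^ q) - of_nat q)"
      using cauchy_kernel_rational_rotation[OF pq, of y] ny s1
      by (simp add: K_def sum_subtractf \<omega>_def)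
    hence "cmod (K t) \<le> (\<Sum>k<q. cmod (1 / (1 - u k / v t) - 1 / (1 - \<omega> ^ k * y))) + q * (2 * s ^ q)"
      using norm_triangle_mono[OF norm_sum main] by (simp only:)
    also have "(\<Sum>k<q. cmod (1 / (1 - u k / v t) - 1 / (1 - \<omega> ^ k * y)))
        \<le> (\<Sum>k<q. 2 * \<eta> / \<rho> * (1 / (cmod (1 - \<omega> ^ k * y))\<^sup>2))"
      by (intro sum_mono diff) auto
    also have "\<dots> = 2 * \<eta> / \<rho> * (\<Sum>k<q. 1 / (cmod (1 - \<omega> ^ k * y))\<^sup>2)"
      by (rule sum_distrib_left[symmetric])
    also have "\<dots> \<le> 2 * \<eta> / \<rho> * (3 * q / (1 - s))"
      using poisson_kernel_rational_rotation[OF pq ny s1(2)] s \<eta>0 \<rho>0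
      by (intro mult_left_mono) (auto simp: \<omega>_def s_def)
    also have "\<dots> = q * (6 * \<eta> / (\<rho> - r))" by (simp add: \<rho>s[symmetric])
    finally show ?thesis by (simp add: algebra_simps)
  qed
  have contH: "continuous_on {0..2 * pi} (\<lambda>t. H (v t))"
  proof -
    have "continuous_on (v ` {0..2 * pi}) H"
      by (rule holomorphic_on_imp_continuous_on, rule holomorphic_on_subset[OF H]) (use nv \<rho> in auto)
    moreover have "continuous_on {0..2 * pi} v" unfolding v_def by (intro continuous_intros)
    ultimately show ?thesis using continuous_on_compose2[of _ H] by blast
  qed
  have int1: "(\<lambda>t. (q * (2 * s ^ q + 6 * \<eta> / (\<rho> - r))) * cmod (H (v t))) integrable_on {0..2 * pi}"
    by (intro integrable_continuous_interval continuous_intros contH)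
  have "cmod (2 * pi * ((\<Sum>k<q. H (u k)) - q * H 0)) = cmod (integral {0..2 * pi} (\<lambda>t. H (v t) * K t))"
    using I by (simp add: integral_unique)
  also have "\<dots> \<le> integral {0..2 * pi} (\<lambda>t. (q * (2 * s ^ q + 6 * \<eta> / (\<rho> - r))) * cmod (H (v t)))"
  proof (rule integral_norm_bound_integral[OF _ int1])
    show "(\<lambda>t. H (v t) * K t) integrable_on {0..2 * pi}" using I by blast
    show "cmod (H (v t) * K t) \<le> q * (2 * s ^ q + 6 * \<eta> / (\<rho> - r)) * cmod (H (v t))" for t
      unfolding norm_mult mult.commute[of "cmod (H (v t))"] by (intro mult_right_mono Kle) auto
  qed
  also have "\<dots> = (q * (2 * s ^ q + 6 * \<eta> / (\<rho> - r))) * integral {0..2 * pi} (\<lambda>t. cmod (H (v t)))"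
    by (rule integral_mult_right)
  finally have "2 * pi * cmod ((\<Sum>k<q. H (u k)) - q * H 0)
     \<le> (q * (2 * s ^ q + 6 * \<eta> / (\<rho> - r))) * integral {0..2 * pi} (\<lambda>t. cmod (H (v t)))"
    by (simp add: norm_mult)
  thus ?thesis unfolding v_def s_def by (simp add: field_simps)
qed

section \<open>Areas of images under holomorphic maps\<close>

text \<open>Linear maps that permute the coordinates carry Lebesgue measure over between \<open>\<complex>\<close>,
\<open>\<real> \<times> \<real>\<close> and \<open>real^2\<close>: the change of variables formula lives on the last of these spaces,
iterated integrals on the second.\<close>

lemma lborel_distr_basis_permutation:
  fixes L :: "'a::euclidean_space \<Rightarrow> 'b::euclidean_space"
  assumes L: "linear L" and bij: "bij_betw L Basis Basis"
  shows "distr lborel borel L = lborel"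
proof (rule lborel_eqI[symmetric])
  show "sets (distr lborel borel L) = sets borel" by simp
next
  fix l u :: 'b
  assume le: "\<And>b. b \<in> Basis \<Longrightarrow> l \<bullet> b \<le> u \<bullet> b"
  have LL: "L i \<bullet> L b = (if i = b then 1 else 0)" if "i \<in> Basis" "b \<in> Basis" for i b
  proof -
    have "L i \<in> Basis" "L b \<in> Basis" "L i = L b \<longleftrightarrow> i = b"
      using bij that by (auto simp: bij_betw_def inj_on_def)
    thus ?thesis by (simp add: inner_Basis)
  qed
  have inner: "L x \<bullet> L b = x \<bullet> b" if b: "b \<in> Basis" for x b
  proof -
    have "L x = (\<Sum>i\<in>Basis. (x \<bullet> i) *\<^sub>R L i)"
      using L euclidean_representation[of x] by (metis (no_types, lifting) linear_sum linear_cmul sum.cong)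
    hence "L x \<bullet> L b = (\<Sum>i\<in>Basis. (x \<bullet> i) * (L i \<bullet> L b))"
      by (simp add: inner_sum_left)
    also have "\<dots> = (\<Sum>i\<in>Basis. if i = b then x \<bullet> i else 0)"
      using b by (intro sum.cong) (auto simp: LL)
    finally show ?thesis using b by simp
  qed
  define l' where "l' = (\<Sum>b\<in>Basis. (l \<bullet> L b) *\<^sub>R b)"
  define u' where "u' = (\<Sum>b\<in>Basis. (u \<bullet> L b) *\<^sub>R b)"
  have lu: "l' \<bullet> b = l \<bullet> L b" "u' \<bullet> b = u \<bullet> L b" if "b \<in> Basis" for b
    using that by (simp_all add: l'_def u'_def)
  have img: "L ` Basis = Basis" using bij by (simp add: bij_betw_def)
  have Lb: "L b \<in> Basis" if "b \<in> Basis" for b using that img by blast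
  have eq: "L -` box l u = box l' u'"
  proof -
    have "x \<in> L -` box l u \<longleftrightarrow> (\<forall>b\<in>Basis. l \<bullet> L b < L x \<bullet> L b \<and> L x \<bullet> L b < u \<bullet> L b)" for x
      unfolding vimage_eq mem_box by (subst img[symmetric], simp)
    thus ?thesis by (auto simp: mem_box inner lu)
  qed
  have meas: "L \<in> borel_measurable borel"
    using L by (intro borel_measurable_continuous_onI linear_continuous_on) (simp add: linear_conv_bounded_linear)
  have "emeasure (distr lborel borel L) (box l u) = emeasure lborel (L -` box l u)"
    using meas by (subst emeasure_distr) auto
  also have "\<dots> = (\<Prod>b\<in>Basis. (u' - l') \<bullet> b)"
    unfolding eq using le Lb by (intro emeasure_lborel_box) (auto simp: lu)
  also have "(\<Prod>b\<in>Basis. (u' - l') \<bullet> b) = (\<Prod>b\<in>Basis. (u - l) \<bullet> L b)"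
    by (intro prod.cong) (auto simp: inner_diff_left lu)
  also have "\<dots> = (\<Prod>b\<in>Basis. (u - l) \<bullet> b)"
    by (rule prod.reindex_bij_betw[OF bij])
  finally show "emeasure (distr lborel borel L) (box l u) = (\<Prod>b\<in>Basis. (u - l) \<bullet> b)" .
qed

definition complex_vec :: "complex \<Rightarrow> real^2"
  where "complex_vec z = vector [Re z, Im z]"

definition vec_complex :: "real^2 \<Rightarrow> complex"
  where "vec_complex v = Complex (v $ 1) (v $ 2)"

lemma complex_vec_inverse [simp]: "vec_complex (complex_vec z) = z" "complex_vec (vec_complex v) = v"
  by (simp_all add: complex_vec_def vec_complex_def vec_eq_iff forall_2)

lemma linear_vec_complex: "linear vec_complex"
  by (rule linearI) (simp_all add: vec_complex_def complex_eq_iff)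

lemma linear_complex_vec: "linear complex_vec"
  by (rule linearI) (simp_all add: complex_vec_def vec_eq_iff forall_2)

lemma bij_vec_complex_Basis: "bij_betw vec_complex Basis Basis"
proof -
  have B: "(Basis :: (real^2) set) = {axis 1 1, axis 2 1}"
    by (auto simp: Basis_vec_def UNIV_2)
  have "vec_complex (axis 1 1) = 1" "vec_complex (axis 2 1) = \<i>"
    by (simp_all add: vec_complex_def complex_eq_iff axis_def)
  thus ?thesis unfolding B Basis_complex_def by (auto simp: bij_betw_def inj_on_def complex_eq_iff)
qed

lemma distr_vec_complex: "distr lborel borel vec_complex = lborel"
  by (rule lborel_distr_basis_permutation[OF linear_vec_complex bij_vec_complex_Basis])

lemma vec_complex_measurable [measurable]: "vec_complex \<in> borel_measurable borel"
  using linear_vec_complex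
  by (intro borel_measurable_continuous_onI linear_continuous_on) (simp add: linear_conv_bounded_linear)

lemma set_integral_vec_complex:
  fixes f :: "complex \<Rightarrow> real"
  assumes "(\<lambda>z. indicator X z * f z) \<in> borel_measurable borel"
  shows "set_integrable lborel X f \<longleftrightarrow> (\<lambda>v. f (vec_complex v)) absolutely_integrable_on (complex_vec ` X)"
    and "set_lebesgue_integral lborel X f
         = set_lebesgue_integral lebesgue (complex_vec ` X) (\<lambda>v. f (vec_complex v))"
proof -
  define F where "F z = indicator X z *\<^sub>R f z" for z
  have F: "F \<in> borel_measurable borel" using assms by (simp add: F_def[abs_def])
  have ind: "indicator (complex_vec ` X) v *\<^sub>R f (vec_complex v) = F (vec_complex v)" for v
    by (auto simp: F_def indicator_def) (metis complex_vec_inverse(2) imageI)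
  have FV: "(\<lambda>v. F (vec_complex v)) \<in> borel_measurable lborel" using F by measurable
  show "set_integrable lborel X f \<longleftrightarrow> (\<lambda>v. f (vec_complex v)) absolutely_integrable_on (complex_vec ` X)"
    unfolding set_integrable_def ind F_def[symmetric]
    using integrable_completion[OF FV] integrable_distr_eq[of vec_complex lborel borel F] F
    by (simp add: distr_vec_complex)
  show "set_lebesgue_integral lborel X f
         = set_lebesgue_integral lebesgue (complex_vec ` X) (\<lambda>v. f (vec_complex v))"
    unfolding set_lebesgue_integral_def ind F_def[symmetric]
    using integral_completion[OF FV] integral_distr[of vec_complex lborel borel F] F
    by (simp add: distr_vec_complex)
qed

lemma has_derivative_complex_vec_conj:
  assumes "(\<Phi> has_field_derivative d) (at z)"
  shows "((\<lambda>v. complex_vec (\<Phi> (vec_complex v))) has_derivative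
           (\<lambda>v. complex_vec (d * vec_complex v))) (at (complex_vec z))"
proof -
  have bl: "bounded_linear vec_complex" "bounded_linear complex_vec"
    using linear_vec_complex linear_complex_vec by (simp_all add: linear_conv_bounded_linear)
  have "(\<Phi> has_derivative (\<lambda>h. d * h)) (at (vec_complex (complex_vec z)))"
    using assms by (simp add: has_field_derivative_def)
  from has_derivative_compose[OF bounded_linear_imp_has_derivative[OF bl(1)] this]
  have "((\<lambda>v. \<Phi> (vec_complex v)) has_derivative (\<lambda>v. d * vec_complex v)) (at (complex_vec z))" .
  from has_derivative_compose[OF this bounded_linear_imp_has_derivative[OF bl(2)]]
  show ?thesis .
qed

lemma det_complex_mult: "det (matrix (\<lambda>v. complex_vec (d * vec_complex v))) = (cmod d)\<^sup>2"
  unfolding cmod_power2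
  by (simp add: det_2 matrix_def axis_def complex_vec_def vec_complex_def power2_eq_square)

text \<open>The real Jacobian of a holomorphic map is \<open>\<bar>deriv \<Phi>\<bar>\<^sup>2\<close>.\<close>

lemma holomorphic_change_of_variables:
  fixes h :: "complex \<Rightarrow> real"
  assumes hol: "\<Phi> holomorphic_on A" "open A" "R \<subseteq> A" and R: "R \<in> sets borel"
    and inj: "inj_on \<Phi> R"
    and meas1: "(\<lambda>z. indicator R z * ((cmod (deriv \<Phi> z))\<^sup>2 * h (\<Phi> z))) \<in> borel_measurable borel"
    and meas2: "(\<lambda>w. indicator (\<Phi> ` R) w * h w) \<in> borel_measurable borel"
    and int: "set_integrable lborel R (\<lambda>z. (cmod (deriv \<Phi> z))\<^sup>2 * h (\<Phi> z))"
  shows "set_integrable lborel (\<Phi> ` R) h"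
    and "set_lebesgue_integral lborel (\<Phi> ` R) h
         = set_lebesgue_integral lborel R (\<lambda>z. (cmod (deriv \<Phi> z))\<^sup>2 * h (\<Phi> z))"
proof -
  define S where "S = complex_vec ` R"
  define g where "g v = complex_vec (\<Phi> (vec_complex v))" for v
  define g' where "g' v = (\<lambda>x. complex_vec (deriv \<Phi> (vec_complex v) * vec_complex x))" for v
  have gS: "g ` S = complex_vec ` (\<Phi> ` R)" by (simp add: g_def S_def image_image)
  have "vec_complex -` R \<inter> space borel \<in> sets borel"
    using vec_complex_measurable R by (rule measurable_sets)
  moreover have "S = vec_complex -` R" unfolding S_def by (auto simp: image_iff) (metis complex_vec_inverse(2))
  ultimately have S: "S \<in> sets lebesgue" by simp
  have der: "(g has_derivative g' v) (at v within S)" if "v \<in> S" for v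
  proof -
    have "vec_complex v \<in> A" using that hol(3) by (auto simp: S_def)
    hence "(\<Phi> has_field_derivative deriv \<Phi> (vec_complex v)) (at (vec_complex v))"
      using hol by (intro holomorphic_derivI)
    from has_derivative_complex_vec_conj[OF this]
    show ?thesis unfolding g_def g'_def by (simp add: has_derivative_at_withinI)
  qed
  have injg: "inj_on g S"
    using inj unfolding inj_on_def g_def S_def by simp (metis complex_vec_inverse(1))
  have det: "\<bar>det (matrix (g' v))\<bar> = (cmod (deriv \<Phi> (vec_complex v)))\<^sup>2" for v
    unfolding g'_def det_complex_mult by simp
  define b where "b = set_lebesgue_integral lborel R (\<lambda>z. (cmod (deriv \<Phi> z))\<^sup>2 * h (\<Phi> z))"
  define k where "k v = (vec (h (vec_complex v)) :: real^1)" for v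
  define j where "j v = (cmod (deriv \<Phi> (vec_complex v)))\<^sup>2 * h (\<Phi> (vec_complex v))" for v
  have jS: "j absolutely_integrable_on S" "integral S j = b"
    using set_integral_vec_complex[OF meas1] int set_lebesgue_integral_eq_integral(2)[of S j]
    by (simp_all add: S_def j_def[abs_def] b_def)
  have kj: "\<bar>det (matrix (g' v))\<bar> *\<^sub>R k (g v) = vec (j v)" for v
    by (simp add: det k_def g_def j_def vec_eq_iff)
  have "linear (vec :: real \<Rightarrow> real^1)"
    by (rule linearI) (simp_all add: vec_eq_iff)
  hence bl: "bounded_linear (vec :: real \<Rightarrow> real^1)" by (simp add: linear_conv_bounded_linear)
  have "(\<lambda>v. (vec (j v) :: real^1)) absolutely_integrable_on S \<and> integral S (\<lambda>v. vec (j v) :: real^1) = vec b"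
  proof
    show "(\<lambda>v. (vec (j v) :: real^1)) absolutely_integrable_on S"
      using absolutely_integrable_linear[OF jS(1) bl] by (simp add: o_def)
    have "(j has_integral b) S" using jS
      by (metis set_lebesgue_integral_eq_integral(1) integrable_integral)
    from has_integral_linear[OF this bl]
    have "((\<lambda>v. (vec (j v) :: real^1)) has_integral vec b) S" by (simp add: o_def)
    thus "integral S (\<lambda>v. vec (j v) :: real^1) = vec b" by (rule integral_unique)
  qed
  hence 1: "k absolutely_integrable_on g ` S" "integral (g ` S) k = vec b"
    using has_absolute_integral_change_of_variables[OF S der injg, of k "vec b"] unfolding kj by auto
  have k1: "h (vec_complex v) = k v $ 1" for v by (simp add: k_def)
  have ka: "(\<lambda>v. h (vec_complex v)) absolutely_integrable_on g ` S"
    unfolding k1 using absolutely_integrable_component[OF 1(1), of "axis 1 1"] by (simp add: inner_axis)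
  have "integral (g ` S) (\<lambda>v. k v $ 1) = integral (g ` S) k $ 1"
    by (rule integral_component_eq_cart) (rule set_lebesgue_integral_eq_integral(1)[OF 1(1)])
  also have "\<dots> = b" by (simp only: 1(2) vec_component)
  finally have kb: "integral (g ` S) (\<lambda>v. h (vec_complex v)) = b" by (simp only: k1)
  show "set_integrable lborel (\<Phi> ` R) h"
    using set_integral_vec_complex(1)[OF meas2] ka by (simp add: gS)
  show "set_lebesgue_integral lborel (\<Phi> ` R) h
         = set_lebesgue_integral lborel R (\<lambda>z. (cmod (deriv \<Phi> z))\<^sup>2 * h (\<Phi> z))"
    using set_integral_vec_complex(2)[OF meas2] set_lebesgue_integral_eq_integral(2)[OF ka] kb
    by (simp add: gS b_def)
qed

section \<open>Logarithmic area and univalent functions\<close>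

lemma inj_on_exp_strip: "inj_on exp {z. 0 \<le> Im z \<and> Im z < 2 * pi}"
proof (rule inj_onI)
  fix z w :: complex
  assume zw: "z \<in> {z. 0 \<le> Im z \<and> Im z < 2 * pi}" "w \<in> {z. 0 \<le> Im z \<and> Im z < 2 * pi}" "exp z = exp w"
  have "Im z = Im w" using Arg2pi_exp[of z] Arg2pi_exp[of w] zw by simp
  moreover have "Re z = Re w" using arg_cong[OF zw(3), of cmod] by simp
  ultimately show "z = w" by (simp add: complex_eq_iff)
qed

lemma log_area_image:
  assumes hol: "\<Phi> holomorphic_on A" "open A" "R \<subseteq> A" and R: "R \<in> sets borel" "\<Phi> ` R \<in> sets borel"
    and inj: "inj_on \<Phi> R"
    and int: "set_integrable lborel R (\<lambda>z. (cmod (deriv \<Phi> z / \<Phi> z))\<^sup>2)"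
  shows "set_integrable lborel (\<Phi> ` R) (\<lambda>w. 1 / (cmod w)\<^sup>2)"
    and "set_lebesgue_integral lborel (\<Phi> ` R) (\<lambda>w. 1 / (cmod w)\<^sup>2)
         = set_lebesgue_integral lborel R (\<lambda>z. (cmod (deriv \<Phi> z / \<Phi> z))\<^sup>2)"
proof -
  have eq: "(cmod (deriv \<Phi> z / \<Phi> z))\<^sup>2 = (cmod (deriv \<Phi> z))\<^sup>2 * (1 / (cmod (\<Phi> z))\<^sup>2)" for z
    by (simp add: norm_divide power_divide)
  have m1: "(\<lambda>z. indicator R z * ((cmod (deriv \<Phi> z))\<^sup>2 * (1 / (cmod (\<Phi> z))\<^sup>2))) \<in> borel_measurable borel"
    using borel_measurable_integrable[OF int[unfolded set_integrable_def]] by (simp add: eq)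
  have m2: "(\<lambda>w. indicator (\<Phi> ` R) w * (1 / (cmod w)\<^sup>2)) \<in> borel_measurable borel"
    using R(2) by measurable
  note cov = holomorphic_change_of_variables[OF hol R(1) inj m1 m2 int[unfolded eq]]
  show "set_integrable lborel (\<Phi> ` R) (\<lambda>w. 1 / (cmod w)\<^sup>2)" by (rule cov(1))
  show "set_lebesgue_integral lborel (\<Phi> ` R) (\<lambda>w. 1 / (cmod w)\<^sup>2)
         = set_lebesgue_integral lborel R (\<lambda>z. (cmod (deriv \<Phi> z / \<Phi> z))\<^sup>2)"
    using cov(2) by (simp only: eq)
qed

text \<open>The exponential function maps a half-open rectangle injectively onto the annulus, and turns the area
element \<open>1 / \<bar>w\<bar>\<^sup>2\<close> into the Euclidean one.\<close>

lemma log_area_annulus: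
  assumes "0 < a" "a \<le> b"
  shows "set_integrable lborel {w. a \<le> cmod w \<and> cmod w \<le> b} (\<lambda>w. 1 / (cmod w)\<^sup>2)"
    and "set_lebesgue_integral lborel {w. a \<le> cmod w \<and> cmod w \<le> b} (\<lambda>w. 1 / (cmod w)\<^sup>2)
         \<le> 2 * pi * (ln b - ln a)"
proof -
  define R where "R = {z. ln a \<le> Re z \<and> Re z \<le> ln b \<and> 0 \<le> Im z \<and> Im z < 2 * pi}"
  define C where "C = cbox (Complex (ln a) 0) (Complex (ln b) (2 * pi))"
  have RC: "R \<subseteq> C" by (auto simp: R_def C_def in_cbox_complex_iff)
  have R: "R \<in> sets borel"
  proof -
    have "R = C \<inter> {z. Im z < 2 * pi}" by (auto simp: R_def C_def in_cbox_complex_iff)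
    moreover have "{z. Im z < 2 * pi} \<in> sets borel" by (intro borel_open open_halfspace_Im_lt)
    ultimately show ?thesis by (auto simp: C_def)
  qed
  have b0: "b > 0" using assms by simp
  have img: "exp ` R = {w. a \<le> cmod w \<and> cmod w \<le> b}"
  proof (intro equalityI subsetI)
    fix w assume "w \<in> exp ` R"
    then obtain z where z: "z \<in> R" "w = exp z" by auto
    hence "exp (ln a) \<le> cmod w \<and> cmod w \<le> exp (ln b)" by (simp add: R_def)
    thus "w \<in> {w. a \<le> cmod w \<and> cmod w \<le> b}" using assms b0 by simp
  next
    fix w assume w: "w \<in> {w. a \<le> cmod w \<and> cmod w \<le> b}"
    define z where "z = Complex (ln (cmod w)) (Arg2pi w)"
    have w0: "cmod w > 0" using w assms by auto
    have "z \<in> R" using w assms w0 Arg2pi_ge_0[of w] Arg2pi_lt_2pi[of w] by (auto simp: R_def z_def)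
    moreover have "exp z = w"
    proof -
      have "exp z = exp (of_real (ln (cmod w))) * exp (\<i> * of_real (Arg2pi w))"
        unfolding z_def Complex_eq exp_add ..
      also have "exp (of_real (ln (cmod w))) = complex_of_real (cmod w)"
        using w0 by (simp add: exp_of_real)
      finally show ?thesis using Arg2pi_eq[of w] by simp
    qed
    ultimately show "w \<in> exp ` R" by (metis image_eqI)
  qed
  have cl: "closed {w::complex. a \<le> cmod w \<and> cmod w \<le> b}"
    by (intro closed_Collect_conj closed_Collect_le continuous_intros)
  have dexp: "deriv exp z = exp z" for z :: complex by (rule DERIV_imp_deriv[OF DERIV_exp])
  have int: "set_integrable lborel R (\<lambda>z. (cmod (deriv exp z / exp z))\<^sup>2)"
  proof -
    have "set_integrable lborel C (\<lambda>z. 1::real)"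
      unfolding set_integrable_def C_def by (intro borel_integrable_compact) auto
    hence "set_integrable lborel R (\<lambda>z. 1::real)"
      by (rule set_integrable_subset) (use R RC in auto)
    thus ?thesis by (simp add: dexp)
  qed
  have inj: "inj_on exp R" by (rule inj_on_subset[OF inj_on_exp_strip]) (auto simp: R_def)
  note la = log_area_image[of exp UNIV R, OF _ _ _ R _ inj int, unfolded img]
  show "set_integrable lborel {w. a \<le> cmod w \<and> cmod w \<le> b} (\<lambda>w. 1 / (cmod w)\<^sup>2)"
    by (rule la(1)) (use cl in \<open>auto intro: holomorphic_intros\<close>)
  have "set_lebesgue_integral lborel {w. a \<le> cmod w \<and> cmod w \<le> b} (\<lambda>w. 1 / (cmod w)\<^sup>2)
     = set_lebesgue_integral lborel R (\<lambda>z. (cmod (deriv exp z / exp z))\<^sup>2)"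
    by (rule la(2)) (use cl in \<open>auto intro: holomorphic_intros\<close>)
  also have "\<dots> = measure lborel R" using R by (simp add: set_lebesgue_integral_def dexp)
  also have "\<dots> \<le> measure lborel C"
    using RC R by (intro measure_mono_fmeasurable) (auto simp: C_def fmeasurable_def emeasure_lborel_cbox_finite[unfolded infinity_ennreal_def])
  also have "\<dots> = (ln b - ln a) * (2 * pi)"
    unfolding C_def using assms b0
    by (subst content_cbox) (auto simp: Basis_complex_def inner_complex_def)
  finally show "set_lebesgue_integral lborel {w. a \<le> cmod w \<and> cmod w \<le> b} (\<lambda>w. 1 / (cmod w)\<^sup>2)
         \<le> 2 * pi * (ln b - ln a)" by (simp add: mult.commute)
qed

lemma distr_lborel_Complex: "distr lborel borel (\<lambda>(x, y). Complex x y) = lborel"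
proof (rule lborel_distr_basis_permutation)
  show "linear (\<lambda>(x, y). Complex x y)"
    by (rule linearI) (auto simp: complex_eq_iff)
  have B: "(Basis :: (real \<times> real) set) = {(1, 0), (0, 1)}" by (auto simp: Basis_prod_def)
  show "bij_betw (\<lambda>(x, y). Complex x y) Basis Basis"
    unfolding B by (auto simp: Basis_complex_def bij_betw_def inj_on_def complex_eq_iff)
qed

text \<open>In logarithmic coordinates a circle is a vertical segment, on which \<open>\<bar>E\<bar>\<^sup>2 = \<bar>E\<^sup>2\<bar>\<close> has at least
the mean \<open>\<bar>(E 0)\<^sup>2\<bar>\<close>.\<close>

lemma mean_square_exp_rectangle:
  fixes E :: "complex \<Rightarrow> complex"
  assumes E: "E holomorphic_on ball 0 1" and st: "0 < s" "s \<le> t" "t < 1"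
  defines "R \<equiv> box (Complex (ln s) 0) (Complex (ln t) (2 * pi))"
  shows "set_integrable lborel R (\<lambda>z. (cmod (E (exp z)))\<^sup>2)"
    and "2 * pi * (ln t - ln s) * (cmod (E 0))\<^sup>2
         \<le> set_lebesgue_integral lborel R (\<lambda>z. (cmod (E (exp z)))\<^sup>2)"
proof -
  define F where "F z = (cmod (E (exp z)))\<^sup>2" for z
  define C where "C = cbox (Complex (ln s) 0) (Complex (ln t) (2 * pi))"
  have lt: "ln s \<le> ln t" "ln t < 0" using st by auto
  have contF: "continuous_on {z. Re z < 0} F"
  proof -
    have "continuous_on {z. Re z < 0} (\<lambda>z. E (exp z))"
      by (rule continuous_on_compose2[OF holomorphic_on_imp_continuous_on[OF E]])
        (auto intro: continuous_intros)
    thus ?thesis unfolding F_def by (intro continuous_intros)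
  qed
  have CA: "C \<subseteq> {z. Re z < 0}" using lt by (auto simp: C_def in_cbox_complex_iff)
  have "set_integrable lborel C F"
    unfolding set_integrable_def C_def
    by (intro borel_integrable_compact compact_cbox) (rule continuous_on_subset[OF contF CA[unfolded C_def]])
  hence intR: "set_integrable lborel R F"
    by (rule set_integrable_subset) (auto simp: R_def C_def box_subset_cbox)
  thus "set_integrable lborel R (\<lambda>z. (cmod (E (exp z)))\<^sup>2)" by (simp add: F_def[abs_def])
  define G where "G p = (case p of (x, y) \<Rightarrow> F (Complex x y))" for p
  define B where "B = box (ln s, 0) (ln t, 2 * pi)"
  have ind: "indicator R (case p of (x, y) \<Rightarrow> Complex x y) *\<^sub>R F (case p of (x, y) \<Rightarrow> Complex x y)
      = indicator B p *\<^sub>R G p" for p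
    by (cases p) (auto simp: R_def B_def G_def in_box_complex_iff indicator_def box_prod mem_box)
  have LC: "(\<lambda>(x, y). Complex x y) \<in> lborel \<rightarrow>\<^sub>M borel"
    unfolding split_beta Complex_eq
    by (simp, intro borel_measurable_continuous_onI continuous_intros)
  have "set_lebesgue_integral lborel R F = set_lebesgue_integral lborel B G"
    unfolding set_lebesgue_integral_def ind[symmetric]
    using integral_distr[OF LC, of "\<lambda>z. indicator R z *\<^sub>R F z"]
      borel_measurable_integrable[OF intR[unfolded set_integrable_def]]
    by (simp add: distr_lborel_Complex)
  moreover have "set_integrable lborel B G"
    unfolding set_integrable_def ind[symmetric]
    using integrable_distr_eq[OF LC, of "\<lambda>z. indicator R z *\<^sub>R F z"]
      borel_measurable_integrable[OF intR[unfolded set_integrable_def]] intR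
    by (simp add: distr_lborel_Complex set_integrable_def)
  ultimately have "set_lebesgue_integral lborel R F = integral B G"
    by (simp add: set_borel_integral_eq_integral(2))
  also have "\<dots> = integral (cbox (ln s, 0) (ln t, 2 * pi)) G"
    unfolding B_def by (rule integral_open_interval)
  also have contG: "continuous_on (cbox (ln s, 0) (ln t, 2 * pi)) G"
    unfolding G_def split_beta
    by (rule continuous_on_compose2[OF contF])
      (use lt in \<open>auto simp: cbox_Pair_eq Complex_eq intro!: continuous_intros\<close>)
  have "integral (cbox (ln s, 0) (ln t, 2 * pi)) G
      = integral {ln s..ln t} (\<lambda>x. integral {0..2 * pi} (\<lambda>y. G (x, y)))"
    using integral_prod_continuous[OF contG] by simp
  also have "\<dots> \<ge> integral {ln s..ln t} (\<lambda>x. 2 * pi * (cmod (E 0))\<^sup>2)"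
  proof (rule integral_le)
    show "(\<lambda>x. integral {0..2 * pi} (\<lambda>y. G (x, y))) integrable_on {ln s..ln t}"
      using integral_integrable_2dim[OF contG] by simp
    show "2 * pi * (cmod (E 0))\<^sup>2 \<le> integral {0..2 * pi} (\<lambda>y. G (x, y))" if x: "x \<in> {ln s..ln t}" for x
    proof -
      define \<rho> where "\<rho> = exp x"
      have \<rho>: "0 < \<rho>" "\<rho> < 1" using x lt by (auto simp: \<rho>_def)
      have "(\<lambda>z. (E z)\<^sup>2) holomorphic_on ball 0 1" by (intro holomorphic_intros E)
      from cauchy_formula_circle_mean[OF this \<rho>, of 0]
      have I: "((\<lambda>y. (E (\<rho> * cis y))\<^sup>2) has_integral 2 * pi * (E 0)\<^sup>2) {0..2 * pi}" using \<rho> by simp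
      have Gy: "G (x, y) = cmod ((E (\<rho> * cis y))\<^sup>2)" for y
        by (simp add: G_def F_def \<rho>_def norm_power exp_eq_polar exp_of_real)
      have "continuous_on {0..2 * pi} (\<lambda>y. G (x, y))"
        by (rule continuous_on_compose2[OF contG]) (use x in \<open>auto intro!: continuous_intros simp: cbox_Pair_eq\<close>)
      hence "(\<lambda>y. G (x, y)) integrable_on {0..2 * pi}" by (rule integrable_continuous_interval)
      hence "cmod (integral {0..2 * pi} (\<lambda>y. (E (\<rho> * cis y))\<^sup>2)) \<le> integral {0..2 * pi} (\<lambda>y. G (x, y))"
        using I by (intro integral_norm_bound_integral) (auto simp: Gy)
      thus ?thesis using I by (simp add: integral_unique norm_mult norm_power)
    qed
  qed auto
  finally show "2 * pi * (ln t - ln s) * (cmod (E 0))\<^sup>2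
         \<le> set_lebesgue_integral lborel R (\<lambda>z. (cmod (E (exp z)))\<^sup>2)"
    using lt by (simp add: F_def[abs_def] algebra_simps)
qed

text \<open>The maps \<open>\<Phi> = T \<circ> exp\<close> and \<open>\<Psi> = 1 / \<Phi>\<close> have the same logarithmic derivative up to sign, namely \<open>E \<circ> exp\<close>
with \<open>E z = z * deriv T z / T z\<close> and \<open>E 0 = 1\<close>, so their images of a rectangle have the same
logarithmic area. The images are disjoint because \<open>T z * T w \<noteq> 1\<close>. They avoid the disk of radius \<open>\<rho>\<close>,
which \<open>T\<close> covers near the origin, and then also the exterior of the disk of radius \<open>1 / \<rho>\<close>.\<close>

lemma log_area_comparison:
  assumes T: "T holomorphic_on ball 0 1" "inj_on T (ball 0 1)" "T 0 = 0"
    and prod: "\<And>z w. z \<in> ball 0 1 \<Longrightarrow> w \<in> ball 0 1 \<Longrightarrow> T z * T w \<noteq> 1"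
    and st: "0 < s" "s \<le> t" "t < 1" and \<rho>: "0 < \<rho>" "\<rho> \<le> 1"
    and cover: "ball 0 \<rho> \<subseteq> T ` ball 0 s"
  shows "ln t - ln s \<le> - ln \<rho>"
proof -
  define R where "R = box (Complex (ln s) 0) (Complex (ln t) (2 * pi))"
  define A where "A = {z::complex. Re z < 0}"
  define \<Phi> where "\<Phi> z = T (exp z)" for z
  define \<Psi> where "\<Psi> z = inverse (T (exp z))" for z
  define N where "N = {w::complex. \<rho> \<le> cmod w \<and> cmod w \<le> 1 / \<rho>}"
  define area where "area X = set_lebesgue_integral lborel X (\<lambda>w::complex. 1 / (cmod w)\<^sup>2)" for X
  have oA: "open A" unfolding A_def by (rule open_halfspace_Re_lt)
  have RA: "R \<subseteq> A" using st by (auto simp: R_def A_def in_box_complex_iff intro: order_less_trans)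
  have oR: "open R" unfolding R_def by (rule open_box)
  have eA: "exp z \<in> ball 0 1" if "z \<in> A" for z using that by (simp add: A_def)
  have eR: "s < cmod (exp z)" if "z \<in> R" for z
  proof -
    have "exp (ln s) < exp (Re z)" using that by (simp only: exp_less_cancel_iff) (simp add: R_def in_box_complex_iff)
    thus ?thesis using st by simp
  qed
  have T0: "T z \<noteq> 0" if "z \<in> ball 0 1" "z \<noteq> 0" for z
    using inj_onD[OF T(2), of z 0] that T(3) by auto
  have injR: "inj_on exp R"
    by (rule inj_on_subset[OF inj_on_exp_strip]) (auto simp: R_def in_box_complex_iff)
  have inj\<Phi>: "inj_on \<Phi> R"
    using injR T(2) eA RA unfolding inj_on_def \<Phi>_def by blast
  hence inj\<Psi>: "inj_on \<Psi> R" by (simp add: inj_on_def \<Phi>_def \<Psi>_def)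
  have dT: "(T has_field_derivative deriv T w) (at w)" if "w \<in> ball 0 1" for w
    using T(1) that by (intro holomorphic_derivI[of T "ball 0 1"]) auto
  have d\<Phi>: "(\<Phi> has_field_derivative deriv T (exp z) * exp z) (at z)" if "z \<in> A" for z
    unfolding \<Phi>_def using DERIV_chain2[OF dT[OF eA[OF that]] DERIV_exp] .
  have d\<Psi>: "(\<Psi> has_field_derivative - (deriv T (exp z) * exp z) / (\<Phi> z)\<^sup>2) (at z)" if "z \<in> A" for z
    unfolding \<Psi>_def
    by (rule DERIV_inverse_fun[OF d\<Phi>[OF that, unfolded \<Phi>_def], THEN DERIV_cong])
      (use T0[OF eA[OF that]] in \<open>auto simp: \<Phi>_def field_simps power2_eq_square\<close>)
  have hol: "\<Phi> holomorphic_on A" "\<Psi> holomorphic_on A"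
    using d\<Phi> d\<Psi> oA by (auto simp: holomorphic_on_open)
  obtain k where k: "k holomorphic_on ball 0 1" "\<And>z. cmod z < 1 \<Longrightarrow> T z = z * k z" "deriv T 0 = k 0"
    using Schwarz3[OF T(1,3)] by blast
  have T'0: "deriv T 0 \<noteq> 0"
    using holomorphic_injective_imp_regular[OF T(1) _ T(2), of 0] by simp
  have k0: "k z \<noteq> 0" if "z \<in> ball 0 1" for z
    using T0[OF that] k(2)[of z] that T'0 k(3) by (cases "z = 0") auto
  define E where "E z = deriv T z / k z" for z
  have E: "E holomorphic_on ball 0 1" unfolding E_def
    using k0 by (intro holomorphic_intros holomorphic_deriv T(1) k(1)) auto
  have E0: "E 0 = 1" using T'0 k(3) by (simp add: E_def)
  have q\<Phi>: "deriv \<Phi> z / \<Phi> z = E (exp z)" if "z \<in> A" for z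
    using DERIV_imp_deriv[OF d\<Phi>[OF that]] k(2)[of "exp z"] eA[OF that] k0[OF eA[OF that]]
    by (simp add: E_def \<Phi>_def)
  have q\<Psi>: "deriv \<Psi> z / \<Psi> z = - E (exp z)" if "z \<in> A" for z
    using DERIV_imp_deriv[OF d\<Psi>[OF that]] k(2)[of "exp z"] eA[OF that] k0[OF eA[OF that]]
    by (simp add: E_def \<Psi>_def \<Phi>_def power2_eq_square field_simps)
  note ms = mean_square_exp_rectangle[OF E st, folded R_def, unfolded E0]
  have oX: "\<Phi> ` R \<in> sets borel" "\<Psi> ` R \<in> sets borel"
    using open_mapping_thm3[OF holomorphic_on_subset[OF hol(1) RA] oR inj\<Phi>]
      open_mapping_thm3[OF holomorphic_on_subset[OF hol(2) RA] oR inj\<Psi>] by auto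
  have Rb: "R \<in> sets borel" using oR by simp
  have cong: "set_integrable lborel R g \<longleftrightarrow> set_integrable lborel R g'"
    "set_lebesgue_integral lborel R g = set_lebesgue_integral lborel R g'"
    if "\<And>z. z \<in> A \<Longrightarrow> g z = g' z" for g g' :: "complex \<Rightarrow> real"
  proof -
    have eq: "indicat_real R z *\<^sub>R g z = indicat_real R z *\<^sub>R g' z" for z
      using that RA by (auto simp: indicator_def)
    show "set_integrable lborel R g = set_integrable lborel R g'"
      unfolding set_integrable_def eq ..
    show "set_lebesgue_integral lborel R g = set_lebesgue_integral lborel R g'"
      unfolding set_lebesgue_integral_def eq ..
  qed
  have i\<Phi>: "set_integrable lborel R (\<lambda>z. (cmod (deriv \<Phi> z / \<Phi> z))\<^sup>2)"
    using ms(1) by (subst cong(1)[where g'="\<lambda>z. (cmod (E (exp z)))\<^sup>2"]) (simp_all add: q\<Phi>)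
  have i\<Psi>: "set_integrable lborel R (\<lambda>z. (cmod (deriv \<Psi> z / \<Psi> z))\<^sup>2)"
    using ms(1) by (subst cong(1)[where g'="\<lambda>z. (cmod (E (exp z)))\<^sup>2"]) (simp_all add: q\<Psi>)
  note a\<Phi> = log_area_image[OF hol(1) oA RA Rb oX(1) inj\<Phi> i\<Phi>]
  note a\<Psi> = log_area_image[OF hol(2) oA RA Rb oX(2) inj\<Psi> i\<Psi>]
  have "area (\<Phi> ` R) = set_lebesgue_integral lborel R (\<lambda>z. (cmod (E (exp z)))\<^sup>2)"
    unfolding area_def a\<Phi>(2) by (rule cong(2)) (simp add: q\<Phi>)
  moreover have "area (\<Psi> ` R) = set_lebesgue_integral lborel R (\<lambda>z. (cmod (E (exp z)))\<^sup>2)"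
    unfolding area_def a\<Psi>(2) by (rule cong(2)) (simp add: q\<Psi>)
  ultimately have lower: "2 * (2 * pi * (ln t - ln s)) \<le> area (\<Phi> ` R) + area (\<Psi> ` R)"
    using ms(2) by simp
  have bounds: "\<rho> \<le> cmod (T w) \<and> \<rho> \<le> cmod (inverse (T w))" if w: "w \<in> ball 0 1" "s < cmod w" for w
  proof -
    have "w \<noteq> 0" using w st by auto
    hence w0: "T w \<noteq> 0" using T0[of w] w by auto
    have "T w \<notin> ball 0 \<rho>"
    proof
      assume "T w \<in> ball 0 \<rho>"
      then obtain v where v: "v \<in> ball 0 s" "T w = T v" using cover by blast
      hence "w = v" using inj_onD[OF T(2) v(2)] w st by auto
      thus False using v w by simp
    qed
    moreover have "inverse (T w) \<notin> ball 0 \<rho>"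
    proof
      assume "inverse (T w) \<in> ball 0 \<rho>"
      then obtain v where v: "v \<in> ball 0 s" "inverse (T w) = T v" using cover by blast
      hence "T w * T v = 1" using w0 by (metis right_inverse)
      thus False using prod[of w v] v w st by auto
    qed
    ultimately show ?thesis by simp
  qed
  have sub: "\<Phi> ` R \<subseteq> N" "\<Psi> ` R \<subseteq> N"
  proof -
    have "\<rho> \<le> cmod (\<Phi> z) \<and> \<rho> \<le> cmod (\<Psi> z) \<and> \<Psi> z = inverse (\<Phi> z)" if "z \<in> R" for z
      using bounds[of "exp z"] eR[OF that] eA[of z] that RA by (auto simp: \<Phi>_def \<Psi>_def)
    moreover have "cmod w \<le> 1 / \<rho>" if "\<rho> \<le> cmod (inverse w)" for w
    proof -
      have "w \<noteq> 0" using that \<rho> by auto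
      hence "cmod w > 0" by simp
      thus ?thesis using that \<rho> by (simp add: norm_inverse norm_divide pos_le_divide_eq mult.commute inverse_eq_divide)
    qed
    ultimately show "\<Phi> ` R \<subseteq> N" "\<Psi> ` R \<subseteq> N" unfolding N_def by (auto, force+)
  qed
  have disj: "\<Phi> ` R \<inter> \<Psi> ` R = {}"
  proof -
    have "\<Phi> z \<noteq> \<Psi> w" if "z \<in> R" "w \<in> R" for z w
    proof
      assume "\<Phi> z = \<Psi> w"
      moreover have "T (exp w) \<noteq> 0" using T0[OF eA[of w]] that RA by auto
      ultimately have "T (exp z) * T (exp w) = 1" by (simp add: \<Phi>_def \<Psi>_def)
      thus False using prod[OF eA eA, of z w] that RA by auto
    qed
    thus ?thesis by blast
  qed
  have le1: "\<rho> \<le> 1 / \<rho>"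
    using \<rho> mult_le_one[of \<rho> \<rho>] by (simp add: field_simps)
  note an = log_area_annulus[OF \<rho>(1) le1, folded N_def]
  have "area (\<Phi> ` R) + area (\<Psi> ` R) = area (\<Phi> ` R \<union> \<Psi> ` R)"
    unfolding area_def using a\<Phi>(1) a\<Psi>(1) disj by (subst set_integral_Un) auto
  also have "\<dots> \<le> area N"
    unfolding area_def set_lebesgue_integral_def
  proof (rule integral_mono)
    show "integrable lborel (\<lambda>x. indicat_real (\<Phi> ` R \<union> \<Psi> ` R) x *\<^sub>R (1 / (cmod x)\<^sup>2))"
      using set_integrable_Un[OF a\<Phi>(1) a\<Psi>(1)] oX by (simp add: set_integrable_def)
    show "integrable lborel (\<lambda>x. indicat_real N x *\<^sub>R (1 / (cmod x)\<^sup>2))"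
      using an(1) by (simp add: set_integrable_def)
    show "indicat_real (\<Phi> ` R \<union> \<Psi> ` R) x *\<^sub>R (1 / (cmod x)\<^sup>2) \<le> indicat_real N x *\<^sub>R (1 / (cmod x)\<^sup>2)" for x
      using sub by (auto simp: indicator_def)
  qed
  also have "\<dots> \<le> 2 * pi * (ln (1 / \<rho>) - ln \<rho>)" unfolding area_def by (rule an(2))
  also have "\<dots> = 2 * (2 * pi * (- ln \<rho>))" using \<rho> by (simp add: ln_div)
  finally have "2 * (2 * pi * (ln t - ln s)) \<le> 2 * (2 * pi * (- ln \<rho>))" using lower by linarith
  hence "pi * (ln t - ln s) \<le> pi * (- ln \<rho>)" by linarith
  thus ?thesis by (rule mult_left_le_imp_le) simp
qed

text \<open>For \<open>c < \<bar>deriv T 0\<bar>\<close> and small \<open>\<rho>\<close> the image of the disk of radius \<open>s = \<rho> / c\<close> covers the disk of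
radius \<open>\<rho>\<close>, because the inverse function has derivative \<open>1 / deriv T 0\<close> at the origin. Comparing
areas gives \<open>t * c \<le> 1\<close> for every \<open>t\<close> between \<open>s\<close> and 1.\<close>

theorem univalent_bieberbach_eilenberg:
  assumes T: "T holomorphic_on ball 0 1" "inj_on T (ball 0 1)" "T 0 = 0"
    and prod: "\<And>z w. z \<in> ball 0 1 \<Longrightarrow> w \<in> ball 0 1 \<Longrightarrow> T z * T w \<noteq> 1"
  shows "cmod (deriv T 0) \<le> 1"
proof (rule dense_le)
  fix c' assume c': "c' < cmod (deriv T 0)"
  define c where "c = max c' (cmod (deriv T 0) / 2)"
  have T'0: "deriv T 0 \<noteq> 0"
    using holomorphic_injective_imp_regular[OF T(1) _ T(2), of 0] by simp
  have c: "0 < c" "c < cmod (deriv T 0)" "c' \<le> c" using c' T'0 by (auto simp: c_def less_max_iff_disj)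
  obtain g where g: "g holomorphic_on T ` ball 0 1" "\<And>z. z \<in> ball 0 1 \<Longrightarrow> deriv T z * deriv g (T z) = 1"
      "\<And>z. z \<in> ball 0 1 \<Longrightarrow> g (T z) = z"
    using holomorphic_has_inverse[OF T(1) _ T(2)] by auto
  have oI: "open (T ` ball 0 1)" by (rule open_mapping_thm3[OF T(1) _ T(2)]) simp
  have I0: "0 \<in> T ` ball 0 1" using T(3) by (intro image_eqI[of _ _ 0]) auto
  have g0: "g 0 = 0" using g(3)[of 0] T(3) by simp
  have dg: "(g has_field_derivative deriv g 0) (at 0)"
    using holomorphic_derivI[OF g(1) oI I0] .
  have "cmod (deriv T 0) * cmod (deriv g 0) = 1" using g(2)[of 0] T(3) by (metis centre_in_ball norm_mult norm_one zero_less_one)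
  hence "cmod (deriv g 0) = 1 / cmod (deriv T 0)" using T'0 by (simp add: field_simps)
  also have "\<dots> < 1 / c" using c by (intro divide_strict_left_mono mult_pos_pos) auto
  finally have small: "1 / c - cmod (deriv g 0) > 0" by simp
  obtain d where d: "d > 0" "\<And>w. cmod w < d \<Longrightarrow> cmod (g w - deriv g 0 * w) \<le> (1 / c - cmod (deriv g 0)) * cmod w"
  proof -
    have "(g has_derivative (\<lambda>h. deriv g 0 * h)) (at 0)" using dg by (simp add: has_field_derivative_def)
    then show ?thesis using small that unfolding has_derivative_at_alt
      by (metis diff_zero g0)
  qed
  have glow: "cmod (g w) \<le> cmod w / c" if "cmod w < d" for w
  proof -
    have "cmod (g w) \<le> cmod (g w - deriv g 0 * w) + cmod (deriv g 0 * w)"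
      by (metis diff_add_cancel norm_triangle_ineq)
    also have "\<dots> \<le> (1 / c - cmod (deriv g 0)) * cmod w + cmod (deriv g 0) * cmod w"
      using d(2)[OF that] by (simp add: norm_mult)
    finally show ?thesis by (simp add: algebra_simps)
  qed
  obtain d' where d': "d' > 0" "ball 0 d' \<subseteq> T ` ball 0 1"
    using oI I0 by (meson openE)
  \<comment> \<open>the entry \<open>c / 2\<close> makes \<open>s < 1\<close>\<close>
  define \<rho> where "\<rho> = Min {d, d', c / 2, 1}"
  define s where "s = \<rho> / c"
  have \<rho>: "0 < \<rho>" "\<rho> \<le> d" "\<rho> \<le> d'" "\<rho> \<le> c / 2" "\<rho> \<le> 1" using d(1) d'(1) c by (auto simp: \<rho>_def)
  have s: "0 < s" "s < 1" using \<rho> c by (auto simp: s_def field_simps)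
  have cover: "ball 0 \<rho> \<subseteq> T ` ball 0 s"
  proof
    fix w :: complex assume w: "w \<in> ball 0 \<rho>"
    hence "w \<in> T ` ball 0 1" using d' \<rho> by auto
    then obtain z where z: "z \<in> ball 0 1" "w = T z" by auto
    have "cmod z \<le> cmod w / c" using glow[of w] w \<rho> g(3)[OF z(1)] z(2) by auto
    also have "\<dots> < s" using w c by (simp add: s_def divide_strict_right_mono)
    finally show "w \<in> T ` ball 0 s" using z by auto
  qed
  have "t * c \<le> 1" if t: "s \<le> t" "t < 1" for t
  proof -
    have t0: "t > 0" using s t by simp
    have "ln t - ln s \<le> - ln \<rho>"
      using log_area_comparison[OF T prod s(1) t \<rho>(1,5) cover] by simp
    hence "ln (t * \<rho>) \<le> ln s" using t0 \<rho> by (simp add: ln_mult)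
    hence "t * \<rho> \<le> s" using t0 \<rho> s by simp
    hence "t * \<rho> * c \<le> \<rho>" using c by (simp add: s_def field_simps)
    hence "t * c \<le> 1" using \<rho>(1) by (simp add: mult.assoc mult.left_commute)
    thus ?thesis .
  qed
  note tc = this
  have "c \<le> 1"
  proof (rule ccontr)
    assume "\<not> c \<le> 1"
    hence c1: "1 / c < 1" "1 / c > 0" using c by auto
    define t where "t = max s ((1 / c + 1) / 2)"
    have "1 / c < (1 / c + 1) / 2" "(1 / c + 1) / 2 < 1" using c1(1) by argo+
    hence "s \<le> t" "t < 1" "1 / c < t" using s by (auto simp: t_def less_max_iff_disj)
    hence "1 < t * c" using c by (simp add: field_simps)
    thus False using tc[of t] \<open>s \<le> t\<close> \<open>t < 1\<close> by simp
  qed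
  thus "c' \<le> 1" using c by simp
qed

section \<open>Koebe distortion and the Schwarz--Pick inequality\<close>

lemma Moebius_function_DERIV:
  assumes "cmod a < 1" "cmod z < 1"
  shows "(Moebius_function 0 a has_field_derivative (1 - (cmod a)\<^sup>2) / (1 - cnj a * z)\<^sup>2) (at z)"
proof -
  have "cmod (cnj a * z) < 1" using norm_mult_less[of "cnj a" 1 z 1] assms by simp
  hence n0: "1 - cnj a * z \<noteq> 0" by auto
  have nn: "complex_of_real (cmod a) * complex_of_real (cmod a) = a * cnj a"
    using complex_norm_square[of a] by (simp add: power2_eq_square)
  have "((\<lambda>z. (z - a) / (1 - cnj a * z)) has_field_derivative (1 - (cmod a)\<^sup>2) / (1 - cnj a * z)\<^sup>2) (at z)"
    by (rule derivative_eq_intros refl | use n0 in force)+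
      (use n0 in \<open>simp add: nn power2_eq_square field_simps\<close>)
  thus ?thesis by (simp add: Moebius_function_simple[abs_def])
qed

text \<open>Univalence of the zero-free function \<open>F = H\<^sup>2\<close> means that \<open>H\<close> is univalent and that \<open>H z + H w\<close> never vanishes. The
quotient \<open>T = (H - h) / (H + h)\<close> turns the second property into \<open>T z * T w \<noteq> 1\<close>, since
\<open>w \<mapsto> - w\<close> corresponds to \<open>t \<mapsto> 1 / t\<close>.\<close>

lemma koebe_nonvanishing_at_0:
  assumes F: "F holomorphic_on ball 0 1" "inj_on F (ball 0 1)"
    and nz: "\<And>z. z \<in> ball 0 1 \<Longrightarrow> F z \<noteq> 0"
  shows "cmod (deriv F 0) \<le> 4 * cmod (F 0)"
proof -
  obtain H where H: "H holomorphic_on ball 0 1" "\<And>z. z \<in> ball 0 1 \<Longrightarrow> F z = (H z)\<^sup>2"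
    using contractible_imp_holomorphic_sqrt[OF F(1) _ nz] convex_imp_contractible[OF convex_ball] by blast
  define h where "h = H 0"
  have h0: "h \<noteq> 0" using nz[of 0] H(2)[of 0] by (auto simp: h_def)
  have sep: "z = w" if "z \<in> ball 0 1" "w \<in> ball 0 1" "(H z)\<^sup>2 = (H w)\<^sup>2" for z w
    using that H(2) F(2) by (metis inj_onD)
  have anti: "H z + H w \<noteq> 0" if "z \<in> ball 0 1" "w \<in> ball 0 1" for z w
  proof
    assume "H z + H w = 0"
    hence m: "H w = - H z" by (simp add: eq_neg_iff_add_eq_0 add.commute)
    hence "z = w" using sep[OF that] by simp
    hence "H z = 0" using m by simp
    thus False using nz[OF that(1)] H(2)[OF that(1)] by simp
  qed
  have den: "H z + h \<noteq> 0" if "z \<in> ball 0 1" for z using anti[OF that, of 0] by (simp add: h_def)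
  define T where "T z = (H z - h) / (H z + h)" for z
  have T: "T holomorphic_on ball 0 1" unfolding T_def using den by (intro holomorphic_intros H) auto
  have injT: "inj_on T (ball 0 1)"
  proof (rule inj_onI)
    fix z w assume zw: "z \<in> ball 0 1" "w \<in> ball 0 1" "T z = T w"
    hence "(H z - h) * (H w + h) = (H w - h) * (H z + h)"
      using den by (simp add: T_def frac_eq_eq)
    hence "2 * h * (H z - H w) = 0" by (simp add: algebra_simps)
    hence "H z = H w" using h0 by simp
    thus "z = w" using sep zw by simp
  qed
  have prod: "T z * T w \<noteq> 1" if "z \<in> ball 0 1" "w \<in> ball 0 1" for z w
  proof
    assume "T z * T w = 1"
    hence "(H z - h) * (H w - h) = (H z + h) * (H w + h)"
      using den that by (simp add: T_def field_simps)
    hence "2 * h * (H z + H w) = 0" by (simp add: algebra_simps)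
    thus False using h0 anti[OF that] by simp
  qed
  have dH: "(H has_field_derivative deriv H 0) (at 0)" using H(1) by (intro holomorphic_derivI[of H "ball 0 1"]) auto
  have "(T has_field_derivative (deriv H 0 * (H 0 + h) - (H 0 - h) * deriv H 0) / ((H 0 + h) * (H 0 + h))) (at 0)"
    unfolding T_def using den[of 0] by (auto intro!: derivative_eq_intros dH)
  hence dT: "deriv T 0 = deriv H 0 / (2 * h)"
    using h0 by (simp add: DERIV_imp_deriv h_def[symmetric] field_simps)
  have "((\<lambda>z. (H z)\<^sup>2) has_field_derivative 2 * h * deriv H 0) (at 0)"
    by (auto intro!: derivative_eq_intros dH simp: h_def)
  moreover have "eventually (\<lambda>z. (H z)\<^sup>2 = F z) (nhds 0)"
    using eventually_nhds_in_open[of "ball 0 1" 0] H(2) by (auto elim!: eventually_mono)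
  ultimately have "deriv F 0 = 2 * h * deriv H 0"
    by (metis DERIV_imp_deriv deriv_cong_ev)
  also have "\<dots> = 4 * (h\<^sup>2 * deriv T 0)" using h0 by (simp add: dT power2_eq_square)
  also have "h\<^sup>2 = F 0" using H(2)[of 0] by (simp add: h_def)
  finally have "cmod (deriv F 0) = 4 * (cmod (F 0) * cmod (deriv T 0))" by (simp add: norm_mult)
  moreover have "cmod (deriv T 0) \<le> 1"
    by (rule univalent_bieberbach_eilenberg[OF T injT]) (use prod in \<open>auto simp: T_def h_def\<close>)
  ultimately show ?thesis using mult_left_le[of "cmod (deriv T 0)" "cmod (F 0)"] by simp
qed

lemma koebe_nonvanishing:
  assumes F: "F holomorphic_on ball 0 1" "inj_on F (ball 0 1)"
    and nz: "\<And>z. z \<in> ball 0 1 \<Longrightarrow> F z \<noteq> 0" and \<zeta>: "cmod \<zeta> < 1"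
  shows "(1 - (cmod \<zeta>)\<^sup>2) * cmod (deriv F \<zeta>) \<le> 4 * cmod (F \<zeta>)"
proof -
  define m where "m = Moebius_function 0 (- \<zeta>)"
  have mb: "m z \<in> ball 0 1" if "z \<in> ball 0 1" for z
    using Moebius_function_norm_lt_1[of "-\<zeta>" z] \<zeta> that by (simp add: m_def)
  have m0: "m 0 = \<zeta>" by (simp add: m_def Moebius_function_of_zero)
  have injm: "inj_on m (ball 0 1)"
    by (rule inj_on_inverseI[where g="Moebius_function 0 \<zeta>"])
      (use \<zeta> in \<open>simp add: m_def Moebius_function_compose\<close>)
  have holm: "m holomorphic_on ball 0 1" unfolding m_def using \<zeta> by (intro Moebius_function_holomorphic) simp
  have "(m has_field_derivative (1 - (cmod \<zeta>)\<^sup>2)) (at 0)"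
    using Moebius_function_DERIV[of "-\<zeta>" 0] \<zeta> by (simp add: m_def)
  moreover have "(F has_field_derivative deriv F \<zeta>) (at \<zeta>)"
    using F(1) \<zeta> by (intro holomorphic_derivI[of F "ball 0 1"]) auto
  ultimately have "((\<lambda>z. F (m z)) has_field_derivative deriv F \<zeta> * (1 - (cmod \<zeta>)\<^sup>2)) (at 0)"
    by (intro DERIV_chain2) (simp_all add: m0)
  hence d: "deriv (\<lambda>z. F (m z)) 0 = deriv F \<zeta> * (1 - (cmod \<zeta>)\<^sup>2)" by (rule DERIV_imp_deriv)
  have "cmod (deriv (\<lambda>z. F (m z)) 0) \<le> 4 * cmod (F (m 0))"
  proof (rule koebe_nonvanishing_at_0)
    show "(\<lambda>z. F (m z)) holomorphic_on ball 0 1"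
      using holomorphic_on_compose_gen[OF holm F(1) image_subsetI[OF mb]] by (simp add: o_def)
    show "inj_on (\<lambda>z. F (m z)) (ball 0 1)"
      using F(2) injm mb unfolding inj_on_def by blast
  qed (use nz mb in auto)
  moreover have "cmod (1 - (cmod \<zeta>)\<^sup>2) = 1 - (cmod \<zeta>)\<^sup>2"
  proof -
    have "(cmod \<zeta>)\<^sup>2 \<le> 1" using \<zeta> by (simp add: power_le_one)
    moreover have "cmod (1 - (cmod \<zeta>)\<^sup>2) = \<bar>1 - (cmod \<zeta>)\<^sup>2\<bar>"
      by (metis norm_of_real of_real_1 of_real_diff)
    ultimately show ?thesis by simp
  qed
  ultimately show ?thesis by (simp add: d m0 norm_mult mult.commute)
qed

text \<open>Integrating the logarithmic derivative, at most \<open>4 / (1 - \<bar>z\<bar>\<^sup>2)\<close>, along the radius to \<open>\<zeta>\<close> gives the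
factor \<open>((1 - \<bar>\<zeta>\<bar>) / (1 + \<bar>\<zeta>\<bar>))\<^sup>2\<close>, and \<open>1 + \<bar>\<zeta>\<bar> \<le> 2\<close>; the
exponent 2 comes from the constant 4.\<close>

lemma koebe_growth_nonvanishing:
  assumes F: "F holomorphic_on ball 0 1" "inj_on F (ball 0 1)"
    and nz: "\<And>z. z \<in> ball 0 1 \<Longrightarrow> F z \<noteq> 0" and \<zeta>: "cmod \<zeta> < 1"
  shows "cmod (F 0) * (1 - cmod \<zeta>)\<^sup>2 / 4 \<le> cmod (F \<zeta>)"
proof -
  define a where "a = cmod \<zeta>"
  have a: "0 \<le> a" "a < 1" using \<zeta> by (auto simp: a_def)
  obtain G where G: "G holomorphic_on ball 0 1" "\<And>z. z \<in> ball 0 1 \<Longrightarrow> F z = exp (G z)"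
    using contractible_imp_holomorphic_log[OF F(1) _ nz] convex_imp_contractible[OF convex_ball] by blast
  have dG: "(G has_field_derivative deriv G z) (at z)" if "z \<in> ball 0 1" for z
    using G(1) that by (intro holomorphic_derivI[of G "ball 0 1"]) auto
  have Gle: "(1 - (cmod z)\<^sup>2) * cmod (deriv G z) \<le> 4" if z: "z \<in> ball 0 1" for z
  proof -
    have "((\<lambda>z. exp (G z)) has_field_derivative exp (G z) * deriv G z) (at z)"
      by (auto intro!: derivative_eq_intros dG z)
    moreover have "eventually (\<lambda>z. exp (G z) = F z) (nhds z)"
      using eventually_nhds_in_open[of "ball 0 1" z] z G(2) by (auto elim!: eventually_mono)
    ultimately have "deriv F z = F z * deriv G z"
      using G(2)[OF z] by (metis DERIV_imp_deriv deriv_cong_ev)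
    hence "cmod (F z) * ((1 - (cmod z)\<^sup>2) * cmod (deriv G z)) \<le> cmod (F z) * 4"
      using koebe_nonvanishing[OF F nz, of z] z by (simp add: norm_mult mult_ac)
    thus ?thesis using nz[OF z] by simp
  qed
  define v where "v t = Re (G (of_real t * \<zeta>)) + 2 * (ln (1 + a * t) - ln (1 - a * t))" for t :: real
  have "v 0 \<le> v 1"
  proof (rule DERIV_nonneg_imp_nondecreasing[of 0 1 v])
    fix t :: real assume t: "0 \<le> t" "t \<le> 1"
    have at: "0 \<le> a * t" "a * t < 1" using a t mult_left_le[of t a] by auto
    have n: "cmod (of_real t * \<zeta>) = a * t" using t by (simp add: norm_mult a_def)
    hence b: "of_real t * \<zeta> \<in> ball 0 1" using at by simp
    have "((\<lambda>t. of_real t * \<zeta>) has_vector_derivative \<zeta>) (at t)"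
      by (rule derivative_eq_intros refl | simp)+
    from field_vector_diff_chain_at[OF this dG[OF b]]
    have "((\<lambda>t. G (of_real t * \<zeta>)) has_vector_derivative \<zeta> * deriv G (of_real t * \<zeta>)) (at t)"
      by (simp add: o_def)
    hence "((\<lambda>t. Re (G (of_real t * \<zeta>))) has_vector_derivative Re (\<zeta> * deriv G (of_real t * \<zeta>))) (at t)"
      by (rule bounded_linear.has_vector_derivative[OF bounded_linear_Re])
    hence 1: "((\<lambda>t. Re (G (of_real t * \<zeta>))) has_real_derivative Re (\<zeta> * deriv G (of_real t * \<zeta>))) (at t)"
      by (simp add: has_real_derivative_iff_has_vector_derivative)
    have 2: "((\<lambda>t. ln (1 + a * t) - ln (1 - a * t)) has_real_derivative a / (1 + a * t) + a / (1 - a * t)) (at t)"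
      using at by (auto intro!: derivative_eq_intros simp: divide_inverse)
    have 3: "(v has_real_derivative Re (\<zeta> * deriv G (of_real t * \<zeta>)) + 2 * (a / (1 + a * t) + a / (1 - a * t))) (at t)"
      unfolding v_def by (intro DERIV_add 1 DERIV_cmult 2)
    have "a / (1 + a * t) + a / (1 - a * t) = 2 * a / (1 - (a * t)\<^sup>2)"
    proof -
      have "(1 + a * t) * (1 - a * t) = 1 - (a * t)\<^sup>2" by (simp add: power2_eq_square algebra_simps)
      moreover have "a / (1 + a * t) + a / (1 - a * t) = 2 * a / ((1 + a * t) * (1 - a * t))"
        using at by (simp add: add_frac_eq) (simp add: algebra_simps)
      ultimately show ?thesis by simp
    qed
    moreover have "- (4 * a / (1 - (a * t)\<^sup>2)) \<le> Re (\<zeta> * deriv G (of_real t * \<zeta>))"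
    proof -
      have p: "1 - (a * t)\<^sup>2 > 0" using at by (simp add: power_less_one_iff abs_square_less_1)
      have "cmod (deriv G (of_real t * \<zeta>)) \<le> 4 / (1 - (a * t)\<^sup>2)"
        using Gle[OF b] p unfolding n by (simp add: field_simps)
      hence "a * cmod (deriv G (of_real t * \<zeta>)) \<le> a * (4 / (1 - (a * t)\<^sup>2))"
        using a by (intro mult_left_mono) auto
      hence "cmod (\<zeta> * deriv G (of_real t * \<zeta>)) \<le> 4 * a / (1 - (a * t)\<^sup>2)"
        by (simp add: norm_mult a_def mult.commute)
      thus ?thesis using abs_Re_le_cmod[of "\<zeta> * deriv G (of_real t * \<zeta>)"] by linarith
    qed
    ultimately show "\<exists>y. (v has_real_derivative y) (at t) \<and> 0 \<le> y"
      using 3 by (intro exI conjI) auto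
  qed simp
  hence "Re (G 0) \<le> Re (G \<zeta>) + 2 * (ln (1 + a) - ln (1 - a))" by (simp add: v_def)
  hence "exp (Re (G 0)) \<le> exp (Re (G \<zeta>) + 2 * (ln (1 + a) - ln (1 - a)))" by simp
  also have "\<dots> = exp (Re (G \<zeta>)) * ((1 + a) / (1 - a))\<^sup>2"
  proof -
    have "exp (2 * (ln (1 + a) - ln (1 - a))) = (exp (ln (1 + a) - ln (1 - a)))\<^sup>2"
      by (rule exp_double)
    also have "\<dots> = ((1 + a) / (1 - a))\<^sup>2" using a by (simp add: exp_diff)
    finally show ?thesis by (simp add: exp_add)
  qed
  finally have "cmod (F 0) \<le> cmod (F \<zeta>) * ((1 + a) / (1 - a))\<^sup>2"
    using G(2)[of 0] G(2)[of \<zeta>] \<zeta> by simp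
  hence "cmod (F 0) * (1 - a)\<^sup>2 \<le> cmod (F \<zeta>) * (1 + a)\<^sup>2"
    using a by (simp add: power_divide pos_le_divide_eq)
  also have "\<dots> \<le> cmod (F \<zeta>) * 2\<^sup>2" using a by (intro mult_left_mono power_mono) auto
  finally show ?thesis by (simp add: a_def)
qed

text \<open>Applied to \<open>\<psi> - w\<close> for an omitted value \<open>w\<close>, the growth estimate says that \<open>\<psi> \<zeta>\<close> is not close to \<open>w\<close>.\<close>

lemma univalent_image_contains_ball:
  assumes \<psi>: "\<psi> holomorphic_on ball 0 1" "inj_on \<psi> (ball 0 1)"
    and d: "ball (\<psi> 0) d \<subseteq> \<psi> ` ball 0 1" and \<zeta>: "cmod \<zeta> < 1"
  shows "ball (\<psi> \<zeta>) (d / 4 * (1 - cmod \<zeta>)\<^sup>2) \<subseteq> \<psi> ` ball 0 1"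
proof (rule ccontr)
  assume "\<not> ?thesis"
  then obtain w where w: "w \<in> ball (\<psi> \<zeta>) (d / 4 * (1 - cmod \<zeta>)\<^sup>2)" "w \<notin> \<psi> ` ball 0 1" by blast
  have "cmod (\<psi> 0 - w) * (1 - cmod \<zeta>)\<^sup>2 / 4 \<le> cmod (\<psi> \<zeta> - w)"
    by (rule koebe_growth_nonvanishing) (use \<psi> w \<zeta> in \<open>auto intro!: holomorphic_intros simp: inj_on_def\<close>)
  moreover have "d \<le> cmod (\<psi> 0 - w)" using d w(2) by (force simp: dist_norm)
  hence "d * (1 - cmod \<zeta>)\<^sup>2 \<le> cmod (\<psi> 0 - w) * (1 - cmod \<zeta>)\<^sup>2" by (intro mult_right_mono) auto
  moreover have "cmod (\<psi> \<zeta> - w) < d * (1 - cmod \<zeta>)\<^sup>2 / 4" using w(1) by (simp add: dist_norm)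
  ultimately show False by argo
qed

text \<open>Schwarz's lemma for \<open>\<phi>\<close> followed by the disk automorphism that moves \<open>\<phi> z\<close> to the origin. The factor
\<open>1 - \<bar>\<phi> z\<bar>\<^sup>2\<close> gains one power of the distance to the circle over the plain Cauchy estimate.\<close>

lemma schwarz_pick_ball:
  assumes \<phi>: "\<phi> holomorphic_on ball z d" and d: "d > 0"
    and lt: "\<And>w. w \<in> ball z d \<Longrightarrow> cmod (\<phi> w) < 1"
  shows "d * cmod (deriv \<phi> z) \<le> 1 - (cmod (\<phi> z))\<^sup>2"
proof -
  define a where "a = \<phi> z"
  have a: "cmod a < 1" using lt[of z] d by (simp add: a_def)
  have b: "z + of_real d * u \<in> ball z d" if "u \<in> ball 0 1" for u
    using that d by (simp add: dist_norm norm_mult)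
  define g where "g u = Moebius_function 0 a (\<phi> (z + of_real d * u))" for u
  have h: "(\<lambda>u. \<phi> (z + of_real d * u)) holomorphic_on ball 0 1"
  proof -
    have "(\<lambda>u. z + of_real d * u) holomorphic_on ball 0 1" by (intro holomorphic_intros)
    from holomorphic_on_compose_gen[OF this \<phi> image_subsetI[OF b]] show ?thesis by (simp add: o_def)
  qed
  have "g holomorphic_on ball 0 1"
    using holomorphic_on_compose_gen[OF h Moebius_function_holomorphic[OF a] image_subsetI] lt b
    by (simp add: o_def g_def[abs_def])
  moreover have "g 0 = 0" by (simp add: g_def a_def Moebius_function_eq_zero)
  moreover have "cmod (g u) < 1" if "cmod u < 1" for u
    unfolding g_def using a lt b[of u] that by (intro Moebius_function_norm_lt_1) auto
  ultimately have g1: "cmod (deriv g 0) \<le> 1" using Schwarz_Lemma[of g 0] by simp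
  have "(\<phi> has_field_derivative deriv \<phi> z) (at (z + of_real d * 0))"
    using \<phi> d by (simp, intro holomorphic_derivI[of \<phi> "ball z d"]) auto
  moreover have "((\<lambda>u. z + of_real d * u) has_field_derivative d) (at 0)"
    by (auto intro!: derivative_eq_intros)
  ultimately have 1: "((\<lambda>u. \<phi> (z + of_real d * u)) has_field_derivative deriv \<phi> z * d) (at 0)"
    by (rule DERIV_chain2)
  have 2: "(Moebius_function 0 a has_field_derivative (1 - (cmod a)\<^sup>2) / (1 - cnj a * a)\<^sup>2) (at (\<phi> (z + of_real d * 0)))"
    using Moebius_function_DERIV[OF a a] by (simp add: a_def)
  have p: "1 - (cmod a)\<^sup>2 > 0" using a by (simp add: abs_square_less_1)
  have "cnj a * a = (cmod a)\<^sup>2" by (metis complex_norm_square mult.commute)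
  hence "deriv g 0 = of_real (1 - (cmod a)\<^sup>2) / (of_real (1 - (cmod a)\<^sup>2))\<^sup>2 * (deriv \<phi> z * d)"
    unfolding g_def using DERIV_imp_deriv[OF DERIV_chain2[OF 2 1]] by simp
  also have "\<dots> = of_real (d / (1 - (cmod a)\<^sup>2)) * deriv \<phi> z"
  proof -
    have "complex_of_real (1 - (cmod a)\<^sup>2) \<noteq> 0" using p by (simp only: of_real_eq_0_iff)
    moreover have "X / X\<^sup>2 * (D * e) = e / X * D" if "X \<noteq> 0" for X D e :: complex
      using that by (simp add: power2_eq_square)
    ultimately show ?thesis unfolding of_real_divide by blast
  qed
  finally have "cmod (deriv g 0) = d / (1 - (cmod a)\<^sup>2) * cmod (deriv \<phi> z)"
    using p d by (simp add: norm_mult norm_divide del: of_real_divide of_real_diff)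
  thus ?thesis using g1 p by (simp add: a_def field_simps)
qed

section \<open>The Fatou set and the Siegel disk\<close>

lemma iter_dom_iff: "z \<in> iter_dom f U (Suc n) \<longleftrightarrow> (\<forall>k\<le>n. (f ^^ k) z \<in> U)"
  by (induction n) (auto simp: le_Suc_eq)

lemma iter_set_iff: "z \<in> iter_set f U \<longleftrightarrow> (\<forall>n. (f ^^ n) z \<in> U)"
proof -
  have "z \<in> iter_set f U \<longleftrightarrow> (\<forall>n\<ge>1. \<forall>k\<le>n. (f ^^ k) z \<in> U)"
    unfolding iter_set_def by (simp only: INT_iff iter_dom_iff atLeast_iff Ball_def)
  also have "\<dots> \<longleftrightarrow> (\<forall>n. (f ^^ n) z \<in> U)"
    by (metis le_add2 le_add1 plus_1_eq_Suc)
  finally show ?thesis .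
qed

lemma open_fatou: "open (fatou f U)"
proof (subst open_subopen, intro ballI)
  fix z assume "z \<in> fatou f U"
  then obtain V where V: "open V" "z \<in> V" "V \<subseteq> iter_set f U" "normal_family V {f ^^ n |n. n \<ge> 1}"
    by (auto simp: fatou_def)
  have "V \<subseteq> fatou f U"
    using V interior_maximal[OF V(3,1)] unfolding fatou_def by auto
  thus "\<exists>T. open T \<and> z \<in> T \<and> T \<subseteq> fatou f U" using V by blast
qed

lemma continuous_to_sphere: "continuous_on A to_sphere"
proof -
  have "1 + (cmod z)\<^sup>2 \<noteq> 0" for z using zero_le_power2[of "cmod z"] by linarith
  thus ?thesis unfolding to_sphere_def by (auto intro!: continuous_intros)
qed

text \<open>On a compact set the chordal metric is controlled by the Euclidean one.\<close>

lemma uniform_limit_to_sphere: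
  assumes lim: "uniform_limit K s g sequentially" and C: "compact C"
    and sC: "\<And>n z. z \<in> K \<Longrightarrow> s n z \<in> C"
  shows "uniform_limit K (\<lambda>n z. to_sphere (s n z)) (\<lambda>z. to_sphere (g z)) sequentially"
proof (rule uniform_limitI)
  fix e :: real assume e: "e > 0"
  have gC: "g z \<in> C" if "z \<in> K" for z
    using closed_sequentially[OF compact_imp_closed[OF C], of "\<lambda>n. s n z"] sC[OF that]
      tendsto_uniform_limitI[OF lim that] by blast
  have "uniformly_continuous_on C to_sphere"
    by (rule compact_uniformly_continuous[OF continuous_to_sphere C])
  then obtain d where d: "d > 0" "\<And>x y. x \<in> C \<Longrightarrow> y \<in> C \<Longrightarrow> dist y x < d \<Longrightarrow> dist (to_sphere y) (to_sphere x) < e"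
    using e unfolding uniformly_continuous_on_def by metis
  show "\<forall>\<^sub>F n in sequentially. \<forall>z\<in>K. dist (to_sphere (s n z)) (to_sphere (g z)) < e"
    using uniform_limitD[OF lim d(1)] by eventually_elim (use d(2) gC sC in blast)
qed

text \<open>Montel's theorem applies because all iterates map \<open>V\<close> into the bounded set \<open>S\<close>.\<close>

lemma bounded_orbits_subset_fatou:
  assumes V: "open V" and S: "bounded S" "open S" "S \<subseteq> U" and f: "f holomorphic_on S"
    and orb: "\<And>n z. z \<in> V \<Longrightarrow> (f ^^ n) z \<in> S"
  shows "V \<subseteq> fatou f U"
proof -
  have it: "V \<subseteq> iter_set f U" using orb S(3) unfolding subset_eq iter_set_iff by blast
  have hol: "(f ^^ n) holomorphic_on V" for n
  proof (induction n)
    case 0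
    have "(\<lambda>x. x) holomorphic_on V" by (rule holomorphic_on_ident)
    then show ?case by (simp add: id_def)
  next
    case (Suc n)
    have "(f \<circ> (f ^^ n)) holomorphic_on V"
      using orb by (intro holomorphic_on_compose_gen[OF Suc f]) auto
    then show ?case by (simp add: o_def)
  qed
  define C where "C = closure S"
  have C: "compact C" using S(1) by (simp add: C_def compact_closure)
  have SC: "S \<subseteq> C" by (simp add: C_def closure_subset)
  obtain B where B: "\<And>z. z \<in> S \<Longrightarrow> cmod z \<le> B" using S(1) by (auto simp: bounded_iff)
  have norm: "normal_family V {f ^^ n |n. n \<ge> 1}"
    unfolding normal_family_def
  proof (intro allI impI)
    fix s :: "nat \<Rightarrow> complex \<Rightarrow> complex" assume s: "range s \<subseteq> {f ^^ n |n. n \<ge> 1}"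
    have sS: "s n z \<in> S" if "z \<in> V" for n z
    proof -
      have "s n \<in> {f ^^ n |n. n \<ge> 1}" using s by auto
      thus ?thesis using orb[OF that] by auto
    qed
    obtain g r where gr: "strict_mono (r :: nat \<Rightarrow> nat)"
      "\<And>K. compact K \<Longrightarrow> K \<subseteq> V \<Longrightarrow> uniform_limit K (s \<circ> r) g sequentially"
    proof (rule Montel[OF V, of "{f ^^ n |n. n \<ge> 1}" s])
      show "h holomorphic_on V" if "h \<in> {f ^^ n |n. n \<ge> 1}" for h using that hol by auto
      show "\<exists>B. \<forall>h\<in>{f ^^ n |n. n \<ge> 1}. \<forall>z\<in>K. cmod (h z) \<le> B" if "compact K" "K \<subseteq> V" for K
        using B orb that by (intro exI[of _ B]) auto
    qed (use s in auto)
    show "\<exists>r g. strict_mono r \<and> (\<forall>K. compact K \<and> K \<subseteq> V \<longrightarrow>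
        uniform_limit K (\<lambda>n z. to_sphere (s (r n) z)) g sequentially)"
    proof (intro exI conjI allI impI)
      show "strict_mono r" by (rule gr)
      fix K assume K: "compact K \<and> K \<subseteq> V"
      show "uniform_limit K (\<lambda>n z. to_sphere (s (r n) z)) (\<lambda>z. to_sphere (g z)) sequentially"
        by (rule uniform_limit_to_sphere[OF _ C])
          (use gr(2)[of K] K sS SC in \<open>auto simp: o_def\<close>)
    qed
  qed
  show ?thesis
    using V it norm interior_maximal[OF it V] unfolding fatou_def by auto
qed

text \<open>The image of a disk is open, and a sequence of iterates converges on it as soon as its composition
with \<open>f\<close>, again a sequence of iterates, converges on the closed disk. The limit function on the image
is defined pointwise, as \<open>f\<close> need not be injective.\<close>

lemma image_in_fatou:
  assumes U: "open U" "connected U" and f: "f holomorphic_on U" "\<not> f constant_on U"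
    and z: "z \<in> fatou f U"
  shows "f z \<in> fatou f U"
proof -
  obtain V where V: "open V" "z \<in> V" "V \<subseteq> iter_set f U" "normal_family V {f ^^ n |n. n \<ge> 1}"
    using z by (auto simp: fatou_def)
  obtain e where e: "e > 0" "cball z e \<subseteq> V" using V by (meson open_contains_cball)
  define V' where "V' = f ` ball z e"
  have VU: "V \<subseteq> U"
  proof
    fix x assume "x \<in> V"
    hence "\<forall>n. (f ^^ n) x \<in> U" using V(3) unfolding iter_set_iff[symmetric] by blast
    from spec[OF this, of 0] show "x \<in> U" by simp
  qed
  have bU: "ball z e \<subseteq> U" "cball z e \<subseteq> U" using e VU ball_subset_cball by blast+
  have oV: "open V'" unfolding V'_def by (rule open_mapping_thm[OF f(1) U _ bU(1) f(2)]) simp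
  have it: "V' \<subseteq> iter_set f U"
  proof
    fix w assume "w \<in> V'"
    then obtain y where y: "y \<in> ball z e" "w = f y" by (auto simp: V'_def)
    hence "y \<in> V" using e(2) ball_subset_cball[of z e] by blast
    hence "y \<in> iter_set f U" using V(3) by blast
    hence "(f ^^ Suc n) y \<in> U" for n unfolding iter_set_iff by blast
    thus "w \<in> iter_set f U" unfolding iter_set_iff y(2) by (simp add: funpow_swap1)
  qed
  have norm: "normal_family V' {f ^^ n |n. n \<ge> 1}"
    unfolding normal_family_def
  proof (intro allI impI)
    fix s :: "nat \<Rightarrow> complex \<Rightarrow> complex" assume s: "range s \<subseteq> {f ^^ n |n. n \<ge> 1}"
    have "range (\<lambda>n. s n \<circ> f) \<subseteq> {f ^^ n |n. n \<ge> 1}"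
    proof
      fix h assume "h \<in> range (\<lambda>n. s n \<circ> f)"
      then obtain n where n: "h = s n \<circ> f" by auto
      have "s n \<in> {f ^^ n |n. n \<ge> 1}" using s by auto
      then obtain m where "s n = f ^^ m" by auto
      hence "h = f ^^ Suc m" using n by (simp only: funpow_Suc_right)
      thus "h \<in> {f ^^ n |n. n \<ge> 1}" by (intro CollectI exI[of _ "Suc m"]) simp
    qed
    from V(4)[unfolded normal_family_def, THEN spec, THEN mp, OF this]
    obtain r g where rg: "strict_mono (r :: nat \<Rightarrow> nat)"
      "\<And>K. compact K \<Longrightarrow> K \<subseteq> V \<Longrightarrow> uniform_limit K (\<lambda>n z. to_sphere ((s (r n) \<circ> f) z)) g sequentially"
      by blast
    define G where "G w = lim (\<lambda>n. to_sphere (s (r n) w))" for w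
    have lim: "uniform_limit (cball z e) (\<lambda>n z. to_sphere ((s (r n) \<circ> f) z)) g sequentially"
      using rg(2) e by auto
    have G: "G (f y) = g y" if "y \<in> cball z e" for y
      using tendsto_uniform_limitI[OF lim that] by (simp add: G_def limI)
    show "\<exists>r g. strict_mono r \<and> (\<forall>K. compact K \<and> K \<subseteq> V' \<longrightarrow>
        uniform_limit K (\<lambda>n z. to_sphere (s (r n) z)) g sequentially)"
    proof (intro exI conjI allI impI)
      show "strict_mono r" by (rule rg)
      fix K assume K: "compact K \<and> K \<subseteq> V'"
      show "uniform_limit K (\<lambda>n z. to_sphere (s (r n) z)) G sequentially"
      proof (rule uniform_limitI)
        fix d :: real assume "d > 0"
        from uniform_limitD[OF lim this]
        show "\<forall>\<^sub>F n in sequentially. \<forall>w\<in>K. dist (to_sphere (s (r n) w)) (G w) < d"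
        proof eventually_elim
          case (elim n)
          show ?case
          proof
            fix w assume "w \<in> K"
            hence "w \<in> f ` ball z e" using K unfolding V'_def by blast
            then obtain y where y: "y \<in> cball z e" "w = f y" using ball_subset_cball by blast
            thus "dist (to_sphere (s (r n) w)) (G w) < d" using elim G[OF y(1)] by auto
          qed
        qed
      qed
    qed
  qed
  have "f z \<in> V'" using e by (auto simp: V'_def)
  thus ?thesis using oV it norm interior_maximal[OF it oV] unfolding fatou_def by auto
qed

lemma deriv_inverse_pair:
  assumes S: "open S" and \<phi>: "\<phi> holomorphic_on S" and \<psi>: "\<psi> holomorphic_on ball 0 1"
    and inv: "\<And>u. cmod u < 1 \<Longrightarrow> \<psi> u \<in> S \<and> \<phi> (\<psi> u) = u" and u: "cmod u < 1"
  shows "deriv \<phi> (\<psi> u) * deriv \<psi> u = 1"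
proof -
  have "(\<psi> has_field_derivative deriv \<psi> u) (at u)"
    using \<psi> u by (intro holomorphic_derivI[of \<psi> "ball 0 1"]) auto
  moreover have "(\<phi> has_field_derivative deriv \<phi> (\<psi> u)) (at (\<psi> u))"
    using \<phi> S inv[OF u] by (intro holomorphic_derivI[of \<phi> S]) auto
  ultimately have "((\<lambda>u. \<phi> (\<psi> u)) has_field_derivative deriv \<phi> (\<psi> u) * deriv \<psi> u) (at u)"
    by (intro DERIV_chain2)
  moreover have "eventually (\<lambda>x. \<phi> (\<psi> x) = x) (nhds u)"
    using eventually_nhds_in_open[of "ball 0 1" u] inv u by (auto elim!: eventually_mono)
  hence "deriv (\<lambda>x. \<phi> (\<psi> x)) u = deriv (\<lambda>x. x) u" by (intro deriv_cong_ev) auto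
  ultimately show ?thesis by (simp add: DERIV_imp_deriv)
qed

text \<open>Conjugated to the unit disk, \<open>f\<close> fixes the origin with a derivative of modulus 1, the equality case of
Schwarz's lemma.\<close>

lemma rotation_on_siegel_disk:
  assumes S: "open S" "0 \<in> S" and f: "f holomorphic_on S" "f ` S \<subseteq> S" "f 0 = 0" "cmod (deriv f 0) = 1"
    and \<phi>: "\<phi> holomorphic_on S" "\<phi> 0 = 0" "\<And>z. z \<in> S \<Longrightarrow> cmod (\<phi> z) < 1" "\<And>z. z \<in> S \<Longrightarrow> \<psi> (\<phi> z) = z"
    and \<psi>: "\<psi> holomorphic_on ball 0 1" "\<And>u. cmod u < 1 \<Longrightarrow> \<psi> u \<in> S \<and> \<phi> (\<psi> u) = u"
    and u: "cmod u < 1"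
  shows "f (\<psi> u) = \<psi> (deriv f 0 * u)"
proof -
  have \<psi>0: "\<psi> 0 = 0" using \<phi>(2,4) S by metis
  have \<psi>S: "\<psi> x \<in> S" if "x \<in> ball 0 1" for x using \<psi>(2) that by simp
  have fS: "f (\<psi> x) \<in> S" if "x \<in> ball 0 1" for x using \<psi>S[OF that] f(2) by blast
  define h where "h x = \<phi> (f (\<psi> x))" for x
  have 1: "(\<lambda>x. f (\<psi> x)) holomorphic_on ball 0 1"
    using holomorphic_on_compose_gen[OF \<psi>(1) f(1) image_subsetI[OF \<psi>S]] by (simp add: o_def)
  have h: "h holomorphic_on ball 0 1"
    using holomorphic_on_compose_gen[OF 1 \<phi>(1) image_subsetI[OF fS]] by (simp add: o_def h_def[abs_def])
  have h0: "h 0 = 0" by (simp add: h_def \<psi>0 f \<phi>)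
  have d\<psi>: "(\<psi> has_field_derivative deriv \<psi> 0) (at 0)"
    using \<psi>(1) by (intro holomorphic_derivI[of \<psi> "ball 0 1"]) auto
  have d\<phi>: "(\<phi> has_field_derivative deriv \<phi> 0) (at 0)"
    using \<phi>(1) S by (intro holomorphic_derivI[of \<phi> S])
  have df: "(f has_field_derivative deriv f 0) (at 0)"
    using f(1) S by (intro holomorphic_derivI[of f S])
  have one: "deriv \<phi> 0 * deriv \<psi> 0 = 1"
    using deriv_inverse_pair[OF S(1) \<phi>(1) \<psi>(1) \<psi>(2), of 0] \<psi>0 by simp
  have "((\<lambda>x. f (\<psi> x)) has_field_derivative deriv f 0 * deriv \<psi> 0) (at 0)"
    by (rule DERIV_chain2[OF _ d\<psi>]) (simp add: \<psi>0 df)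
  hence "((\<lambda>x. \<phi> (f (\<psi> x))) has_field_derivative deriv \<phi> 0 * (deriv f 0 * deriv \<psi> 0)) (at 0)"
    by (rule DERIV_chain2[rotated]) (simp add: \<psi>0 d\<phi> f)
  hence "(h has_field_derivative (deriv \<phi> 0 * deriv \<psi> 0) * deriv f 0) (at 0)"
    unfolding h_def by (simp add: mult_ac)
  hence dh: "(h has_field_derivative deriv f 0) (at 0)" using one by simp
  hence dh': "deriv h 0 = deriv f 0" by (rule DERIV_imp_deriv)
  have h1: "cmod (h x) < 1" if "cmod x < 1" for x using \<phi>(3)[OF fS] that by (simp add: h_def)
  have "cmod (deriv h 0) = 1" using f(4) dh' by simp
  then obtain a where a: "\<And>x. cmod x < 1 \<Longrightarrow> h x = a * x" "cmod a = 1"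
    using Schwarz_Lemma(3)[OF h h0 h1] by blast
  have "((\<lambda>x. a * x) has_field_derivative a) (at 0)" by (auto intro!: derivative_eq_intros)
  moreover have "eventually (\<lambda>x. h x = a * x) (nhds 0)"
    using eventually_nhds_in_open[of "ball 0 1" 0] a(1) by (auto elim!: eventually_mono)
  hence "deriv h 0 = deriv (\<lambda>x. a * x) 0" by (intro deriv_cong_ev) auto
  ultimately have "a = deriv f 0" using dh' by (simp add: DERIV_imp_deriv)
  hence "\<phi> (f (\<psi> u)) = deriv f 0 * u" using a(1)[OF u] by (simp add: h_def)
  thus ?thesis using \<phi>(4)[OF fS[of u]] u by simp
qed

text \<open>The closure of \<open>S\<close> in the sphere is \<open>S\<close> together with its boundary; it misses the point at infinity and
is pulled back by stereographic projection \<open>\<sigma>\<close>.\<close>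

lemma frontier_in_image_imp_compact_superset:
  assumes "S \<subseteq> U" "riemann_sphere frontier_of (to_sphere ` S) \<subseteq> to_sphere ` U"
  obtains K where "compact K" "S \<subseteq> K" "K \<subseteq> U"
proof -
  define X where "X = to_sphere ` S"
  define \<sigma> where "\<sigma> p = (1 / (1 - snd p)) *\<^sub>R fst p" for p :: "complex \<times> real"
  have pos: "1 + (cmod z)\<^sup>2 > 0" for z using zero_le_power2[of "cmod z"] by linarith
  have snd1: "1 - snd (to_sphere z) = 2 / (1 + (cmod z)\<^sup>2)" for z
    using pos[of z] by (simp add: to_sphere_def field_simps)
  have \<sigma>: "\<sigma> (to_sphere z) = z" for z
  proof -
    have "\<sigma> (to_sphere z) = (1 / (2 / (1 + (cmod z)\<^sup>2)) * (2 / (1 + (cmod z)\<^sup>2))) *\<^sub>R z"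
      unfolding \<sigma>_def snd1 by (simp only: to_sphere_def fst_conv scaleR_scaleR)
    moreover have "1 / (2 / a) * (2 / a) = 1" if "a > 0" for a :: real using that by simp
    ultimately show ?thesis using pos[of z] by (simp only: scaleR_one)
  qed
  have sph: "to_sphere z \<in> sphere 0 1" for z
  proof -
    have "(norm (to_sphere z))\<^sup>2 = (2 / (1 + (cmod z)\<^sup>2) * cmod z)\<^sup>2 + (((cmod z)\<^sup>2 - 1) / (1 + (cmod z)\<^sup>2))\<^sup>2"
      using pos[of z] by (simp add: to_sphere_def norm_Pair power_mult_distrib power_divide)
    also have "\<dots> = 1" using pos[of z] by (simp add: power_divide power_mult_distrib field_simps)
      (simp add: power2_eq_square algebra_simps)
    finally show ?thesis by (simp add: power2_eq_1_iff) (metis norm_ge_zero le_minus_one_simps(3) order_trans)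
  qed
  have cl: "closure X \<subseteq> to_sphere ` U"
  proof -
    have "X \<subseteq> sphere 0 1" using sph by (auto simp: X_def)
    hence cs: "closure X \<subseteq> sphere 0 1" by (rule closure_minimal) simp
    have "riemann_sphere closure_of X = closure X"
      using \<open>X \<subseteq> sphere 0 1\<close> cs unfolding riemann_sphere_def
      by (simp add: closure_of_subtopology Int_absorb1 Int_absorb2)
    moreover have "riemann_sphere closure_of X - riemann_sphere interior_of X \<subseteq> to_sphere ` U"
      using assms(2) by (simp add: frontier_of_def X_def)
    moreover have "riemann_sphere interior_of X \<subseteq> to_sphere ` U"
      using interior_of_subset[of riemann_sphere X] assms(1) by (auto simp: X_def)
    ultimately show ?thesis by blast
  qed
  have bX: "bounded X" by (rule bounded_subset[OF bounded_sphere[of 0 1]]) (use sph in \<open>auto simp: X_def\<close>)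
  have comp: "compact (\<sigma> ` closure X)"
  proof (rule compact_continuous_image)
    have "1 - snd p \<noteq> 0" if "p \<in> closure X" for p
    proof -
      obtain z where "p = to_sphere z" using cl \<open>p \<in> closure X\<close> by blast
      thus ?thesis using snd1[of z] pos[of z] by simp
    qed
    thus "continuous_on (closure X) \<sigma>" unfolding \<sigma>_def by (intro continuous_intros) auto
    show "compact (closure X)" using bX by (simp add: compact_closure)
  qed
  show thesis
  proof (rule that[OF comp])
    have "z \<in> \<sigma> ` closure X" if "z \<in> S" for z
    proof -
      have "to_sphere z \<in> closure X" using that closure_subset[of X] by (auto simp: X_def)
      thus ?thesis using \<sigma>[of z] by (metis image_eqI)
    qed
    thus "S \<subseteq> \<sigma> ` closure X" by blast
    show "\<sigma> ` closure X \<subseteq> U" using cl \<sigma> by fastforce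
  qed
qed

section \<open>Analytic families and Stolz angles\<close>

lemma analytic_family_partials:
  assumes "analytic_family f W U" "l \<in> W" "z \<in> U"
  shows "f l field_differentiable (at z)" "(\<lambda>l. f l z) field_differentiable (at l)"
    "isCont (\<lambda>(l, z). f l z) (l, z)"
proof -
  obtain a b where ab: "((\<lambda>(l, z). f l z) has_derivative (\<lambda>(h, k). a * h + b * k)) (at (l, z))"
    using assms unfolding analytic_family_def by blast
  have "((\<lambda>z. (l, z)) has_derivative (\<lambda>k. (0, k))) (at z)"
    by (auto intro!: derivative_eq_intros)
  from has_derivative_compose[OF this ab] have "(f l has_derivative (\<lambda>k. b * k)) (at z)" by simp
  thus "f l field_differentiable (at z)"
    unfolding field_differentiable_def has_field_derivative_def by blast
  have "((\<lambda>l. (l, z)) has_derivative (\<lambda>h. (h, 0))) (at l)"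
    by (auto intro!: derivative_eq_intros)
  from has_derivative_compose[OF this ab] have "((\<lambda>l. f l z) has_derivative (\<lambda>h. a * h)) (at l)" by simp
  thus "(\<lambda>l. f l z) field_differentiable (at l)"
    unfolding field_differentiable_def has_field_derivative_def by blast
  show "isCont (\<lambda>(l, z). f l z) (l, z)" using has_derivative_continuous[OF ab] .
qed

text \<open>The family is bounded on a compact neighbourhood of \<open>{l0} \<times> K\<close>, and Cauchy's estimate in the
parameter bounds the derivative with respect to \<open>l\<close>.\<close>

lemma analytic_family_lipschitz:
  assumes fam: "analytic_family f W U" and W: "open W" "l0 \<in> W" and K: "compact K" "K \<subseteq> U"
  obtains M \<rho> where "M > 0" "\<rho> > 0" 
    "\<And>l z. cmod (l - l0) < \<rho> \<Longrightarrow> z \<in> K \<Longrightarrow> cmod (f l z - f l0 z) \<le> M * cmod (l - l0)"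
proof -
  obtain \<rho> where \<rho>: "\<rho> > 0" "cball l0 \<rho> \<subseteq> W" using W by (meson open_contains_cball)
  have "continuous_on (cball l0 \<rho> \<times> K) (\<lambda>(l, z). f l z)"
    using analytic_family_partials(3)[OF fam] \<rho>(2) K(2)
    by (intro continuous_at_imp_continuous_on) auto
  hence "compact ((\<lambda>(l, z). f l z) ` (cball l0 \<rho> \<times> K))"
    using K(1) by (intro compact_continuous_image compact_Times) auto
  then obtain B0 where "\<And>w. w \<in> (\<lambda>(l, z). f l z) ` (cball l0 \<rho> \<times> K) \<Longrightarrow> cmod w \<le> B0"
    using compact_imp_bounded bounded_iff by metis
  hence B0: "cmod (f l z) \<le> B0" if "l \<in> cball l0 \<rho>" "z \<in> K" for l z
    using that by force
  define B where "B = max B0 1"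
  have B: "B > 0" "\<And>l z. l \<in> cball l0 \<rho> \<Longrightarrow> z \<in> K \<Longrightarrow> cmod (f l z) \<le> B"
    using B0 by (auto simp: B_def le_max_iff_disj)
  define M where "M = B / (\<rho> / 2)"
  show thesis
  proof (rule that[of M "\<rho> / 2"])
    show "M > 0" "\<rho> / 2 > 0" using B \<rho> by (auto simp: M_def)
    fix l z assume l: "cmod (l - l0) < \<rho> / 2" and z: "z \<in> K"
    have hol: "(\<lambda>l. f l z) holomorphic_on W"
      using analytic_family_partials(2)[OF fam] z K(2)
      by (auto simp: holomorphic_on_def field_differentiable_at_within)
    have "cmod (deriv (\<lambda>l. f l z) x) \<le> M" if x: "x \<in> ball l0 (\<rho> / 2)" for x
    proof -
      have c: "cball x (\<rho> / 2) \<subseteq> cball l0 \<rho>"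
      proof
        fix y assume "y \<in> cball x (\<rho> / 2)"
        thus "y \<in> cball l0 \<rho>" using x dist_triangle[of l0 y x] by simp
      qed
      have "cmod ((deriv ^^ 1) (\<lambda>l. f l z) x) \<le> fact 1 * B / (\<rho> / 2) ^ 1"
      proof (rule Cauchy_inequality)
        show "(\<lambda>l. f l z) holomorphic_on ball x (\<rho> / 2)"
          using c \<rho>(2) ball_subset_cball by (intro holomorphic_on_subset[OF hol]) blast
        show "continuous_on (cball x (\<rho> / 2)) (\<lambda>l. f l z)"
          using c \<rho>(2) by (intro holomorphic_on_imp_continuous_on holomorphic_on_subset[OF hol]) blast
        fix y assume "cmod (x - y) = \<rho> / 2"
        hence "y \<in> cball l0 \<rho>" using c by (auto simp: dist_norm)
        thus "cmod (f y z) \<le> B" using B(2) z by blast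
      qed (use \<rho> in auto)
      thus ?thesis by (simp add: M_def)
    qed
    note bound = this
    have der: "((\<lambda>l. f l z) has_field_derivative deriv (\<lambda>l. f l z) x) (at x within ball l0 (\<rho> / 2))"
      if x: "x \<in> ball l0 (\<rho> / 2)" for x
    proof -
      have "x \<in> cball l0 \<rho>" using x \<rho>(1) by simp
      hence "x \<in> W" using \<rho>(2) by blast
      from holomorphic_derivI[OF hol W(1) this] show ?thesis .
    qed
    have "l \<in> ball l0 (\<rho> / 2)" "l0 \<in> ball l0 (\<rho> / 2)"
      using l \<rho>(1) by (simp_all add: dist_norm norm_minus_commute)
    from field_differentiable_bound[OF convex_ball der bound this]
    show "cmod (f l z - f l0 z) \<le> M * cmod (l - l0)" .
  qed
qed

text \<open>In the Stolz angle of opening \<open>\<Theta>\<close> one can take \<open>\<kappa> = cos \<Theta>\<close>.\<close>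

lemma stolz_angle_Re_bound:
  assumes "stolz_angle l0 D" "l0 \<noteq> 0"
  obtains \<kappa> where "\<kappa> > 0" "\<And>l. cmod l0 = 1 \<Longrightarrow> l \<in> D \<Longrightarrow> l \<noteq> l0 \<and> Re ((l - l0) / l0) \<le> - \<kappa> * cmod (l - l0)"
proof -
  obtain \<Theta> \<rho> where \<Theta>: "0 < \<Theta>" "\<Theta> < pi / 2"
    and D: "D = {l. \<bar>Arg (1 - l / l0)\<bar> < \<Theta> \<and> 0 < cmod (l - l0) \<and> cmod (l - l0) < \<rho>}"
    using assms(1) unfolding stolz_angle_def by blast
  show thesis
  proof (rule that[of "cos \<Theta>"])
    show "cos \<Theta> > 0" using \<Theta> by (intro cos_gt_zero) auto
    fix l assume n: "cmod l0 = 1" and l: "l \<in> D"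
    define w where "w = 1 - l / l0"
    have w: "w = - ((l - l0) / l0)" using assms(2) by (simp add: w_def field_simps)
    have nw: "cmod w = cmod (l - l0)" unfolding w by (simp add: norm_divide n)
    have "Re w = cmod w * cos (Arg w)" by (metis rcis_cmod_Arg Re_rcis)
    also have "cos (Arg w) = cos \<bar>Arg w\<bar>" by simp
    finally have "Re w = cmod w * cos \<bar>Arg w\<bar>" .
    moreover have "cos \<Theta> \<le> cos \<bar>Arg w\<bar>"
      using l \<Theta> by (intro cos_monotone_0_pi_le) (auto simp: D w_def)
    ultimately have "cmod w * cos \<Theta> \<le> Re w" by (simp add: mult_left_mono)
    thus "l \<noteq> l0 \<and> Re ((l - l0) / l0) \<le> - cos \<Theta> * cmod (l - l0)"
      using l unfolding nw by (auto simp: D w mult.commute)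
  qed
qed

section \<open>Perturbed rotations\<close>

lemma cis_diff_le: "cmod (cis a - cis b) \<le> \<bar>a - b\<bar>"
proof -
  have "cis a - cis b = cis b * (exp (\<i> * of_real (a - b)) - 1)"
    by (simp add: cis_conv_exp algebra_simps flip: exp_add)
  hence "cmod (cis a - cis b) = 2 * \<bar>sin ((a - b) / 2)\<bar>"
    by (simp only: norm_mult norm_cis dist_exp_i_1 mult_1_left)
  also have "\<dots> \<le> 2 * \<bar>(a - b) / 2\<bar>" by (intro mult_left_mono abs_sin_x_le_abs_x) auto
  finally show ?thesis by simp
qed

lemma norm_one_plus_le_exp: "cmod (1 + y) \<le> exp (Re y + (cmod y)\<^sup>2 / 2)"
proof -
  have "(cmod (1 + y))\<^sup>2 = 1 + (2 * Re y + (cmod y)\<^sup>2)"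
    unfolding cmod_power2 by (simp add: power2_eq_square algebra_simps)
  also have "\<dots> \<le> exp (2 * Re y + (cmod y)\<^sup>2)" by (rule exp_ge_add_one_self)
  also have "\<dots> = exp (2 * (Re y + (cmod y)\<^sup>2 / 2))" by (simp add: field_simps)
  also have "\<dots> = (exp (Re y + (cmod y)\<^sup>2 / 2))\<^sup>2" by (rule exp_double)
  finally show ?thesis by (rule power2_le_imp_le) simp
qed

text \<open>The orbit satisfies \<open>(g ^^ q) \<zeta> = l0 ^ q * \<zeta> * (\<Prod>k<q. 1 + y k)\<close> with \<open>y k = (l - l0) * H (u k)\<close>, and
\<open>\<bar>1 + y\<bar> \<le> exp (Re y + \<bar>y\<bar>\<^sup>2 / 2)\<close> reduces the modulus of the product to sums. The main term
\<open>q * Re ((l - l0) / l0)\<close> is at most \<open>- q * \<kappa> * \<tau>\<close>; the averaging error and the squares each use up a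
quarter of it.\<close>

lemma perturbed_rotation_first_return:
  fixes g H :: "complex \<Rightarrow> complex" and l l0 :: complex
  assumes l0: "l0 = cis (2 * pi * \<alpha>)"
    and H: "H holomorphic_on ball 0 R" "H 0 = 1 / l0" and r: "0 \<le> r" "r < \<rho>" "\<rho> < R" "\<rho> \<le> 1"
    and g: "\<And>w. cmod w < R \<Longrightarrow> g w = l0 * w * (1 + (l - l0) * H (l0 * w))"
    and B: "\<And>u. cmod u \<le> \<rho> \<Longrightarrow> cmod (H u) \<le> B"
    and \<tau>: "\<tau> = cmod (l - l0)" and \<kappa>: "Re ((l - l0) / l0) \<le> - \<kappa> * \<tau>" "0 < \<kappa>"
    and pq: "coprime p (int q)" "q > 0" "\<bar>\<alpha> - p / q\<bar> \<le> 1 / (real q)\<^sup>2"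
    and \<eta>: "\<eta> = q * \<tau> * B + 2 * pi / q" "2 * \<eta> \<le> \<rho> - r"
    and s: "(r / \<rho>) ^ q \<le> 1 / 2"
    and mean: "integral {0..2 * pi} (\<lambda>t. cmod (H (\<rho> * cis t))) / (2 * pi)
        * (2 * (r / \<rho>) ^ q + 6 * \<eta> / (\<rho> - r)) \<le> \<kappa> / 4"
    and \<tau>B: "\<tau> * B\<^sup>2 \<le> \<kappa> / 2"
    and \<zeta>: "cmod \<zeta> \<le> r"
  shows "k \<le> q \<Longrightarrow> cmod ((g ^^ k) \<zeta>) < \<rho>" and "cmod ((g ^^ q) \<zeta>) \<le> cmod \<zeta>"
proof -
  define w where "w k = (g ^^ k) \<zeta>" for k
  define \<omega> where "\<omega> = cis (2 * pi * p / q)"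
  have n0: "cmod l0 = 1" "l0 \<noteq> 0" by (auto simp: l0)
  have \<tau>0: "\<tau> \<ge> 0" by (simp add: \<tau>)
  have B0: "B \<ge> 0" using order_trans[OF norm_ge_zero B[of 0]] r by simp
  have q0: "real q > 0" using pq(2) by simp
  have qTB: "q * \<tau> * B \<le> \<eta>" unfolding \<eta>(1) using q0 by simp
  have \<eta>0: "\<eta> > 0" unfolding \<eta>(1) using q0 \<tau>0 B0 by (intro add_nonneg_pos) auto
  have step: "w (Suc k) = l0 * w k * (1 + (l - l0) * H (l0 * w k))" if "cmod (w k) < \<rho>" for k
    using g[of "w k"] that r by (simp add: w_def)
  have kle: "k * \<tau> * B \<le> \<eta>" if "k \<le> q" for k
  proof -
    have "k * \<tau> * B \<le> q * \<tau> * B" using that \<tau>0 B0 by (intro mult_right_mono) auto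
    thus ?thesis using qTB by linarith
  qed
  have inside: "cmod (w k) < \<rho>" if "k \<le> q" "cmod (w k - l0 ^ k * \<zeta>) \<le> k * \<tau> * B" for k
  proof -
    have "cmod (w k) \<le> cmod (w k - l0 ^ k * \<zeta>) + cmod (l0 ^ k * \<zeta>)"
      by (metis diff_add_cancel norm_triangle_ineq)
    also have "\<dots> \<le> \<eta> + r" using that kle[of k] \<zeta> n0 by (simp add: norm_mult norm_power)
    finally show ?thesis using \<eta>(2) \<eta>0 by linarith
  qed
  \<comment> \<open>each step adds at most \<open>\<tau> * B\<close> to the distance from the orbit of the rigid rotation\<close>
  have dev: "k \<le> q \<Longrightarrow> cmod (w k - l0 ^ k * \<zeta>) \<le> k * \<tau> * B" for k
  proof (induction k)
    case 0
    then show ?case by (simp add: w_def)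
  next
    case (Suc k)
    hence IH: "cmod (w k - l0 ^ k * \<zeta>) \<le> k * \<tau> * B" by simp
    have i: "cmod (w k) < \<rho>" using inside[of k] IH Suc by simp
    have "w (Suc k) - l0 ^ Suc k * \<zeta> = l0 * (w k - l0 ^ k * \<zeta>) + l0 * w k * ((l - l0) * H (l0 * w k))"
      unfolding step[OF i] by (simp add: algebra_simps)
    hence "cmod (w (Suc k) - l0 ^ Suc k * \<zeta>)
        \<le> cmod (w k - l0 ^ k * \<zeta>) + cmod (w k) * (\<tau> * cmod (H (l0 * w k)))"
      using norm_triangle_ineq[of "l0 * (w k - l0 ^ k * \<zeta>)" "l0 * w k * ((l - l0) * H (l0 * w k))"]
      by (simp add: norm_mult n0 \<tau>)
    also have "cmod (w k) * (\<tau> * cmod (H (l0 * w k))) \<le> 1 * (\<tau> * B)"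
      using i r(4) \<tau>0 B0 B[of "l0 * w k"] n0 by (intro mult_mono) (auto simp: norm_mult)
    finally show ?case using IH by (simp add: algebra_simps)
  qed
  have ins: "cmod (w k) < \<rho>" if "k \<le> q" for k using inside[OF that dev[OF that]] .
  thus "k \<le> q \<Longrightarrow> cmod ((g ^^ k) \<zeta>) < \<rho>" by (simp add: w_def)
  define u where "u k = l0 * w k" for k
  define y where "y k = (l - l0) * H (u k)" for k
  have rot: "cmod (u k - \<omega> ^ k * (l0 * \<zeta>)) \<le> \<eta>" if k: "k < q" for k
  proof -
    have "cmod (l0 ^ k - \<omega> ^ k) \<le> \<bar>real k * (2 * pi * \<alpha>) - real k * (2 * pi * p / q)\<bar>"
      unfolding l0 \<omega>_def Complex.DeMoivre by (rule cis_diff_le)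
    also have "real k * (2 * pi * \<alpha>) - real k * (2 * pi * p / q) = (2 * pi * k) * (\<alpha> - p / q)"
      by (simp add: algebra_simps)
    also have "\<bar>(2 * pi * k) * (\<alpha> - p / q)\<bar> \<le> (2 * pi * q) * (1 / (real q)\<^sup>2)"
      unfolding abs_mult using pq(3) k by (intro mult_mono) auto
    also have "\<dots> = 2 * pi / q" using q0 by (simp add: power2_eq_square)
    finally have a: "cmod (l0 ^ k - \<omega> ^ k) \<le> 2 * pi / q" .
    have "u k - \<omega> ^ k * (l0 * \<zeta>) = l0 * ((w k - l0 ^ k * \<zeta>) + (l0 ^ k - \<omega> ^ k) * \<zeta>)"
      by (simp add: u_def algebra_simps)
    hence "cmod (u k - \<omega> ^ k * (l0 * \<zeta>)) \<le> cmod (w k - l0 ^ k * \<zeta>) + cmod (l0 ^ k - \<omega> ^ k) * cmod \<zeta>"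
      by (metis n0(1) mult_1 norm_mult norm_triangle_ineq)
    also have "\<dots> \<le> q * \<tau> * B + 2 * pi / q * 1"
    proof (intro add_mono mult_mono a)
      have "k * \<tau> * B \<le> q * \<tau> * B" using k \<tau>0 B0 by (intro mult_right_mono) auto
      thus "cmod (w k - l0 ^ k * \<zeta>) \<le> q * \<tau> * B" using dev[of k] k by linarith
    qed (use \<zeta> r in auto)
    finally show ?thesis by (simp add: \<eta>(1))
  qed
  have avg: "cmod ((\<Sum>k<q. H (u k)) - q * H 0)
      \<le> q * (2 * (r / \<rho>) ^ q + 6 * \<eta> / (\<rho> - r))
          * (integral {0..2 * pi} (\<lambda>t. cmod (H (\<rho> * cis t))) / (2 * pi))"
    by (rule sum_along_perturbed_rotation[OF H(1) r(3) r(1,2) pq(1,2) s _ \<eta>(2) rot[unfolded \<omega>_def]])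
      (use \<zeta> n0 in \<open>auto simp: norm_mult\<close>)
  also have "\<dots> \<le> q * (\<kappa> / 4)"
    using mean mult_left_mono[OF mean, of "real q"] by (simp add: mult_ac)
  finally have avg': "cmod ((\<Sum>k<q. H (u k)) - q * H 0) \<le> q * (\<kappa> / 4)" .
  have wprod: "k \<le> q \<Longrightarrow> w k = l0 ^ k * \<zeta> * (\<Prod>i<k. 1 + y i)" for k
  proof (induction k)
    case 0
    then show ?case by (simp add: w_def)
  next
    case (Suc k)
    hence "w k = l0 ^ k * \<zeta> * (\<Prod>i<k. 1 + y i)" by simp
    moreover have "w (Suc k) = l0 * w k * (1 + y k)"
      using step[of k] ins[of k] Suc by (simp add: y_def u_def)
    ultimately show ?case by simp
  qed
  have "(\<Sum>k<q. Re (y k)) = Re ((l - l0) * (\<Sum>k<q. H (u k)))"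
    by (simp add: y_def sum_distrib_left Re_sum)
  also have "(l - l0) * (\<Sum>k<q. H (u k)) = q * ((l - l0) / l0) + (l - l0) * ((\<Sum>k<q. H (u k)) - q * H 0)"
    by (simp add: H(2) algebra_simps)
  also have "Re \<dots> = q * Re ((l - l0) / l0) + Re ((l - l0) * ((\<Sum>k<q. H (u k)) - q * H 0))"
    by (simp only: plus_complex.sel Re_of_nat_mult)
  also have "Re ((l - l0) * ((\<Sum>k<q. H (u k)) - q * H 0)) \<le> \<tau> * (q * (\<kappa> / 4))"
  proof -
    have "cmod ((l - l0) * ((\<Sum>k<q. H (u k)) - q * H 0)) \<le> \<tau> * (q * (\<kappa> / 4))"
      unfolding norm_mult \<tau>[symmetric] using avg' \<tau>0 by (intro mult_left_mono) auto
    thus ?thesis using complex_Re_le_cmod order_trans by blast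
  qed
  also have "q * Re ((l - l0) / l0) \<le> q * (- \<kappa> * \<tau>)" using \<kappa>(1) by (intro mult_left_mono) auto
  finally have re: "(\<Sum>k<q. Re (y k)) \<le> - 3 / 4 * (q * \<kappa> * \<tau>)" by (simp add: algebra_simps)
  have sq: "(\<Sum>k<q. (cmod (y k))\<^sup>2 / 2) \<le> q * \<kappa> * \<tau> / 4"
  proof -
    have "(cmod (y k))\<^sup>2 / 2 \<le> \<kappa> * \<tau> / 4" if "k < q" for k
    proof -
      have "cmod (H (u k)) \<le> B" using B[of "u k"] ins[of k] that by (simp add: u_def norm_mult n0)
      hence "(cmod (y k))\<^sup>2 \<le> (\<tau> * B)\<^sup>2"
        unfolding y_def norm_mult \<tau>[symmetric] using \<tau>0 B0 by (intro power_mono mult_left_mono) auto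
      also have "\<dots> = \<tau> * (\<tau> * B\<^sup>2)" by (simp add: power2_eq_square)
      also have "\<dots> \<le> \<tau> * (\<kappa> / 2)" using \<tau>B \<tau>0 by (rule mult_left_mono)
      finally show ?thesis by (simp add: mult.commute)
    qed
    hence "(\<Sum>k<q. (cmod (y k))\<^sup>2 / 2) \<le> (\<Sum>k<q. \<kappa> * \<tau> / 4)" by (intro sum_mono) auto
    thus ?thesis by (simp add: mult.assoc)
  qed
  have "cmod (w q) = cmod \<zeta> * (\<Prod>i<q. cmod (1 + y i))"
    using wprod[of q] by (simp add: norm_mult norm_power n0 prod_norm)
  also have "(\<Prod>i<q. cmod (1 + y i)) \<le> (\<Prod>i<q. exp (Re (y i) + (cmod (y i))\<^sup>2 / 2))"
    by (intro prod_mono) (auto simp: norm_one_plus_le_exp)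
  also have "\<dots> = exp ((\<Sum>i<q. Re (y i)) + (\<Sum>i<q. (cmod (y i))\<^sup>2 / 2))"
    by (simp add: exp_sum flip: sum.distrib)
  also have "\<dots> \<le> 1"
  proof -
    have "q * \<kappa> * \<tau> \<ge> 0" using \<kappa> \<tau>0 by simp
    thus ?thesis using re sq by simp
  qed
  finally have "cmod (w q) \<le> cmod \<zeta>" by (simp add: mult_left_le mult_left_mono)
  thus "cmod ((g ^^ q) \<zeta>) \<le> cmod \<zeta>" by (simp add: w_def)
qed

lemma funpow_bounded_by_first_return:
  fixes g :: "complex \<Rightarrow> complex"
  assumes "q > 0"
    and "\<And>\<zeta> k. cmod \<zeta> \<le> r \<Longrightarrow> k \<le> q \<Longrightarrow> cmod ((g ^^ k) \<zeta>) < \<rho>"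
    and "\<And>\<zeta>. cmod \<zeta> \<le> r \<Longrightarrow> cmod ((g ^^ q) \<zeta>) \<le> r"
    and "cmod \<zeta> \<le> r"
  shows "cmod ((g ^^ n) \<zeta>) < \<rho>"
proof -
  have "cmod ((g ^^ (q * m)) \<zeta>) \<le> r" for m
  proof (induction m)
    case (Suc m)
    have "(g ^^ (q * Suc m)) \<zeta> = (g ^^ q) ((g ^^ (q * m)) \<zeta>)" by (simp add: funpow_add)
    then show ?case using assms(3)[OF Suc] by simp
  qed (use assms(4) in simp)
  moreover have "(g ^^ n) \<zeta> = (g ^^ (n mod q)) ((g ^^ (q * (n div q))) \<zeta>)"
    by (metis comp_apply funpow_add mod_mult_div_eq)
  moreover have "n mod q \<le> q" using assms(1) by (simp add: less_imp_le)
  ultimately show ?thesis using assms(2) by metis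
qed

text \<open>Within \<open>d / 2\<close> of \<open>z\<close> there is room for circles of radius \<open>d / 3\<close>, so Cauchy's estimate bounds the
second derivative by \<open>2 / (d / 3)\<^sup>2 = 18 / d\<^sup>2\<close>.\<close>

lemma taylor_remainder_bounded:
  assumes \<phi>: "\<phi> holomorphic_on ball z d" and d: "d > 0"
    and bd: "\<And>w. w \<in> ball z d \<Longrightarrow> cmod (\<phi> w) \<le> 1" and v: "cmod v \<le> d / 2"
  shows "cmod (\<phi> (z + v) - \<phi> z) \<le> cmod (deriv \<phi> z) * cmod v + 18 * (cmod v)\<^sup>2 / d\<^sup>2"
proof -
  define D where "D = cball z (d / 2)"
  have Db: "D \<subseteq> ball z d" using d by (auto simp: D_def)
  have h1: "deriv \<phi> holomorphic_on ball z d" using \<phi> by (intro holomorphic_deriv) auto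
  have "cmod ((deriv ^^ 0) \<phi> (z + v) - (\<Sum>i\<le>1. (deriv ^^ i) \<phi> z * (z + v - z) ^ i / fact i))
      \<le> 18 / d\<^sup>2 * cmod (z + v - z) ^ Suc 1 / fact 1"
  proof (rule complex_Taylor[of D 1 "\<lambda>i. (deriv ^^ i) \<phi>"])
    show "convex D" by (simp add: D_def)
    fix i x assume x: "x \<in> D" "i \<le> (1::nat)"
    have "((deriv ^^ i) \<phi> has_field_derivative deriv ((deriv ^^ i) \<phi>) x) (at x)"
      by (rule holomorphic_derivI[of _ "ball z d"]) (use x Db \<phi> in \<open>auto intro!: holomorphic_higher_deriv\<close>)
    thus "((deriv ^^ i) \<phi> has_field_derivative (deriv ^^ Suc i) \<phi> x) (at x within D)"
      by (simp add: has_field_derivative_at_within)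
  next
    fix x assume x: "x \<in> D"
    have c: "cball x (d / 3) \<subseteq> ball z d"
    proof
      fix y assume "y \<in> cball x (d / 3)"
      thus "y \<in> ball z d" using x d dist_triangle[of z y x] by (simp add: D_def)
    qed
    have "cmod ((deriv ^^ 2) \<phi> x) \<le> fact 2 * 1 / (d / 3) ^ 2"
    proof (rule Cauchy_inequality)
      show "\<phi> holomorphic_on ball x (d / 3)"
        using holomorphic_on_subset[OF \<phi> c] ball_subset_cball holomorphic_on_subset by blast
      show "continuous_on (cball x (d / 3)) \<phi>"
        using holomorphic_on_imp_continuous_on[OF holomorphic_on_subset[OF \<phi> c]] .
      show "0 < d / 3" using d by simp
      fix y assume "cmod (x - y) = d / 3"
      hence "y \<in> cball x (d / 3)" by (simp add: dist_norm)
      thus "cmod (\<phi> y) \<le> 1" using c bd by blast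
    qed
    thus "cmod ((deriv ^^ Suc 1) \<phi> x) \<le> 18 / d\<^sup>2"
      by (simp add: numeral_2_eq_2 power2_eq_square divide_simps)
  qed (use v d in \<open>auto simp: D_def dist_norm\<close>)
  hence "cmod (\<phi> (z + v) - \<phi> z - deriv \<phi> z * v) \<le> 18 * (cmod v)\<^sup>2 / d\<^sup>2"
    by (simp add: power2_eq_square algebra_simps)
  moreover have "cmod (\<phi> (z + v) - \<phi> z) \<le> cmod (deriv \<phi> z * v) + cmod (\<phi> (z + v) - \<phi> z - deriv \<phi> z * v)"
    by (metis add.commute norm_triangle_sub)
  ultimately show ?thesis by (simp add: norm_mult)
qed

text \<open>In the coordinate of the disk, \<open>f\<close> differs from the rotation by \<open>h (l0 * w)\<close> where \<open>h 0 = 0\<close> and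
\<open>deriv h 0 = l / l0 - 1\<close>; dividing \<open>h u\<close> by \<open>u * (l - l0)\<close> gives \<open>H\<close>. The bound on \<open>H\<close> is Taylor's formula
for \<open>\<phi>\<close> at \<open>\<psi> u\<close>, whose linear term carries the derivative of \<open>\<phi>\<close> at this very point. It is this form
that allows integration over a circle later on.\<close>

lemma conjugated_perturbation:
  fixes \<phi> \<psi> f f0 :: "complex \<Rightarrow> complex" and l l0 :: complex
  assumes S: "open S" "0 \<in> S"
    and \<phi>: "\<phi> holomorphic_on S" "\<phi> 0 = 0" "\<And>z. z \<in> S \<Longrightarrow> cmod (\<phi> z) < 1" "\<And>z. z \<in> S \<Longrightarrow> \<psi> (\<phi> z) = z"
    and \<psi>: "\<psi> holomorphic_on ball 0 1" "\<And>u. cmod u < 1 \<Longrightarrow> \<psi> u \<in> S \<and> \<phi> (\<psi> u) = u"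
    and l0: "cmod l0 = 1" "l \<noteq> l0" and \<tau>: "\<tau> = cmod (l - l0)"
    and f0: "\<And>u. cmod u < 1 \<Longrightarrow> f0 (\<psi> u) = \<psi> (l0 * u)"
    and f: "f holomorphic_on S" "f 0 = 0" "deriv f 0 = l" "\<And>z. z \<in> S \<Longrightarrow> cmod (f z - f0 z) \<le> M * \<tau>"
    and R: "0 < R" "R < 1"
    and d: "d > 0" "\<And>u. cmod u < R \<Longrightarrow> ball (\<psi> u) d \<subseteq> S" and M: "M > 0" "M * \<tau> \<le> d / 2"
  obtains H where "H holomorphic_on ball 0 R" "H 0 = 1 / l0"
    "\<And>w. cmod w < R \<Longrightarrow> f (\<psi> w) \<in> S"
    "\<And>w. cmod w < R \<Longrightarrow> \<phi> (f (\<psi> w)) = l0 * w * (1 + (l - l0) * H (l0 * w))"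
    "\<And>u. 0 < cmod u \<Longrightarrow> cmod u < R \<Longrightarrow>
        cmod (H u) \<le> M / cmod u * (cmod (deriv \<phi> (\<psi> u)) + 18 * M * \<tau> / d\<^sup>2)"
proof -
  have n0: "l0 \<noteq> 0" using l0 by auto
  have \<tau>0: "\<tau> > 0" using l0 by (simp add: \<tau>)
  have close: "cmod (f (\<psi> (u / l0)) - \<psi> u) \<le> d / 2" "cmod (f (\<psi> (u / l0)) - \<psi> u) \<le> M * \<tau>"
    if u: "cmod u < R" for u
  proof -
    have u1: "cmod (u / l0) < 1" using u R by (simp add: norm_divide l0)
    have "cmod (f (\<psi> (u / l0)) - f0 (\<psi> (u / l0))) \<le> M * \<tau>" using \<psi>(2)[OF u1] f(4) by blast
    thus "cmod (f (\<psi> (u / l0)) - \<psi> u) \<le> M * \<tau>" using f0[OF u1] n0 by simp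
    thus "cmod (f (\<psi> (u / l0)) - \<psi> u) \<le> d / 2" using M by linarith
  qed
  have fS: "f (\<psi> (u / l0)) \<in> S" if u: "cmod u < R" for u
  proof -
    have "f (\<psi> (u / l0)) \<in> ball (\<psi> u) d" using close(1)[OF u] d(1) by (simp add: dist_norm norm_minus_commute)
    thus ?thesis using d(2)[OF u] by blast
  qed
  \<comment> \<open>The argument is \<open>u = l0 * w\<close> rather than \<open>w\<close>, so that the unperturbed map is the identity and the bound
on \<open>h u\<close> involves \<open>deriv \<phi> (\<psi> u)\<close> without a rotation.\<close>
  define h where "h u = \<phi> (f (\<psi> (u / l0))) - u" for u
  have div1: "cmod (u / l0) < 1" if "u \<in> ball 0 R" for u using that R by (simp add: norm_divide l0)
  have hol: "(\<lambda>u. \<phi> (f (\<psi> (u / l0)))) holomorphic_on ball 0 R"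
  proof -
    have 1: "(\<lambda>u. \<psi> (u / l0)) holomorphic_on ball 0 R"
    proof -
      have "(\<lambda>u. u / l0) holomorphic_on ball 0 R" using n0 by (intro holomorphic_intros)
      moreover have "(\<lambda>u. u / l0) ` ball 0 R \<subseteq> ball 0 1" using div1 by auto
      ultimately show ?thesis using holomorphic_on_compose_gen[OF _ \<psi>(1)] by (fastforce simp: o_def)
    qed
    have "(\<lambda>u. f (\<psi> (u / l0))) holomorphic_on ball 0 R"
      using holomorphic_on_compose_gen[OF 1 f(1) image_subsetI] \<psi>(2)[OF div1] by (simp add: o_def)
    from holomorphic_on_compose_gen[OF this \<phi>(1) image_subsetI] show ?thesis using fS by (simp add: o_def)
  qed
  have holh: "h holomorphic_on ball 0 R" unfolding h_def by (intro holomorphic_intros hol)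
  have \<psi>0: "\<psi> 0 = 0" using \<phi>(2,4) S by metis
  have h0: "h 0 = 0" by (simp add: h_def \<psi>0 f(2) \<phi>(2))
  obtain k where k: "k holomorphic_on ball 0 R" "\<And>u. cmod u < R \<Longrightarrow> h u = u * k u" "deriv h 0 = k 0"
    using Schwarz3[OF holh h0] by blast
  have dh: "deriv h 0 = l / l0 - 1"
  proof -
    have d\<psi>: "(\<psi> has_field_derivative deriv \<psi> 0) (at 0)"
      using \<psi>(1) by (intro holomorphic_derivI[of \<psi> "ball 0 1"]) auto
    have d\<phi>: "(\<phi> has_field_derivative deriv \<phi> 0) (at 0)"
      using \<phi>(1) S by (intro holomorphic_derivI[of \<phi> S])
    have df: "(f has_field_derivative l) (at 0)"
      using f(1,3) S by (metis holomorphic_derivI)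
    have one: "deriv \<phi> 0 * deriv \<psi> 0 = 1"
      using deriv_inverse_pair[OF S(1) \<phi>(1) \<psi>(1) \<psi>(2), of 0] \<psi>0 by simp
    have "((\<lambda>u. u / l0) has_field_derivative 1 / l0) (at 0)"
      by (intro DERIV_cdivide DERIV_ident)
    from DERIV_chain2[OF _ this, of \<psi> "deriv \<psi> 0"] d\<psi>
    have "((\<lambda>u. \<psi> (u / l0)) has_field_derivative deriv \<psi> 0 * (1 / l0)) (at 0)" by simp
    from DERIV_chain2[OF _ this, of f l] df \<psi>0
    have "((\<lambda>u. f (\<psi> (u / l0))) has_field_derivative l * (deriv \<psi> 0 * (1 / l0))) (at 0)" by simp
    from DERIV_chain2[OF _ this, of \<phi> "deriv \<phi> 0"] d\<phi> \<psi>0 f(2)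
    have "((\<lambda>u. \<phi> (f (\<psi> (u / l0)))) has_field_derivative deriv \<phi> 0 * (l * (deriv \<psi> 0 * (1 / l0)))) (at 0)" by simp
    hence "(h has_field_derivative deriv \<phi> 0 * (l * (deriv \<psi> 0 * (1 / l0))) - 1) (at 0)"
      unfolding h_def by (intro DERIV_diff DERIV_ident)
    moreover have "deriv \<phi> 0 * (l * (deriv \<psi> 0 * (1 / l0))) = (deriv \<phi> 0 * deriv \<psi> 0) * l / l0" by simp
    ultimately show ?thesis using one by (simp add: DERIV_imp_deriv)
  qed
  define H where "H u = k u / (l - l0)" for u
  show thesis
  proof (rule that[of H])
    show "H holomorphic_on ball 0 R" unfolding H_def using l0 by (intro holomorphic_intros k) auto
    have "k 0 = (l - l0) / l0" using k(3) dh n0 by (simp add: diff_divide_distrib)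
    thus "H 0 = 1 / l0" using l0 by (simp add: H_def)
    fix w assume w: "cmod w < R"
    have lw: "cmod (l0 * w) < R" "l0 * w / l0 = w" using w n0 by (simp_all add: norm_mult l0)
    show "f (\<psi> w) \<in> S" using fS[OF lw(1)] lw(2) by simp
    have "(l - l0) * H (l0 * w) = k (l0 * w)" using l0 by (simp add: H_def)
    moreover have "\<phi> (f (\<psi> w)) - l0 * w = l0 * w * k (l0 * w)"
      using k(2)[OF lw(1)] lw(2) by (simp add: h_def)
    ultimately show "\<phi> (f (\<psi> w)) = l0 * w * (1 + (l - l0) * H (l0 * w))"
      by (simp add: algebra_simps)
  next
    fix u assume u: "0 < cmod u" "cmod u < R"
    define v where "v = f (\<psi> (u / l0)) - \<psi> u"
    have v: "cmod v \<le> d / 2" "cmod v \<le> M * \<tau>" using close[OF u(2)] by (auto simp: v_def)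
    have u1: "cmod u < 1" using u R by simp
    have "cmod (h u) = cmod (\<phi> (\<psi> u + v) - \<phi> (\<psi> u))"
      using \<psi>(2)[OF u1] by (simp add: h_def v_def)
    also have "\<dots> \<le> cmod (deriv \<phi> (\<psi> u)) * cmod v + 18 * (cmod v)\<^sup>2 / d\<^sup>2"
      by (rule taylor_remainder_bounded[OF holomorphic_on_subset[OF \<phi>(1) d(2)[OF u(2)]] d(1) _ v(1)])
        (use d(2)[OF u(2)] \<phi>(3) in \<open>blast intro: less_imp_le\<close>)
    also have "\<dots> \<le> cmod (deriv \<phi> (\<psi> u)) * (M * \<tau>) + 18 * (M * \<tau>)\<^sup>2 / d\<^sup>2"
      using v(2) by (intro add_mono mult_left_mono divide_right_mono power_mono) auto
    also have "\<dots> = \<tau> * (M * (cmod (deriv \<phi> (\<psi> u)) + 18 * M * \<tau> / d\<^sup>2))"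
      by (simp add: power2_eq_square algebra_simps)
    finally have "cmod u * cmod (k u) \<le> \<tau> * (M * (cmod (deriv \<phi> (\<psi> u)) + 18 * M * \<tau> / d\<^sup>2))"
      using k(2)[OF u(2)] by (simp add: norm_mult)
    hence "cmod (k u) / \<tau> \<le> (M * (cmod (deriv \<phi> (\<psi> u)) + 18 * M * \<tau> / d\<^sup>2)) / cmod u"
      using u(1) \<tau>0 by (simp add: divide_le_eq le_divide_eq mult.commute mult.assoc)
    thus "cmod (H u) \<le> M / cmod u * (cmod (deriv \<phi> (\<psi> u)) + 18 * M * \<tau> / d\<^sup>2)"
      by (simp add: H_def norm_divide \<tau>)
  qed
qed

lemma circle_bounded_imp_disc_bounded:
  assumes "H holomorphic_on ball 0 R" "0 < \<rho>" "\<rho> < R"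
    and "\<And>u. cmod u = \<rho> \<Longrightarrow> cmod (H u) \<le> B" and "cmod u \<le> \<rho>"
  shows "cmod (H u) \<le> B"
proof (rule maximum_modulus_frontier[of H "cball 0 \<rho>"])
  have sub: "cball 0 \<rho> \<subseteq> ball (0::complex) R" using assms by auto
  show "H holomorphic_on interior (cball 0 \<rho>)"
    by (rule holomorphic_on_subset[OF assms(1) order_trans[OF interior_subset sub]])
  show "continuous_on (closure (cball 0 \<rho>)) H"
    using holomorphic_on_imp_continuous_on[OF holomorphic_on_subset[OF assms(1) sub]] by simp
qed (use assms in auto)

text \<open>The quotient is \<open>r / \<rho>\<close> for \<open>r = 1 - \<delta>\<close> and \<open>\<rho> = 1 - \<delta> / 2\<close>, at most \<open>exp (- \<delta> / 2)\<close>.\<close>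

lemma power_le_inverse_linear:
  fixes \<delta> :: real and q :: nat
  assumes "0 < \<delta>" "\<delta> < 1" "q > 0"
  shows "((1 - \<delta>) / (1 - \<delta> / 2)) ^ q \<le> 2 / (q * \<delta>)"
proof -
  have "(1 - \<delta>) / (1 - \<delta> / 2) \<le> 1 - \<delta> / 2"
  proof (subst pos_divide_le_eq)
    have "(1 - \<delta> / 2) * (1 - \<delta> / 2) = 1 - \<delta> + \<delta> * \<delta> / 4" by (simp add: field_simps)
    moreover have "\<delta> * \<delta> \<ge> 0" using assms by simp
    ultimately show "1 - \<delta> \<le> (1 - \<delta> / 2) * (1 - \<delta> / 2)" by linarith
  qed (use assms in auto)
  also have "\<dots> \<le> exp (- (\<delta> / 2))" using exp_ge_add_one_self[of "- (\<delta> / 2)"] by simp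
  finally have "((1 - \<delta>) / (1 - \<delta> / 2)) ^ q \<le> exp (- (\<delta> / 2)) ^ q"
    using assms by (intro power_mono) auto
  also have "\<dots> = exp (q * (- (\<delta> / 2)))" by (rule exp_of_nat_mult[symmetric])
  also have "\<dots> = 1 / exp (q * \<delta> / 2)" by (simp add: exp_minus inverse_eq_divide)
  also have "\<dots> \<le> 1 / (q * \<delta> / 2)"
  proof (rule divide_left_mono)
    show "q * \<delta> / 2 \<le> exp (q * \<delta> / 2)" using exp_ge_add_one_self[of "q * \<delta> / 2"] by linarith
  qed (use assms in auto)
  finally show ?thesis by simp
qed

section \<open>Basins of attraction near the Siegel disk\<close>

text \<open>Since \<open>deriv \<phi> \<circ> \<psi>\<close> is \<open>1 / deriv \<psi>\<close>, these are the integral means of \<open>\<psi>\<close> with exponent \<open>- 1\<close>. By the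
mean value property they are bounded below by a positive constant, so they cannot tend to 0; this
is why \<open>\<gamma> > 1\<close> and \<open>b\<close> can be taken nonnegative.\<close>

lemma spectrum_growth_bound:
  assumes S: "open S" and \<phi>: "\<phi> holomorphic_on S" and \<psi>: "\<psi> holomorphic_on ball 0 1"
    and inv: "\<And>u. cmod u < 1 \<Longrightarrow> \<psi> u \<in> S \<and> \<phi> (\<psi> u) = u"
    and \<gamma>: "ereal \<gamma> > 1 + integral_means_spectrum \<psi> (- 1)"
  obtains b where "0 \<le> b" "b < \<gamma> - 1"
    "eventually (\<lambda>s. integral {0..2 * pi} (\<lambda>t. cmod (deriv \<phi> (\<psi> (of_real s * cis t)))) \<le> (1 - s) powr (- b)) (at_left 1)"
proof -
  define J where "J s = integral {0..2 * pi} (\<lambda>t. cmod (deriv \<phi> (\<psi> (of_real s * cis t))))" for s :: real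
  define k where "k u = deriv \<phi> (\<psi> u)" for u
  have dd: "k u * deriv \<psi> u = 1" if "cmod u < 1" for u
    using deriv_inverse_pair[OF S \<phi> \<psi> inv that] by (simp add: k_def)
  have "deriv \<phi> holomorphic_on S" using \<phi> S by (rule holomorphic_deriv)
  from holomorphic_on_compose_gen[OF \<psi> this image_subsetI]
  have holk: "k holomorphic_on ball 0 1" using inv by (simp add: o_def k_def[abs_def])
  have powr: "cmod (deriv \<psi> u) powr - 1 = cmod (k u)" if "cmod u < 1" for u
  proof -
    have "cmod (k u) * cmod (deriv \<psi> u) = 1" using dd[OF that] by (metis norm_mult norm_one)
    moreover from this have "cmod (deriv \<psi> u) \<noteq> 0" by auto
    ultimately show ?thesis by (simp add: powr_minus field_simps)
  qed
  define c0 where "c0 = 2 * pi * cmod (k 0)"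
  have "k 0 \<noteq> 0" using dd[of 0] by auto
  hence c0: "c0 > 0" unfolding c0_def by (intro mult_pos_pos) auto
  have Jc: "c0 \<le> J s" if s: "0 < s" "s < 1" for s
  proof -
    have I: "((\<lambda>t. k (s * cis t)) has_integral 2 * pi * k 0) {0..2 * pi}"
      using cauchy_formula_circle_mean[OF holk s, of 0] s by simp
    have "continuous_on {0..2 * pi} (\<lambda>t. k (s * cis t))"
      by (rule continuous_on_compose2[OF holomorphic_on_imp_continuous_on[OF holk]])
        (use s in \<open>auto intro!: continuous_intros simp: norm_mult\<close>)
    hence "(\<lambda>t. cmod (k (s * cis t))) integrable_on {0..2 * pi}"
      by (intro integrable_continuous_interval continuous_on_norm)
    hence "cmod (integral {0..2 * pi} (\<lambda>t. k (s * cis t))) \<le> integral {0..2 * pi} (\<lambda>t. cmod (k (s * cis t)))"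
      using I by (intro integral_norm_bound_integral) auto
    thus ?thesis using I by (simp add: integral_unique norm_mult c0_def J_def k_def)
  qed
  have Jeq: "integral {0..2 * pi} (\<lambda>\<theta>. cmod (deriv \<psi> (of_real s * cis \<theta>)) powr - 1) = J s"
    if "0 < s" "s < 1" for s
    unfolding J_def k_def[symmetric] using that by (intro integral_cong powr) (simp add: norm_mult)
  have ev: "eventually (\<lambda>s. J s < (1 - s) powr (- b)) (at_left 1)"
    if b: "integral_means_spectrum \<psi> (- 1) < ereal b" for b
  proof -
    have "eventually (\<lambda>r::real. ereal (ln (integral {0..2 * pi} (\<lambda>\<theta>. cmod (deriv \<psi> (of_real r * cis \<theta>)) powr - 1))
        / (- ln (1 - r))) < ereal b) (at_left 1)"
      by (rule Limsup_lessD) (use b in \<open>simp add: integral_means_spectrum_def\<close>)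
    moreover have "eventually (\<lambda>s::real. s \<in> {0<..<1}) (at_left 1)"
      by (rule eventually_at_leftI[of 0]) auto
    ultimately show ?thesis
    proof eventually_elim
      case (elim s)
      hence s: "0 < s" "s < 1" by auto
      have J0: "J s > 0" using Jc[OF s] c0 by linarith
      have l: "- ln (1 - s) > 0" using s by simp
      have "ln (J s) / (- ln (1 - s)) < b" using elim Jeq[OF s] by simp
      hence "ln (J s) < b * (- ln (1 - s))" using l by (simp only: pos_divide_less_eq)
      also have "\<dots> = ln ((1 - s) powr (- b))" using s by (simp add: ln_powr)
      finally have "ln (J s) < ln ((1 - s) powr (- b))" .
      moreover have "(1 - s) powr (- b) > 0" using s by simp
      ultimately show ?case using ln_less_cancel_iff[OF J0] by blast
    qed
  qed
  obtain b1 where b1: "integral_means_spectrum \<psi> (- 1) < ereal b1" "b1 < \<gamma> - 1"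
  proof -
    have "integral_means_spectrum \<psi> (- 1) < ereal (\<gamma> - 1)"
      using \<gamma> by (cases "integral_means_spectrum \<psi> (- 1)") (auto simp: one_ereal_def)
    then obtain x where "integral_means_spectrum \<psi> (- 1) < ereal x" "ereal x < ereal (\<gamma> - 1)"
      using ereal_dense2 by blast
    thus ?thesis using that by simp
  qed
  have g1: "\<gamma> - 1 > 0"
  proof (rule ccontr)
    assume "\<not> \<gamma> - 1 > 0"
    hence b1n: "- b1 > 0" using b1 by simp
    have "((\<lambda>s. (1 - s) powr (- b1)) \<longlongrightarrow> 0) (at_left 1)"
    proof (rule tendsto_zero_powrI)
      show "((\<lambda>s::real. 1 - s) \<longlongrightarrow> 0) (at_left 1)" by (auto intro!: tendsto_eq_intros)
      show "\<forall>\<^sub>F s in at_left 1. (0::real) \<le> 1 - s" by (rule eventually_at_leftI[of 0]) auto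
    qed (use b1n in auto)
    hence "eventually (\<lambda>s. (1 - s) powr (- b1) < c0) (at_left 1)"
      using c0 by (rule order_tendstoD(2))
    moreover have "eventually (\<lambda>s::real. s \<in> {0<..<1}) (at_left 1)"
      by (rule eventually_at_leftI[of 0]) auto
    ultimately have "eventually (\<lambda>s::real. False) (at_left 1)"
      using ev[OF b1(1)] by eventually_elim (use Jc in fastforce)
    thus False by simp
  qed
  show thesis
  proof (rule that[of "max b1 0"])
    show "0 \<le> max b1 0" "max b1 0 < \<gamma> - 1" using b1 g1 by auto
    have "eventually (\<lambda>s::real. s \<in> {0<..<1}) (at_left 1)"
      by (rule eventually_at_leftI[of 0]) auto
    with ev[OF b1(1)] show "eventually (\<lambda>s. integral {0..2 * pi} (\<lambda>t. cmod (deriv \<phi> (\<psi> (of_real s * cis t)))) \<le> (1 - s) powr (- max b1 0)) (at_left 1)"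
    proof eventually_elim
      case (elim s)
      have "(1 - s) powr (- b1) \<le> (1 - s) powr (- max b1 0)" using elim by (intro powr_mono') auto
      thus ?case using elim by (simp add: J_def)
    qed
  qed
qed

text \<open>The radii are \<open>r = 1 - \<delta> < \<rho> = 1 - \<delta> / 2 < R = 1 - \<delta> / 4 < 1\<close>. On the circle of radius \<open>\<rho>\<close>,
\<open>K / \<delta>\<close> bounds \<open>\<bar>H\<bar>\<close> and \<open>N * \<delta> powr (- b)\<close> bounds its mean. The number \<open>C\<close> makes those errors small
that stem from \<open>l - l0\<close>; the errors from \<open>p / q\<close> are of order \<open>\<delta> powr e\<close> with \<open>e = \<gamma> - 1 - b > 0\<close> and
are made small by restricting to \<open>\<delta> \<le> \<delta>0\<close>.\<close>

lemma siegel_disk_orbits_stay: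
  fixes \<phi> \<psi> f0 :: "complex \<Rightarrow> complex" and l0 :: complex
  assumes S: "open S" "0 \<in> S"
    and \<phi>: "\<phi> holomorphic_on S" "\<phi> 0 = 0" "\<And>z. z \<in> S \<Longrightarrow> cmod (\<phi> z) < 1" "\<And>z. z \<in> S \<Longrightarrow> \<psi> (\<phi> z) = z"
    and \<psi>: "\<psi> holomorphic_on ball 0 1" "\<And>u. cmod u < 1 \<Longrightarrow> \<psi> u \<in> S \<and> \<phi> (\<psi> u) = u"
    and \<alpha>: "\<alpha> \<notin> \<rat>" "l0 = cis (2 * pi * \<alpha>)"
    and f0: "\<And>u. cmod u < 1 \<Longrightarrow> f0 (\<psi> u) = \<psi> (l0 * u)"
    and c: "c > 0" "\<And>u. cmod u < 1 \<Longrightarrow> ball (\<psi> u) (c * (1 - cmod u)\<^sup>2) \<subseteq> S"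
      "\<And>u. cmod u < 1 \<Longrightarrow> cmod (deriv \<phi> (\<psi> u)) \<le> 2 / (c * (1 - cmod u))"
    and b: "0 \<le> b" "b < \<gamma> - 1"
      "eventually (\<lambda>s. integral {0..2 * pi} (\<lambda>t. cmod (deriv \<phi> (\<psi> (of_real s * cis t)))) \<le> (1 - s) powr (- b)) (at_left 1)"
    and M: "M > 0" and \<kappa>: "\<kappa> > 0"
  obtains C r0 :: real where "C > 0" "0 < r0" "r0 < 1"
    "\<And>r l f \<zeta> n. r0 \<le> r \<Longrightarrow> r < 1 \<Longrightarrow> l \<noteq> l0 \<Longrightarrow>
       cmod (l - l0) < C * (1 - r) ^ 3 / cf_ell \<alpha> ((1 - r) powr (- \<gamma>)) \<Longrightarrow>
       Re ((l - l0) / l0) \<le> - \<kappa> * cmod (l - l0) \<Longrightarrow>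
       f holomorphic_on S \<Longrightarrow> f 0 = 0 \<Longrightarrow> deriv f 0 = l \<Longrightarrow>
       (\<And>z. z \<in> S \<Longrightarrow> cmod (f z - f0 z) \<le> M * cmod (l - l0)) \<Longrightarrow>
       cmod \<zeta> \<le> r \<Longrightarrow> (f ^^ n) (\<psi> \<zeta>) \<in> S"
proof -
  \<comment> \<open>bounds the Taylor term \<open>18 * M * \<tau> / d\<^sup>2\<close> for \<open>\<tau> \<le> 2 * \<delta> ^ 4\<close> and \<open>d = c * (\<delta> / 4)\<^sup>2\<close>\<close>
  define A0 where "A0 = 9216 * M / c\<^sup>2"
  have A0: "A0 > 0" using M c by (simp add: A0_def)
  define K where "K = 2 * M * (4 / c + A0)"
  have K: "K > 0" unfolding K_def using M c A0 by (intro mult_pos_pos add_pos_pos) auto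
  define N where "N = 2 * M * (2 powr b + A0)"
  have N: "N > 0" unfolding N_def using M A0 by (intro mult_pos_pos add_pos_pos) auto
  \<comment> \<open>The second entry ensures \<open>M * \<tau> \<le> d / 2\<close>, the third that the orbit deviates by at most \<open>\<delta> / 8\<close>
because of \<open>l - l0\<close>, the last that this contributes at most \<open>\<kappa> / 8\<close> to the averaging error.\<close>
  define C where "C = Min {1, c / (64 * M), 1 / (8 * K), \<kappa> / (96 * K\<^sup>2)}"
  have C: "C > 0" "C \<le> 1" "C \<le> c / (64 * M)" "C \<le> 1 / (8 * K)" "C \<le> \<kappa> / (96 * K\<^sup>2)"
    using c M K \<kappa> by (auto simp: C_def)
  have C': "64 * M * C \<le> c" "8 * (C * K) \<le> 1" "96 * (C * K\<^sup>2) \<le> \<kappa>"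
    using C M K by (simp_all add: field_simps)
  define e where "e = \<gamma> - 1 - b"
  have e: "e > 0" using b by (simp add: e_def)
  \<comment> \<open>bounds \<open>\<delta> powr e\<close>; the approximation by \<open>p / q\<close> contributes at most \<open>164 * N * \<delta> powr e \<le> \<kappa> / 8\<close> to
the averaging error\<close>
  define \<epsilon> where "\<epsilon> = min (1 / 128) (\<kappa> / (2000 * N))"
  have \<epsilon>: "0 < \<epsilon>" "\<epsilon> \<le> 1 / 128" "\<epsilon> \<le> \<kappa> / (2000 * N)" using \<kappa> N by (auto simp: \<epsilon>_def)
  obtain s0 where s0: "s0 < 1" "\<And>s. s0 < s \<Longrightarrow> s < 1 \<Longrightarrow>
      integral {0..2 * pi} (\<lambda>t. cmod (deriv \<phi> (\<psi> (of_real s * cis t)))) \<le> (1 - s) powr (- b)"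
    using b(3) unfolding eventually_at_left[of 0 1, simplified] eventually_at_left_field by blast
  define \<delta>0 where "\<delta>0 = min (1 / 2) (min (1 - s0) (\<epsilon> powr (1 / e)))"
  have \<delta>0: "0 < \<delta>0" "\<delta>0 \<le> 1 / 2" "\<delta>0 \<le> 1 - s0" "\<delta>0 \<le> \<epsilon> powr (1 / e)"
    proof -
    show "\<delta>0 \<le> 1 / 2" unfolding \<delta>0_def by (rule min.cobounded1)
    show "\<delta>0 \<le> 1 - s0" "\<delta>0 \<le> \<epsilon> powr (1 / e)" unfolding \<delta>0_def by auto
    show "0 < \<delta>0" using s0(1) \<epsilon>(1) by (simp add: \<delta>0_def)
  qed
  show thesis
  proof (rule that[of C "1 - \<delta>0"])
    show "C > 0" "0 < 1 - \<delta>0" "1 - \<delta>0 < 1" using C \<delta>0 by auto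
    fix r l f \<zeta> n
    assume r: "1 - \<delta>0 \<le> r" "r < 1" and l: "l \<noteq> l0"
      and \<tau>C: "cmod (l - l0) < C * (1 - r) ^ 3 / cf_ell \<alpha> ((1 - r) powr (- \<gamma>))"
      and re: "Re ((l - l0) / l0) \<le> - \<kappa> * cmod (l - l0)"
      and f: "f holomorphic_on S" "f 0 = 0" "deriv f 0 = l"
      and ff0: "\<And>z. z \<in> S \<Longrightarrow> cmod (f z - f0 z) \<le> M * cmod (l - l0)"
      and \<zeta>: "cmod \<zeta> \<le> r"
    define \<delta> where "\<delta> = 1 - r"
    define \<tau> where "\<tau> = cmod (l - l0)"
    define E where "E = \<delta> powr (\<gamma> - 1)"
    have \<delta>: "0 < \<delta>" "\<delta> \<le> 1 / 2" "\<delta> \<le> 1 - s0" "\<delta> \<le> \<epsilon> powr (1 / e)" using r \<delta>0 by (auto simp: \<delta>_def)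
    have \<delta>e: "\<delta> powr e \<le> \<epsilon>"
    proof -
      have "\<delta> powr e \<le> (\<epsilon> powr (1 / e)) powr e" using \<delta> e by (intro powr_mono2) auto
      thus ?thesis using e \<epsilon> by (simp add: powr_powr)
    qed
    have E: "0 < E" "E \<le> \<delta> powr e"
      unfolding E_def e_def using \<delta> b by (auto intro!: powr_mono')
    have E128: "E \<le> 1 / 128" using E \<delta>e \<epsilon> by linarith
    have \<delta>\<gamma>: "\<delta> powr \<gamma> = \<delta> * E" using \<delta> powr_add[of \<delta> 1 "\<gamma> - 1"] by (simp add: E_def)
    obtain p :: int and q :: nat where q: "cf_ell \<alpha> (\<delta> powr (- \<gamma>)) = real q" "q \<ge> 1" "coprime p (int q)"
      "\<bar>\<alpha> - p / q\<bar> \<le> 1 / (real q)\<^sup>2" "\<delta> powr (- \<gamma>) \<le> 2 * real q"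
      using cf_ell_convergent[OF \<alpha>(1)] by metis
    have q0: "real q > 0" using q(2) by simp
    have iq: "1 / real q \<le> 2 * (\<delta> * E)"
    proof -
      have "1 / (\<delta> powr \<gamma>) \<le> 2 * real q" using q(5) by (simp add: powr_minus_divide)
      thus ?thesis using q0 \<delta> E unfolding \<delta>\<gamma> by (simp add: field_simps)
    qed
    have \<tau>0: "\<tau> > 0" using l by (simp add: \<tau>_def)
    have q\<tau>: "q * \<tau> \<le> C * \<delta> ^ 3"
      using \<tau>C q0 by (simp add: \<tau>_def[symmetric] \<delta>_def[symmetric] q(1) field_simps)
    \<comment> \<open>Here \<open>1 / q\<close> yields a fourth power of \<open>\<delta>\<close>. This is what keeps the quadratic Taylor remainder
bounded, since \<open>d\<close> is of order \<open>\<delta>\<^sup>2\<close>.\<close>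
    have \<tau>4: "\<tau> \<le> 2 * C * \<delta> ^ 4"
    proof -
      have "\<tau> = (q * \<tau>) * (1 / q)" using q0 by simp
      also have "\<dots> \<le> (C * \<delta> ^ 3) * (2 * (\<delta> * E))"
        using C \<delta> by (intro mult_mono[OF q\<tau> iq]) auto
      also have "\<dots> = 2 * C * \<delta> ^ 4 * E" by (simp add: power4_eq_xxxx power3_eq_cube)
      also have "\<dots> \<le> 2 * C * \<delta> ^ 4 * 1" using E128 C \<delta> by (intro mult_left_mono) auto
      finally show ?thesis by simp
    qed
    have \<delta>42: "\<delta> ^ 4 \<le> \<delta> ^ 2" using \<delta> by (intro power_decreasing) auto
    have \<tau>2: "\<tau> \<le> 2 * C * \<delta>\<^sup>2"
      using \<tau>4 mult_left_mono[OF \<delta>42, of "2 * C"] C by linarith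
    define R where "R = 1 - \<delta> / 4"
    define \<rho> where "\<rho> = 1 - \<delta> / 2"
    define d where "d = c * (\<delta> / 4)\<^sup>2"
    have d0: "d > 0" using c \<delta> by (simp add: d_def)
    have ballS: "ball (\<psi> u) d \<subseteq> S" if "cmod u < R" for u
    proof -
      have "d \<le> c * (1 - cmod u)\<^sup>2"
        unfolding d_def using that c \<delta> by (intro mult_left_mono power_mono) (auto simp: R_def)
      hence "ball (\<psi> u) d \<subseteq> ball (\<psi> u) (c * (1 - cmod u)\<^sup>2)" by (rule subset_ball)
      thus ?thesis using c(2)[of u] that \<delta> by (simp add: R_def)
    qed
    have Md: "M * \<tau> \<le> d / 2"
    proof -
      have "M * \<tau> \<le> M * (2 * C * \<delta>\<^sup>2)" using \<tau>2 M by (intro mult_left_mono) auto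
      also have "\<dots> = (64 * M * C) * \<delta>\<^sup>2 / 32" by simp
      also have "\<dots> \<le> c * \<delta>\<^sup>2 / 32" using C'(1) by (intro divide_right_mono mult_right_mono) auto
      finally show ?thesis by (simp add: d_def power2_eq_square)
    qed
    have n0: "cmod l0 = 1" by (simp add: \<alpha>)
    have R: "0 < R" "R < 1" using \<delta> by (auto simp: R_def)
    obtain H where H: "H holomorphic_on ball 0 R" "H 0 = 1 / l0"
      "\<And>w. cmod w < R \<Longrightarrow> f (\<psi> w) \<in> S"
      "\<And>w. cmod w < R \<Longrightarrow> \<phi> (f (\<psi> w)) = l0 * w * (1 + (l - l0) * H (l0 * w))"
      "\<And>u. 0 < cmod u \<Longrightarrow> cmod u < R \<Longrightarrow>
        cmod (H u) \<le> M / cmod u * (cmod (deriv \<phi> (\<psi> u)) + 18 * M * \<tau> / d\<^sup>2)"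
      using conjugated_perturbation[OF S \<phi> \<psi> n0 l \<tau>_def f0 f ff0[folded \<tau>_def] R d0 ballS M Md] by metis
    have \<rho>: "0 < \<rho>" "1 / 2 \<le> \<rho>" "\<rho> < R" "\<rho> \<le> 1" "r < \<rho>" "\<rho> - r = \<delta> / 2" "1 - \<rho> = \<delta> / 2"
      using \<delta> by (auto simp: \<rho>_def R_def \<delta>_def field_simps)
    have quad: "18 * M * \<tau> / d\<^sup>2 \<le> A0"
    proof -
      have "18 * M * \<tau> / d\<^sup>2 \<le> 18 * M * (2 * C * \<delta> ^ 4) / d\<^sup>2"
        using \<tau>4 M by (intro divide_right_mono mult_left_mono) auto
      also have "\<dots> \<le> 18 * M * (2 * 1 * \<delta> ^ 4) / d\<^sup>2"
        using C M \<delta> by (intro divide_right_mono mult_left_mono mult_right_mono) auto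
      also have "\<dots> = A0" unfolding d_def A0_def using \<delta> c M by (simp add: field_simps power2_eq_square power4_eq_xxxx)
      finally show ?thesis .
    qed
    have Hcirc: "cmod (H u) \<le> 2 * M * (cmod (deriv \<phi> (\<psi> u)) + A0)" if u: "cmod u = \<rho>" for u
    proof -
      have "cmod (H u) \<le> M / \<rho> * (cmod (deriv \<phi> (\<psi> u)) + 18 * M * \<tau> / d\<^sup>2)"
        using H(5)[of u] u \<rho> by simp
      also have "\<dots> \<le> (2 * M) * (cmod (deriv \<phi> (\<psi> u)) + A0)"
      proof (intro mult_mono add_left_mono quad)
        have "M / \<rho> \<le> M / (1 / 2)" using \<rho> M by (intro divide_left_mono) auto
        thus "M / \<rho> \<le> 2 * M" by simp
      qed (use M \<tau>0 in auto)
      finally show ?thesis .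
    qed
    define B where "B = K / \<delta>"
    have Bcirc: "cmod (H u) \<le> B" if u: "cmod u = \<rho>" for u
    proof -
      have "cmod u < 1" using u \<rho>(3) R(2) by linarith
      from c(3)[OF this] have "cmod (deriv \<phi> (\<psi> u)) \<le> 2 / (c * (1 - \<rho>))" unfolding u .
      also have "\<dots> = 4 / c / \<delta>" unfolding \<rho>(7) by simp
      finally have "cmod (deriv \<phi> (\<psi> u)) + A0 \<le> 4 / c / \<delta> + A0 / \<delta>"
        using A0 \<delta> by (intro add_mono) (auto simp: field_simps)
      hence "2 * M * (cmod (deriv \<phi> (\<psi> u)) + A0) \<le> 2 * M * (4 / c / \<delta> + A0 / \<delta>)"
        using M by (intro mult_left_mono) auto
      also have "\<dots> = B" using \<delta>(1) c(1) by (simp add: B_def K_def field_simps)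
      finally show ?thesis using Hcirc[OF u] by linarith
    qed
    have Hdisc: "cmod (H u) \<le> B" if "cmod u \<le> \<rho>" for u
      by (rule circle_bounded_imp_disc_bounded[OF H(1) \<rho>(1,3) Bcirc that])
    have ncirc: "cmod (\<rho> * cis t) = \<rho>" for t using \<rho> by (simp add: norm_mult)
    define I where "I = integral {0..2 * pi} (\<lambda>t. cmod (H (\<rho> * cis t))) / (2 * pi)"
    have contc: "continuous_on {0..2 * pi} (\<lambda>t. F (\<rho> * cis t))" if "continuous_on (ball 0 R) F" for F :: "complex \<Rightarrow> complex"
    proof (rule continuous_on_compose2[OF that])
      show "continuous_on {0..2 * pi} (\<lambda>t. \<rho> * cis t)" by (intro continuous_intros)
      show "(\<lambda>t. \<rho> * cis t) ` {0..2 * pi} \<subseteq> ball 0 R" using ncirc \<rho> by auto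
    qed
    have contH: "continuous_on {0..2 * pi} (\<lambda>t. cmod (H (\<rho> * cis t)))"
      by (intro continuous_on_norm contc holomorphic_on_imp_continuous_on H(1))
    have cont\<phi>: "continuous_on {0..2 * pi} (\<lambda>t. cmod (deriv \<phi> (\<psi> (\<rho> * cis t))))"
    proof (intro continuous_on_norm contc)
      have h: "deriv \<phi> holomorphic_on S" using \<phi>(1) S(1) by (rule holomorphic_deriv)
      have sub: "ball 0 R \<subseteq> ball (0::complex) 1" using R(2) by auto
      have h': "\<psi> holomorphic_on ball 0 R" by (rule holomorphic_on_subset[OF \<psi>(1) sub])
      have "\<psi> ` ball 0 R \<subseteq> S" using \<psi>(2) R(2) by auto
      thus "continuous_on (ball 0 R) (\<lambda>u. deriv \<phi> (\<psi> u))"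
        by (rule continuous_on_compose2[OF holomorphic_on_imp_continuous_on[OF h]
              holomorphic_on_imp_continuous_on[OF h']])
    qed
    have IB: "I \<le> B"
    proof -
      have "integral {0..2 * pi} (\<lambda>t. cmod (H (\<rho> * cis t))) \<le> integral {0..2 * pi} (\<lambda>t. B)"
        using Bcirc ncirc by (intro integral_le integrable_continuous_interval contH) auto
      thus ?thesis by (simp add: I_def field_simps)
    qed
    have I0: "I \<ge> 0" unfolding I_def by (intro divide_nonneg_pos integral_nonneg integrable_continuous_interval contH) auto
    have IN: "I \<le> N * \<delta> powr (- b)"
    proof -
      define J where "J = integral {0..2 * pi} (\<lambda>t. cmod (deriv \<phi> (\<psi> (\<rho> * cis t))))"
      have J0: "J \<ge> 0" unfolding J_def by (intro integral_nonneg integrable_continuous_interval cont\<phi>) auto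
      have "integral {0..2 * pi} (\<lambda>t. cmod (H (\<rho> * cis t)))
          \<le> integral {0..2 * pi} (\<lambda>t. 2 * M * (cmod (deriv \<phi> (\<psi> (\<rho> * cis t))) + A0))"
        using Hcirc ncirc
        by (intro integral_le integrable_continuous_interval contH continuous_intros cont\<phi>) auto
      also have "\<dots> = 2 * M * (integral {0..2 * pi} (\<lambda>t. cmod (deriv \<phi> (\<psi> (\<rho> * cis t))) + A0))"
        by (rule integral_mult_right)
      also have "integral {0..2 * pi} (\<lambda>t. cmod (deriv \<phi> (\<psi> (\<rho> * cis t))) + A0) = J + 2 * pi * A0"
        unfolding J_def by (subst integral_add) (auto intro!: integrable_continuous_interval cont\<phi>)
      finally have "I \<le> 2 * M * (J + 2 * pi * A0) / (2 * pi)" unfolding I_def by (intro divide_right_mono) auto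
      also have "\<dots> = 2 * M * (J / (2 * pi) + A0)" by (simp add: field_simps)
      also have "\<dots> \<le> 2 * M * (J + A0)"
      proof (intro mult_left_mono add_right_mono)
        have "J / (2 * pi) \<le> J / 1" using J0 pi_gt3 by (intro divide_left_mono) auto
        thus "J / (2 * pi) \<le> J" by simp
      qed (use M in auto)
      also have "J \<le> (1 - \<rho>) powr (- b)"
        unfolding J_def using \<delta> \<rho> R by (intro s0(2)) (auto simp: \<rho>_def)
      also have "\<dots> = 2 powr b * \<delta> powr (- b)"
        unfolding \<rho>(7) using \<delta> by (simp add: powr_divide powr_minus field_simps)
      finally have "I \<le> 2 * M * (2 powr b * \<delta> powr (- b) + A0)" using M by simp
      also have "\<dots> \<le> 2 * M * (2 powr b * \<delta> powr (- b) + A0 * \<delta> powr (- b))"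
      proof -
        have "\<delta> powr 0 \<le> \<delta> powr (- b)" using \<delta> b by (intro powr_mono') auto
        hence "1 \<le> \<delta> powr (- b)" using \<delta> by simp
        thus ?thesis using A0 M by (intro mult_left_mono add_left_mono) auto
      qed
      finally show ?thesis by (simp add: N_def algebra_simps)
    qed
    define \<eta> where "\<eta> = q * \<tau> * B + 2 * pi / q"
    define x where "x = (r / \<rho>) ^ q"
    have pi4: "pi \<le> 3.2" using pi_approx by simp
    have \<eta>1: "q * \<tau> * B \<le> C * K * \<delta>\<^sup>2"
    proof -
      have "q * \<tau> * B \<le> (C * \<delta> ^ 3) * B" using q\<tau> K \<delta> by (intro mult_right_mono) (auto simp: B_def)
      also have "\<dots> = C * K * \<delta>\<^sup>2" using \<delta> by (simp add: B_def power3_eq_cube power2_eq_square)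
      finally show ?thesis .
    qed
    have \<eta>2: "2 * pi / q \<le> 13 * (\<delta> * E)"
    proof -
      have "2 * pi / q = 2 * pi * (1 / q)" by simp
      also have "\<dots> \<le> 2 * 3.2 * (2 * (\<delta> * E))" using pi4 iq \<delta> E by (intro mult_mono) auto
      also have "\<dots> \<le> 13 * (\<delta> * E)" using \<delta> E by simp
      finally show ?thesis .
    qed
    have \<eta>: "2 * \<eta> \<le> \<rho> - r"
    proof -
      have "C * K * \<delta>\<^sup>2 = (C * K) * \<delta> * \<delta>" by (simp add: power2_eq_square)
      also have "\<dots> \<le> (1 / 8) * \<delta> * 1" using C' C K \<delta> by (intro mult_mono) auto
      finally have 1: "q * \<tau> * B \<le> \<delta> / 8" using \<eta>1 by simp
      have "\<delta> * E \<le> \<delta> * (1 / 128)" using E128 \<delta> by (intro mult_left_mono) auto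
      hence "2 * pi / q \<le> \<delta> / 8" using \<eta>2 \<delta> by linarith
      thus ?thesis using 1 by (simp add: \<eta>_def \<rho>(6))
    qed
    have x: "x \<le> 4 * E" "0 \<le> x"
    proof -
      have "x \<le> 2 / (q * \<delta>)"
        using power_le_inverse_linear[of \<delta> q] \<delta> q0 by (simp add: x_def \<rho>_def \<delta>_def)
      also have "\<dots> = 2 / \<delta> * (1 / q)" by simp
      also have "\<dots> \<le> 2 / \<delta> * (2 * (\<delta> * E))" using iq \<delta> by (intro mult_left_mono) auto
      also have "\<dots> = 4 * E" using \<delta> by simp
      finally show "x \<le> 4 * E" .
      show "0 \<le> x" using r \<delta>0 \<rho> by (simp add: x_def)
    qed
    \<comment> \<open>The mean \<open>I\<close> is estimated by \<open>K / \<delta>\<close> in the part of the error that comes from \<open>l - l0\<close>, and by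
\<open>N * \<delta> powr (- b)\<close> in the rest.\<close>
    have mean: "I * (2 * x + 6 * \<eta> / (\<rho> - r)) \<le> \<kappa> / 4"
    proof -
      have "6 * \<eta> / (\<rho> - r) = 12 * \<eta> / \<delta>" by (simp add: \<rho>(6))
      also have "\<dots> \<le> 12 * (C * K * \<delta>\<^sup>2 + 13 * (\<delta> * E)) / \<delta>"
        unfolding \<eta>_def using \<eta>1 \<eta>2 \<delta> by (intro divide_right_mono mult_left_mono add_mono) auto
      also have "\<dots> = 12 * (C * K * \<delta>) + 156 * E" using \<delta> by (simp add: field_simps power2_eq_square)
      finally have "2 * x + 6 * \<eta> / (\<rho> - r) \<le> 12 * (C * K * \<delta>) + 164 * E" using x by linarith
      hence "I * (2 * x + 6 * \<eta> / (\<rho> - r)) \<le> I * (12 * (C * K * \<delta>) + 164 * E)"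
        using I0 by (rule mult_left_mono)
      also have "\<dots> = I * (12 * (C * K * \<delta>)) + I * (164 * E)" by (rule distrib_left)
      also have "I * (12 * (C * K * \<delta>)) \<le> B * (12 * (C * K * \<delta>))"
        using IB C K \<delta> by (intro mult_right_mono) auto
      also have "\<dots> = 12 * (C * K\<^sup>2)" using \<delta> by (simp add: B_def power2_eq_square)
      also have "I * (164 * E) \<le> (N * \<delta> powr (- b)) * (164 * E)"
        using IN E by (intro mult_right_mono) auto
      also have "\<dots> = 164 * N * \<delta> powr e"
        using \<delta> by (simp add: E_def e_def flip: powr_add)
      also have "\<dots> \<le> 164 * N * (\<kappa> / (2000 * N))"
        using \<delta>e \<epsilon> N by (intro mult_left_mono) auto
      finally show ?thesis using C'(3) N \<kappa> by simp
    qed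
    have \<tau>B: "\<tau> * B\<^sup>2 \<le> \<kappa> / 2"
    proof -
      have "\<tau> * B\<^sup>2 \<le> (2 * C * \<delta>\<^sup>2) * B\<^sup>2" using \<tau>2 by (intro mult_right_mono) auto
      also have "\<dots> = 2 * (C * K\<^sup>2)" using \<delta> by (simp add: B_def power_divide)
      finally show ?thesis using C'(3) \<kappa> by linarith
    qed
    define g where "g w = \<phi> (f (\<psi> w))" for w
    have gw: "g w = \<phi> (f (\<psi> w))" for w by (simp only: g_def)
    have r0: "0 \<le> r" using r \<delta>0 by linarith
    have qpos: "q > 0" using q by simp
    have xh: "(r / \<rho>) ^ q \<le> 1 / 2" using x E128 by (simp add: x_def)
    have gn: "cmod ((g ^^ m) \<zeta>) < \<rho>" for m
    proof (rule funpow_bounded_by_first_return[OF qpos _ _ \<zeta>])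
      fix z k assume z: "cmod z \<le> r"
      note ret = perturbed_rotation_first_return[of l0 \<alpha> H R r \<rho> g l B \<tau> \<kappa> p q \<eta>, OF \<alpha>(2) H(1,2)
          r0 \<rho>(5,3,4) _ Hdisc \<tau>_def re[folded \<tau>_def] \<kappa> q(3) qpos q(4) \<eta>_def \<eta> xh mean[unfolded I_def x_def] \<tau>B z]
      show "cmod ((g ^^ k) z) < \<rho>" if "k \<le> q" by (rule ret(1)) (use H(4) that in \<open>auto simp: g_def\<close>)
      have "cmod ((g ^^ q) z) \<le> cmod z" by (rule ret(2)) (use H(4) in \<open>auto simp: g_def\<close>)
      thus "cmod ((g ^^ q) z) \<le> r" using z by linarith
    qed
    have conj: "(f ^^ m) (\<psi> \<zeta>) = \<psi> ((g ^^ m) \<zeta>)" for m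
    proof (induction m)
      case (Suc m)
      have "f (\<psi> ((g ^^ m) \<zeta>)) \<in> S" using H(3) gn[of m] \<rho> by simp
      from \<phi>(4)[OF this] have "\<psi> (g ((g ^^ m) \<zeta>)) = f (\<psi> ((g ^^ m) \<zeta>))" by (simp only: gw)
      then show ?case using Suc by simp
    qed simp
    show "(f ^^ n) (\<psi> \<zeta>) \<in> S"
      unfolding conj using \<psi>(2)[of "(g ^^ n) \<zeta>"] gn[of n] \<rho> by simp
  qed
qed

theorem theorem3:
  fixes U W S :: "complex set"
    and f :: "complex \<Rightarrow> complex \<Rightarrow> complex"
    and \<alpha>0 \<gamma> :: real
    and l0 :: complex
    and \<phi> \<psi> :: "complex \<Rightarrow> complex"
    and \<Delta> :: "complex set"
  assumes "open U" "connected U" "0 \<in> U"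
    and "open W" "connected W"
    and "\<alpha>0 \<notin> \<rat>"
    and "analytic_family f W U"
    and "\<And>l. l \<in> W \<Longrightarrow> f l 0 = 0"
    and "\<And>l. l \<in> W \<Longrightarrow> deriv (f l) 0 = l"
    and "l0 = exp (2 * pi * \<i> * \<alpha>0)" "l0 \<in> W"
    and "siegel_point (f l0) U 0"
    and "S = immediate_basin 0 (f l0) U"
    and "S \<subseteq> U" "riemann_sphere frontier_of (to_sphere ` S) \<subseteq> to_sphere ` U"
    and "\<phi> holomorphic_on S" "bij_betw \<phi> S (ball 0 1)"
    and "\<phi> 0 = 0" "deriv \<phi> 0 \<in> \<real>" "Re (deriv \<phi> 0) > 0"
    and "\<And>z. z \<in> S \<Longrightarrow> \<psi> (\<phi> z) = z"
    and "ereal \<gamma> > 1 + max (integral_means_spectrum \<psi> 1) (integral_means_spectrum \<psi> (- 1))"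
    and "stolz_angle l0 \<Delta>"
  shows "\<exists>C>0. \<exists>\<epsilon> :: real \<Rightarrow> real.
    (\<forall>r\<in>{0<..<1}. \<epsilon> r > 0) \<and>
    (\<forall>r\<in>{0<..<1}.
      (\<forall>l\<in>W \<inter> \<Delta>. cmod (l - l0) < \<epsilon> r \<longrightarrow>
        \<psi> ` ball 0 r \<subseteq> immediate_basin 0 (f l) U) \<and>
      \<epsilon> r \<ge> C * (1 - r) ^ 3 / cf_ell \<alpha>0 ((1 - r) powr (- \<gamma>)))"
proof -
  note U = assms(1-3) and W = assms(4) and irr = assms(6) and fam = assms(7)
    and f0 = assms(8) and f1 = assms(9) and l0W = assms(11) and Sdef = assms(13)
    and \<psi>\<phi> = assms(21)
  have l0: "l0 = cis (2 * pi * \<alpha>0)" unfolding assms(10) cis_conv_exp by (simp add: mult_ac)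
  have nl0: "cmod l0 = 1" "l0 \<noteq> 0" by (simp_all add: l0)
  have holU: "f l holomorphic_on U" if "l \<in> W" for l
    using analytic_family_partials(1)[OF fam that] by (auto simp: holomorphic_on_def field_differentiable_at_within)
  have F0: "0 \<in> fatou (f l0) U" using assms(12) by (simp add: siegel_point_def)
  have S: "S = connected_component_set (fatou (f l0) U) 0" using F0 by (simp add: Sdef immediate_basin_def)
  have oS: "open S" unfolding S by (rule open_connected_component[OF open_fatou])
  have S0: "0 \<in> S" using F0 by (simp add: S)
  have SU: "S \<subseteq> U" by (rule assms(14))
  have holS: "f l holomorphic_on S" if "l \<in> W" for l by (rule holomorphic_on_subset[OF holU[OF that] SU])
  have nonconst: "\<not> f l0 constant_on U"
  proof
    assume "f l0 constant_on U"
    then obtain c where c: "\<And>x. x \<in> U \<Longrightarrow> f l0 x = c" by (auto simp: constant_on_def)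
    have "eventually (\<lambda>x. f l0 x = c) (nhds 0)"
      using eventually_nhds_in_open[OF U(1,3)] c by (auto elim!: eventually_mono)
    hence "deriv (f l0) 0 = deriv (\<lambda>x. c) 0" by (intro deriv_cong_ev) auto
    thus False using f1[OF l0W] nl0 by simp
  qed
  have fS: "f l0 ` S \<subseteq> S"
  proof -
    have SF: "S \<subseteq> fatou (f l0) U" unfolding S by (rule connected_component_subset)
    have "connected (f l0 ` S)"
      by (intro connected_continuous_image holomorphic_on_imp_continuous_on holS l0W)
        (simp add: S)
    moreover have "f l0 ` S \<subseteq> fatou (f l0) U"
      using image_in_fatou[OF U(1,2) holU[OF l0W] nonconst] SF by blast
    moreover have "0 \<in> f l0 ` S" using S0 f0[OF l0W] by (metis image_eqI)
    ultimately show ?thesis unfolding S by (intro connected_component_maximal)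
  qed
  have \<phi>1: "cmod (\<phi> z) < 1" if "z \<in> S" for z
    using assms(17) that by (auto simp: bij_betw_def)
  have \<psi>S: "\<psi> u \<in> S \<and> \<phi> (\<psi> u) = u" if "cmod u < 1" for u
  proof -
    have "u \<in> \<phi> ` S" using assms(17) that by (simp add: bij_betw_def)
    thus ?thesis using \<psi>\<phi> by auto
  qed
  have img\<psi>: "\<psi> ` ball 0 1 = S"
  proof
    show "\<psi> ` ball 0 1 \<subseteq> S" using \<psi>S by auto
    show "S \<subseteq> \<psi> ` ball 0 1" using \<psi>\<phi> \<phi>1 by (metis image_eqI mem_ball_0 subsetI)
  qed
  have hol\<psi>: "\<psi> holomorphic_on ball 0 1"
  proof -
    obtain g where g: "g holomorphic_on \<phi> ` S" "\<And>z. z \<in> S \<Longrightarrow> g (\<phi> z) = z"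
      using holomorphic_has_inverse[OF assms(16) oS] assms(17) by (metis bij_betw_def)
    have "\<phi> ` S = ball 0 1" using assms(17) by (simp add: bij_betw_def)
    moreover have "g u = \<psi> u" if "u \<in> ball 0 1" for u using g(2) \<psi>S[of u] that by (metis mem_ball_0)
    ultimately show ?thesis using g(1) holomorphic_transform by metis
  qed
  have inj\<psi>: "inj_on \<psi> (ball 0 1)" using \<psi>S by (intro inj_on_inverseI[where g=\<phi>]) auto
  have \<psi>0: "\<psi> 0 = 0" using \<psi>\<phi>[OF S0] assms(18) by simp
  have rot: "f l0 (\<psi> u) = \<psi> (l0 * u)" if "cmod u < 1" for u
    using rotation_on_siegel_disk[OF oS S0 holS[OF l0W] fS f0[OF l0W] _ assms(16,18) \<phi>1 \<psi>\<phi> hol\<psi> \<psi>S that]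
      f1[OF l0W] nl0 by simp
  obtain K where K: "compact K" "S \<subseteq> K" "K \<subseteq> U"
    using frontier_in_image_imp_compact_superset[OF SU assms(15)] by blast
  have bS: "bounded S" using K bounded_subset compact_imp_bounded by blast
  obtain M \<rho> where M: "M > 0" "\<rho> > 0"
    "\<And>l z. cmod (l - l0) < \<rho> \<Longrightarrow> z \<in> K \<Longrightarrow> cmod (f l z - f l0 z) \<le> M * cmod (l - l0)"
    using analytic_family_lipschitz[OF fam W l0W K(1,3)] by blast
  obtain \<kappa> where \<kappa>: "\<kappa> > 0" "\<And>l. l \<in> \<Delta> \<Longrightarrow> l \<noteq> l0 \<and> Re ((l - l0) / l0) \<le> - \<kappa> * cmod (l - l0)"
    using stolz_angle_Re_bound[OF assms(23) nl0(2)] nl0(1) by metis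
  obtain d where d: "d > 0" "ball 0 d \<subseteq> S" using oS S0 by (meson openE)
  define c where "c = d / 4"
  have c: "c > 0" using d by (simp add: c_def)
  have cball: "ball (\<psi> u) (c * (1 - cmod u)\<^sup>2) \<subseteq> S" if "cmod u < 1" for u
    using univalent_image_contains_ball[OF hol\<psi> inj\<psi> _ that, of d] d(2) by (simp add: \<psi>0 img\<psi> c_def)
  have dphi: "cmod (deriv \<phi> (\<psi> u)) \<le> 2 / (c * (1 - cmod u))" if u: "cmod u < 1" for u
  proof -
    define x where "x = 1 - cmod u"
    have x: "x > 0" using u by (simp add: x_def)
    have "c * x\<^sup>2 * cmod (deriv \<phi> (\<psi> u)) \<le> 1 - (cmod (\<phi> (\<psi> u)))\<^sup>2"
      by (rule schwarz_pick_ball[OF holomorphic_on_subset[OF assms(16) cball[OF u]], folded x_def])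
        (use c x \<phi>1 cball[OF u] in \<open>auto simp: x_def\<close>)
    also have "\<dots> = x * (1 + cmod u)" using \<psi>S[OF u] by (simp add: x_def power2_eq_square algebra_simps)
    also have "\<dots> \<le> x * 2" using x u by (intro mult_left_mono) auto
    finally have "x * (c * x * cmod (deriv \<phi> (\<psi> u))) \<le> x * 2" by (simp add: power2_eq_square mult_ac)
    hence "c * x * cmod (deriv \<phi> (\<psi> u)) \<le> 2" using x by (rule mult_left_le_imp_le)
    thus ?thesis unfolding x_def[symmetric] using c x by (simp add: pos_le_divide_eq mult.commute)
  qed
  have \<gamma>: "ereal \<gamma> > 1 + integral_means_spectrum \<psi> (- 1)"
    by (rule le_less_trans[OF _ assms(22)]) (intro add_left_mono max.cobounded2)
  obtain b where b: "0 \<le> b" "b < \<gamma> - 1"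
    "eventually (\<lambda>s. integral {0..2 * pi} (\<lambda>t. cmod (deriv \<phi> (\<psi> (of_real s * cis t)))) \<le> (1 - s) powr (- b)) (at_left 1)"
    using spectrum_growth_bound[OF oS assms(16) hol\<psi> \<psi>S \<gamma>] by blast
  define ell where "ell r = cf_ell \<alpha>0 ((1 - r) powr (- \<gamma>))" for r
  have ell1: "ell r \<ge> 1" for r
    using cf_ell_convergent[OF irr, of "(1 - r) powr (- \<gamma>)"] unfolding ell_def by (metis of_nat_1 of_nat_mono)
  obtain C r0 where C: "C > 0" "0 < r0" "r0 < 1"
    "\<And>r l g \<zeta> n. r0 \<le> r \<Longrightarrow> r < 1 \<Longrightarrow> l \<noteq> l0 \<Longrightarrow>
       cmod (l - l0) < C * (1 - r) ^ 3 / ell r \<Longrightarrow>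
       Re ((l - l0) / l0) \<le> - \<kappa> * cmod (l - l0) \<Longrightarrow>
       g holomorphic_on S \<Longrightarrow> g 0 = 0 \<Longrightarrow> deriv g 0 = l \<Longrightarrow>
       (\<And>z. z \<in> S \<Longrightarrow> cmod (g z - f l0 z) \<le> M * cmod (l - l0)) \<Longrightarrow>
       cmod \<zeta> \<le> r \<Longrightarrow> (g ^^ n) (\<psi> \<zeta>) \<in> S"
    unfolding ell_def
    using siegel_disk_orbits_stay[OF oS S0 assms(16,18) \<phi>1 \<psi>\<phi> hol\<psi> \<psi>S irr l0 rot c cball dphi b M(1) \<kappa>(1)]
    by blast
  \<comment> \<open>The bound \<open>\<rho>\<close> keeps \<open>l\<close> in the range of the Lipschitz estimate. The last entry serves the radii
\<open>r < r0\<close>, for which the result at \<open>r0\<close> is used, the sets \<open>\<psi> ` ball 0 r\<close> being increasing.\<close>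
  define C' where "C' = min C (min \<rho> (C * (1 - r0) ^ 3 / ell r0))"
  have C': "C' > 0" "C' \<le> C" "C' \<le> \<rho>" "C' \<le> C * (1 - r0) ^ 3 / ell r0"
    using C M ell1[of r0] unfolding C'_def by auto
  define \<epsilon> where "\<epsilon> r = C' * (1 - r) ^ 3 / ell r" for r
  have \<epsilon>C: "\<epsilon> r \<le> C'" if r: "0 < r" "r < 1" for r
  proof -
    have "(1 - r) ^ 3 \<le> 1" using r by (intro power_le_one) auto
    hence "C' * (1 - r) ^ 3 \<le> C' * ell r" using ell1[of r] C' by (intro mult_left_mono) auto
    thus ?thesis using ell1[of r] by (simp add: \<epsilon>_def pos_divide_le_eq)
  qed
  show ?thesis
  proof (intro exI[of _ C'] exI[of _ \<epsilon>] conjI ballI impI)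
    show "C' > 0" by (rule C')
    show "\<epsilon> r > 0" if "r \<in> {0<..<1}" for r using that C' ell1[of r] by (simp add: \<epsilon>_def)
    show "\<epsilon> r \<ge> C' * (1 - r) ^ 3 / cf_ell \<alpha>0 ((1 - r) powr (- \<gamma>))" for r by (simp add: \<epsilon>_def ell_def)
    fix r l assume r: "r \<in> {0<..<1}" and l: "l \<in> W \<inter> \<Delta>" and small: "cmod (l - l0) < \<epsilon> r"
    define r1 where "r1 = max r r0"
    have r1: "r0 \<le> r1" "r1 < 1" "r \<le> r1" using r C by (auto simp: r1_def)
    have lw: "l \<in> W" using l by simp
    have near: "cmod (l - l0) < C * (1 - r1) ^ 3 / ell r1"
    proof (cases "r0 \<le> r")
      case True
      have "\<epsilon> r \<le> C * (1 - r) ^ 3 / ell r"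
        unfolding \<epsilon>_def using C' r ell1[of r] by (intro divide_right_mono mult_right_mono) auto
      thus ?thesis using small True by (simp add: r1_def max_def)
    next
      case False
      hence "r1 = r0" by (simp add: r1_def)
      thus ?thesis using small \<epsilon>C[of r] C'(4) r by auto
    qed
    have orb: "(f l ^^ n) (\<psi> \<zeta>) \<in> S" if "cmod \<zeta> \<le> r1" for \<zeta> n
    proof (rule C(4)[OF r1(1,2) _ near])
      show "l \<noteq> l0" "Re ((l - l0) / l0) \<le> - \<kappa> * cmod (l - l0)" using \<kappa>(2) l by auto
      show "cmod (f l z - f l0 z) \<le> M * cmod (l - l0)" if "z \<in> S" for z
        using M(3)[of l z] small \<epsilon>C[of r] C'(3) r K(2) that by auto
    qed (use holS f0 f1 lw that in auto)
    define V where "V = \<psi> ` ball 0 r1"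
    have sub1: "ball 0 r1 \<subseteq> ball (0::complex) 1" using r1 by (intro subset_ball) auto
    have oV: "open V" unfolding V_def
      by (rule open_mapping_thm3[OF holomorphic_on_subset[OF hol\<psi> sub1] _ inj_on_subset[OF inj\<psi> sub1]]) simp
    have VF: "V \<subseteq> fatou (f l) U"
      by (rule bounded_orbits_subset_fatou[OF oV bS oS SU holS[OF lw]]) (use orb in \<open>auto simp: V_def\<close>)
    have V0: "0 \<in> V" unfolding V_def using \<psi>0 C(2) r1(1) by (intro image_eqI[of _ _ 0]) auto
    have cV: "connected V" unfolding V_def
      by (intro connected_continuous_image holomorphic_on_imp_continuous_on
          holomorphic_on_subset[OF hol\<psi> sub1]) auto
    have "V \<subseteq> connected_component_set (fatou (f l) U) 0"
      by (rule connected_component_maximal[OF V0 cV VF])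
    moreover have "0 \<in> fatou (f l) U" using V0 VF by blast
    ultimately have "V \<subseteq> immediate_basin 0 (f l) U" by (simp add: immediate_basin_def)
    moreover have "\<psi> ` ball 0 r \<subseteq> V" unfolding V_def using r1 by (intro image_mono subset_ball)
    ultimately show "\<psi> ` ball 0 r \<subseteq> immediate_basin 0 (f l) U" by blast
  qed
qed

end
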